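(* Consider the supervised learning problem $\min_{\beta\in\mathcal M}\mathbb E_{(x,y)\sim \mu\times\mathsf D_{y\mid x}}\,\ell(\beta;(x,y))$, denoted $\mathrm{SP}(\mu)$, with fixed conditional law $\mathsf D_{y\mid x}$ of the label, feature distribution $\mu\in\mathcal P_2(\mathbf R^d)$, and fixed parameter $\beta_\star\in\mathcal M$ that minimizes $\mathrm{SP}(\mu)$ for every $\mu$. Let the set of permissible feature distributions be $\mathcal Q=\mathcal P_2(\mathbf R^d)$. Suppose that there is a $C^1$-smooth map $F\colon\mathbf R^d\to\mathbf S^k_+$ such that for every $\mu\in\mathcal P_2(\mathbf R^d)$ the covariant Hessian at $\beta_\star$ of the objective $f_\mu$ of $\mathrm{SP}(\mu)$ satisfies $\nabla^2_{\mathcal M}f_\mu(\beta_\star)=\mathbb E_{x\sim\mu}F(x)$, and that there is a constant $L>0$ with $\|DF(x)\|_{\rm op}\le L(1+\|x\|_2)$ for all $x\in\mathbf R^d$. Suppose there exist $q_1,q_2\in[0,1)$ and constants $a,b>0$ such that for every $\nu\in\mathcal P_2(\mathbf R^d)\setminus\mathcal E$ there is a unit eigenvector $u\in\mathbb S^{k-1}$ of $\mathbb E_\nu F(x)$ corresponding to its minimal eigenvalue satisfying $$a\,\lambda_{\min}(\mathbb E_\nu F(x))^{q_1}\;\le\;\sqrt{\mathbb E_\nu\|DF(x)^*[uu^\top]\|_2^2}\;\le\; b\,\lambda_{\min}(\mathbb E_\nu F(x))^{q_2}.$$ Then there exist constants $C_1,C_2>0$ such that for every $\mu\in\mathcal P_2(\mathbf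 R^d)$, $$C_1\,\mathrm{REG}(\mu)^{q_2-1}\;\le\;\mathrm{RSE}(\mu)\;\le\;C_2\,\mathrm{REG}(\mu)^{q_1-1},$$ where $(+\infty)^{q_i-1}:=0$.
   Context: $\mathcal P_2(\mathbf R^d)$ is the set of Borel probability measures on $\mathbf R^d$ with finite second moment; $W_2(\mu,\nu)=\min_{\pi\in\Pi(\mu,\nu)}(\mathbb E_{(x,y)\sim\pi}\|x-y\|_2^2)^{1/2}$ (minimum over couplings) and $W_2(\mu,\mathcal E)=\inf_{\nu\in\mathcal E}W_2(\mu,\nu)$. $\mathbf S^k$ is the space of real symmetric $k\times k$ matrices with trace inner product, $\mathbf S^k_+$ the PSD cone; $DF(x)\colon\mathbf R^d\to\mathbf S^k$ is the differential and $DF(x)^*\colon\mathbf S^k\to\mathbf R^d$ its adjoint. $\mathcal M$ is a $C^2$ embedded submanifold of a Euclidean space, of dimension $k$, and each objective $f_\mu(\beta)=\mathbb E\,\ell(\beta;(x,y))$ is $C^2$-smooth on $\mathcal M$ (has $C^2$ local extensions to ambient neighborhoods). Covariant Hessian: for $u$ in the tangent space $\mathcal T$ of $\mathcal M$ at $\beta_\star$, $\nabla^2_{\mathcal M}f(\beta_\star)[u,u]=(f\circ\gamma_u)''(0)$ for any $C^2$ curve $\gamma_u$ in $\mathcal M$ with $\gamma_u(0)=\beta_\star$, $\dot\gamma_u(0)=u$ (well defined since $\beta_\star$ is a critical point of $f$ on $\mathcal M$); it is identified with a symmetric $k\times k$ matrix via an orthonormal basis of $\mathcal T$. Tilt-stability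 and REG: a minimizer $\beta_\star$ of $f$ over $\mathcal M$ is tilt-stable if for some $\varepsilon>0$ the map $\sigma(v)=\operatorname{argmin}_{\beta\in\mathcal M\cap B_\varepsilon(\beta_\star)}\{f(\beta)-\langle v,\beta\rangle\}$ satisfies $\sigma(0)=\beta_\star$ and is single-valued and $C^1$-smooth on a neighborhood of the origin; then the regularity modulus is $\mathrm{REG}=\|\nabla\sigma(0)\|_{\rm op}$. If $\beta_\star$ is not tilt-stable, $\mathrm{REG}=+\infty$. $\mathrm{REG}(\mu)$ is the regularity modulus of $\mathrm{SP}(\mu)$ at $\beta_\star$. It is a known fact that $\beta_\star$ is tilt-stable iff $\nabla^2_{\mathcal M}f(\beta_\star)$ is positive definite, in which case $\mathrm{REG}^{-1}=\lambda_{\min}(\nabla^2_{\mathcal M}f(\beta_\star))$. Ill-conditioned set and RSE (supervised): $\mathcal E=\{\mu\in\mathcal Q:\beta_\star\text{ is not a tilt-stable minimizer of }\mathrm{SP}(\mu)\}$ and $\mathrm{RSE}(\mu)=W_2(\mu,\mathcal E)$. *)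

theory Defs
  imports "HOL-Probability.Probability"
begin

definition C1_on :: "'a::real_normed_vector set \<Rightarrow> ('a \<Rightarrow> 'b::real_normed_vector) \<Rightarrow> bool" where
  "C1_on S f \<longleftrightarrow> (\<exists>f' :: 'a \<Rightarrow> 'a \<Rightarrow>\<^sub>L 'b.
     (\<forall>x\<in>S. (f has_derivative blinfun_apply (f' x)) (at x)) \<and> continuous_on S f')"

definition C2_on :: "'a::real_normed_vector set \<Rightarrow> ('a \<Rightarrow> 'b::real_normed_vector) \<Rightarrow> bool" where
  "C2_on S f \<longleftrightarrow> (\<exists>f' :: 'a \<Rightarrow> 'a \<Rightarrow>\<^sub>L 'b.
     (\<forall>x\<in>S. (f has_derivative blinfun_apply (f' x)) (at x)) \<and> C1_on S f')"

text \<open>Embedded submanifold: near each of its points, an ambient \<open>C\<^sup>2\<close> diffeomorphism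
  straightens \<open>M\<close> to a piece of a \<open>k\<close>-dimensional linear subspace.\<close>

definition C2_submanifold :: "nat \<Rightarrow> 'e::euclidean_space set \<Rightarrow> bool" where
  "C2_submanifold k M \<longleftrightarrow> (\<forall>p\<in>M. \<exists>U V \<Phi> \<Psi> S.
     open U \<and> p \<in> U \<and> open V \<and> C2_on U \<Phi> \<and> C2_on V \<Psi> \<and> homeomorphism U V \<Phi> \<Psi> \<and>
     subspace (S :: 'e set) \<and> dim S = k \<and> \<Phi> ` (M \<inter> U) = S \<inter> V)"

definition C2_smooth_on_manifold :: "'e::euclidean_space set \<Rightarrow> ('e \<Rightarrow> real) \<Rightarrow> bool" where
  "C2_smooth_on_manifold M f \<longleftrightarrow> (\<forall>p\<in>M. \<exists>U g.
     open U \<and> p \<in> U \<and> C2_on U g \<and> (\<forall>x\<in>M \<inter> U. g x = f x))"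

definition C2_curve_in :: "'e::euclidean_space set \<Rightarrow> 'e \<Rightarrow> 'e \<Rightarrow> (real \<Rightarrow> 'e) \<Rightarrow> bool" where
  "C2_curve_in M p u \<gamma> \<longleftrightarrow> (\<exists>\<delta>>0. C2_on {-\<delta><..<\<delta>} \<gamma> \<and> \<gamma> ` {-\<delta><..<\<delta>} \<subseteq> M) \<and>
     \<gamma> 0 = p \<and> (\<gamma> has_vector_derivative u) (at 0)"

definition tangent_space :: "'e::euclidean_space set \<Rightarrow> 'e \<Rightarrow> 'e set" where
  "tangent_space M p = {u. \<exists>\<gamma>. C2_curve_in M p u \<gamma>}"

definition orthonormal_basis_of :: "('k::finite \<Rightarrow> 'e::euclidean_space) \<Rightarrow> 'e set \<Rightarrow> bool" where
  "orthonormal_basis_of e T \<longleftrightarrow>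
     (\<forall>i j. e i \<bullet> e j = (if i = j then 1 else 0)) \<and> span (range e) = T"

text \<open>\<open>H\<close> is the matrix, in the orthonormal basis \<open>e\<close> of the tangent space at \<open>p\<close>, of the quadratic
  form sending \<open>u\<close> to the second derivative at \<open>0\<close> of \<open>f\<close> along any \<open>C\<^sup>2\<close> curve in \<open>M\<close>
  with initial velocity \<open>u\<close>; this is meaningful at critical points of \<open>f\<close> on \<open>M\<close>. Since every
  tangent vector is the velocity of such a curve, \<open>H\<close> is unique.\<close>

definition has_covariant_hessian ::
  "'e::euclidean_space set \<Rightarrow> ('e \<Rightarrow> real) \<Rightarrow> 'e \<Rightarrow> ('k::finite \<Rightarrow> 'e) \<Rightarrow> real^'k^'k \<Rightarrow> bool" where
  "has_covariant_hessian M f p e H \<longleftrightarrow> transpose H = H \<and>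
     (\<forall>c \<gamma>. C2_curve_in M p (\<Sum>i\<in>UNIV. (c $ i) *\<^sub>R e i) \<gamma> \<longrightarrow>
        deriv (deriv (f \<circ> \<gamma>)) 0 = c \<bullet> (H *v c))"

text \<open>The inner product of \<^typ>\<open>real^'k^'k\<close> is the trace inner product, and its norm is the
  Frobenius norm. A differential with symmetric values has the same adjoint at symmetric
  matrices whether its codomain is taken to be the symmetric or all matrices.\<close>

definition psd_cone :: "(real^'k^'k) set" where
  "psd_cone = {A. transpose A = A \<and> (\<forall>v. 0 \<le> v \<bullet> (A *v v))}"

definition lambda_min :: "real^'k^'k \<Rightarrow> real" where
  "lambda_min A = Min {c. \<exists>v. v \<noteq> 0 \<and> A *v v = c *\<^sub>R v}"

definition outer_square :: "real^'k \<Rightarrow> real^'k^'k" where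
  "outer_square u = (\<chi> i j. u $ i * u $ j)"

definition tilt_argmin :: "'e::euclidean_space set \<Rightarrow> ('e \<Rightarrow> real) \<Rightarrow> 'e \<Rightarrow> real \<Rightarrow> 'e \<Rightarrow> 'e set" where
  "tilt_argmin M f p \<epsilon> v = {x \<in> M \<inter> cball p \<epsilon>. \<forall>y \<in> M \<inter> cball p \<epsilon>. f x - v \<bullet> x \<le> f y - v \<bullet> y}"

definition is_tilt_map :: "'e::euclidean_space set \<Rightarrow> ('e \<Rightarrow> real) \<Rightarrow> 'e \<Rightarrow> ('e \<Rightarrow> 'e) \<Rightarrow> bool" where
  "is_tilt_map M f p \<sigma> \<longleftrightarrow> \<sigma> 0 = p \<and> (\<exists>\<epsilon>>0. \<exists>\<delta>>0.
     (\<forall>v \<in> ball 0 \<delta>. tilt_argmin M f p \<epsilon> v = {\<sigma> v}) \<and> C1_on (ball 0 \<delta>) \<sigma>)"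

definition tilt_stable :: "'e::euclidean_space set \<Rightarrow> ('e \<Rightarrow> real) \<Rightarrow> 'e \<Rightarrow> bool" where
  "tilt_stable M f p \<longleftrightarrow> (\<exists>\<sigma>. is_tilt_map M f p \<sigma>)"

text \<open>Any two tilt maps agree near the origin, whatever the radii in their definition, so the
  choice of \<open>\<sigma>\<close> does not affect the value.\<close>

definition REG :: "'e::euclidean_space set \<Rightarrow> ('e \<Rightarrow> real) \<Rightarrow> 'e \<Rightarrow> ereal" where
  "REG M f p = (if tilt_stable M f p
     then ereal (onorm (frechet_derivative (SOME \<sigma>. is_tilt_map M f p \<sigma>) (at 0))) else \<infinity>)"

text \<open>Power with the convention that (negative) powers of \<open>\<infinity>\<close> are \<open>0\<close>.\<close>

definition ereal_npowr :: "ereal \<Rightarrow> real \<Rightarrow> real" where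
  "ereal_npowr r s = (if r = \<infinity> then 0 else real_of_ereal r powr s)"

definition P2 :: "'a::euclidean_space measure set" where
  "P2 = {\<mu>. prob_space \<mu> \<and> sets \<mu> = sets borel \<and> integrable \<mu> (\<lambda>x. (norm x)\<^sup>2)}"

definition couplings :: "'a::euclidean_space measure \<Rightarrow> 'a measure \<Rightarrow> ('a \<times> 'a) measure set" where
  "couplings \<mu> \<nu> = {\<pi>. prob_space \<pi> \<and> sets \<pi> = sets (borel \<Otimes>\<^sub>M borel) \<and>
     distr \<pi> borel fst = \<mu> \<and> distr \<pi> borel snd = \<nu>}"

text \<open>Meant for arguments in \<^const>\<open>P2\<close>, where couplings exist, all costs are finite, and the
  infimum is attained.\<close>

definition W2 :: "'a::euclidean_space measure \<Rightarrow> 'a measure \<Rightarrow> real" where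
  "W2 \<mu> \<nu> = (INF \<pi>\<in>couplings \<mu> \<nu>. sqrt (\<integral>z. (norm (fst z - snd z))\<^sup>2 \<partial>\<pi>))"

definition W2_set :: "'a::euclidean_space measure \<Rightarrow> 'a measure set \<Rightarrow> ereal" where
  "W2_set \<mu> E = (INF \<nu>\<in>E. ereal (W2 \<mu> \<nu>))"

text \<open>Joint law of \<open>(x, y)\<close> with \<open>x\<close> distributed as \<open>\<mu>\<close> and \<open>y\<close> given \<open>x\<close> as \<open>D x\<close>; \<open>N\<close> only supplies the
  \<open>\<sigma>\<close>-algebra of the label space.\<close>

definition joint_law ::
  "'y measure \<Rightarrow> ('a::euclidean_space \<Rightarrow> 'y measure) \<Rightarrow> 'a measure \<Rightarrow> ('a \<times> 'y) measure" where
  "joint_law N D \<mu> = \<mu> \<bind> (\<lambda>x. distr (D x) (borel \<Otimes>\<^sub>M N) (Pair x))"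

definition SP_objective ::
  "'y measure \<Rightarrow> ('a::euclidean_space \<Rightarrow> 'y measure) \<Rightarrow> ('e \<Rightarrow> 'a \<times> 'y \<Rightarrow> real) \<Rightarrow>
   'a measure \<Rightarrow> 'e \<Rightarrow> real" where
  "SP_objective N D loss \<mu> \<beta> = (\<integral>z. loss \<beta> z \<partial>joint_law N D \<mu>)"

text \<open>\<open>Q\<close> is the set of permissible distributions and \<open>f \<mu>\<close> the objective at \<open>\<mu>\<close>.\<close>

definition ill_conditioned ::
  "'a measure set \<Rightarrow> 'e::euclidean_space set \<Rightarrow> ('a measure \<Rightarrow> 'e \<Rightarrow> real) \<Rightarrow> 'e \<Rightarrow> 'a measure set" where
  "ill_conditioned Q M f p = {\<mu>\<in>Q. \<not> tilt_stable M (f \<mu>) p}"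

definition RSE ::
  "'a::euclidean_space measure set \<Rightarrow> 'e::euclidean_space set \<Rightarrow> ('a measure \<Rightarrow> 'e \<Rightarrow> real) \<Rightarrow> 'e \<Rightarrow>
   'a measure \<Rightarrow> ereal" where
  "RSE Q M f p \<mu> = W2_set \<mu> (ill_conditioned Q M f p)"

end

(* Let l(mu) be the smallest eigenvalue of E_mu F. In a chart whose differential at the base point
   is the orthonormal frame e, the covariant Hessian is the ordinary Hessian H of the objective, and
   differentiating the first-order condition of the tilted problem at the tilt 0 gives
   D sigma(0) = J H^(-1) J^T with J the frame; conversely a positive definite H yields a C1 solution
   by the inverse function theorem. Hence REG = 1 / l, and the ill-conditioned measures are those
   with l = 0.

   Along the interpolation of a coupling of mu with an ill-conditioned measure, l^(1 - q2) has upper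
   slope at most (1 - q2) b times the transport cost, which bounds the distance from below. For the
   upper bound, mu is moved by maps X in the Hilbert space L2(mu), starting at the identity: the
   field -DF(X)^*[u u^T] decreases l(law of X)^(1 - q1) at rate at least (1 - q1) a per unit of L2
   distance, so a Caristi-type argument, with half this rate, reaches l = 0 within distance
   2 l(mu)^(1 - q1) / ((1 - q1) a). Working with maps avoids gluing of couplings and completeness of
   the Wasserstein space. *)

theory Submission
  imports Defs
begin

subsection \<open>Maps of class C1 and C2\<close>

text \<open>The smallest eigenvalue may fail to be differentiable where it is multiple, and the
  eigenvector granted by the slope hypothesis need not depend continuously on the measure. What
  survives is one-sided: testing with the eigenvector of the base point bounds l from above along
  any line leaving that point. Both halves are arranged so that this upper slope suffices. The lower
  bound on the distance runs its interpolation from the ill-conditioned end, so that the growth of l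
  from 0 is what is controlled; the upper bound takes separate descent steps instead of following a
  flow. The exponent 1 - q makes the rates constant: the derivative of t^(1 - q) is (1 - q) t^(-q),
  which cancels a slope of order l^q. This power is concave, hence below its tangents, so upper
  estimates of l carry over to it even when the new value is 0. The half lost in the descent rate
  pays for a finite step in place of a derivative. On the geometric side, the covariant Hessian
  prescribes only a quadratic form; the full second derivative in the chart follows by polarization
  once it is known to be symmetric.\<close>

lemma C1_onI:
  assumes "\<And>x. x \<in> S \<Longrightarrow> (f has_derivative blinfun_apply (f' x)) (at x)" "continuous_on S f'"
  shows "C1_on S f"
  using assms unfolding C1_on_def by blast

lemma C1_onE:
  assumes "C1_on S f"
  obtains f' where "\<And>x. x \<in> S \<Longrightarrow> (f has_derivative blinfun_apply (f' x)) (at x)"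
    "continuous_on S f'"
  using assms unfolding C1_on_def by blast

lemma C1_on_subset: "C1_on S f \<Longrightarrow> T \<subseteq> S \<Longrightarrow> C1_on T f"
  unfolding C1_on_def by (meson continuous_on_subset subset_iff)

lemma C1_on_continuous:
  assumes "C1_on S f"
  shows "continuous_on S f"
  using assms unfolding C1_on_def
  by (meson continuous_at_imp_continuous_on has_derivative_continuous)

lemma C1_on_const [simp]: "C1_on S (\<lambda>x. c)"
  by (rule C1_onI[where f' = "\<lambda>x. 0"]) (auto simp: zero_blinfun.rep_eq)

lemma C1_on_blinfun: "C1_on S (blinfun_apply L)"
  by (rule C1_onI[where f' = "\<lambda>x. L"])
    (auto simp: bounded_linear_imp_has_derivative blinfun.bounded_linear_right)

lemma C1_on_linear: "bounded_linear L \<Longrightarrow> C1_on S L"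
  using C1_on_blinfun[of S "Blinfun L"] by (simp add: bounded_linear_Blinfun_apply)

lemma C1_on_compose:
  assumes f: "C1_on S f" and g: "C1_on T g" and "f ` S \<subseteq> T"
  shows "C1_on S (\<lambda>x. g (f x))"
proof -
  obtain f' where f': "\<And>x. x \<in> S \<Longrightarrow> (f has_derivative blinfun_apply (f' x)) (at x)"
    "continuous_on S f'" using f by (rule C1_onE) blast
  obtain g' where g': "\<And>x. x \<in> T \<Longrightarrow> (g has_derivative blinfun_apply (g' x)) (at x)"
    "continuous_on T g'" using g by (rule C1_onE) blast
  show ?thesis
  proof (rule C1_onI[where f' = "\<lambda>x. g' (f x) o\<^sub>L f' x"])
    fix x assume "x \<in> S"
    then show "((\<lambda>x. g (f x)) has_derivative blinfun_apply (g' (f x) o\<^sub>L f' x)) (at x)"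
      using has_derivative_compose[OF f'(1)[OF \<open>x \<in> S\<close>] g'(1)[of "f x"]] assms(3)
      by (auto simp: blinfun_compose.rep_eq comp_def)
  next
    show "continuous_on S (\<lambda>x. g' (f x) o\<^sub>L f' x)"
      by (intro bounded_bilinear.continuous_on[OF bounded_bilinear_blinfun_compose]
          continuous_on_compose2[OF g'(2)] C1_on_continuous[OF f] f'(2) assms(3))
  qed
qed

lemma C1_on_bilinear:
  assumes P: "bounded_bilinear P" and f: "C1_on S f" and g: "C1_on S g"
  shows "C1_on S (\<lambda>x. P (f x) (g x))"
proof -
  interpret bounded_bilinear P by fact
  obtain f' where f': "\<And>x. x \<in> S \<Longrightarrow> (f has_derivative blinfun_apply (f' x)) (at x)"
    "continuous_on S f'" using f by (rule C1_onE) blast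
  obtain g' where g': "\<And>x. x \<in> S \<Longrightarrow> (g has_derivative blinfun_apply (g' x)) (at x)"
    "continuous_on S g'" using g by (rule C1_onE) blast
  show ?thesis
  proof (rule C1_onI[where f' = "\<lambda>x. (prod_right (f x) o\<^sub>L g' x) + (prod_left (g x) o\<^sub>L f' x)"])
    fix x assume "x \<in> S"
    then show "((\<lambda>x. P (f x) (g x)) has_derivative
        blinfun_apply ((prod_right (f x) o\<^sub>L g' x) + (prod_left (g x) o\<^sub>L f' x))) (at x)"
      using FDERIV[OF f'(1) g'(1), of x] by (simp add: plus_blinfun.rep_eq)
  next
    show "continuous_on S (\<lambda>x. (prod_right (f x) o\<^sub>L g' x) + (prod_left (g x) o\<^sub>L f' x))"
      by (intro continuous_on_add bounded_bilinear.continuous_on[OF bounded_bilinear_blinfun_compose]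
          bounded_linear.continuous_on[OF bounded_linear_prod_left]
          bounded_linear.continuous_on[OF bounded_linear_prod_right]
          C1_on_continuous[OF f] C1_on_continuous[OF g] f'(2) g'(2))
  qed
qed

lemma C1_on_bounded_linear:
  assumes "bounded_linear L" "C1_on S f"
  shows "C1_on S (\<lambda>x. L (f x))"
  using C1_on_compose[OF assms(2) C1_on_linear[OF assms(1), of UNIV]] by simp

lemma C1_on_add:
  assumes f: "C1_on S f" and g: "C1_on S g"
  shows "C1_on S (\<lambda>x. f x + g x)"
proof -
  obtain f' where f': "\<And>x. x \<in> S \<Longrightarrow> (f has_derivative blinfun_apply (f' x)) (at x)"
    "continuous_on S f'" using f by (rule C1_onE) blast
  obtain g' where g': "\<And>x. x \<in> S \<Longrightarrow> (g has_derivative blinfun_apply (g' x)) (at x)"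
    "continuous_on S g'" using g by (rule C1_onE) blast
  show ?thesis
    by (rule C1_onI[where f' = "\<lambda>x. f' x + g' x"])
      (auto simp: plus_blinfun.rep_eq intro!: has_derivative_add f' g' continuous_on_add)
qed

lemma C1_on_Pair:
  assumes f: "C1_on S f" and g: "C1_on S g"
  shows "C1_on S (\<lambda>x. (f x, g x))"
proof -
  have "C1_on S (\<lambda>x. (f x, 0) + (0, g x))"
    by (intro C1_on_add C1_on_bounded_linear[OF _ f, where L = "\<lambda>a. (a, 0)"]
        C1_on_bounded_linear[OF _ g, where L = "\<lambda>a. (0, a)"])
      (auto intro!: bounded_linear_Pair bounded_linear_ident bounded_linear_zero)
  then show ?thesis by simp
qed

lemma C2_onE:
  assumes "C2_on S f"
  obtains f' where "\<And>x. x \<in> S \<Longrightarrow> (f has_derivative blinfun_apply (f' x)) (at x)" "C1_on S f'"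
  using assms unfolding C2_on_def by blast

lemma C2_onI:
  assumes "\<And>x. x \<in> S \<Longrightarrow> (f has_derivative blinfun_apply (f' x)) (at x)" "C1_on S f'"
  shows "C2_on S f"
  using assms unfolding C2_on_def by blast

lemma C2_on_imp_C1_on: "C2_on S f \<Longrightarrow> C1_on S f"
  unfolding C2_on_def using C1_onI C1_on_continuous by blast

lemma C2_on_subset: "C2_on S f \<Longrightarrow> T \<subseteq> S \<Longrightarrow> C2_on T f"
  unfolding C2_on_def using C1_on_subset by blast

lemma C2_on_affine:
  assumes "bounded_linear L"
  shows "C2_on S (\<lambda>x. a + L x)"
proof (rule C2_onI[where f' = "\<lambda>x. Blinfun L"])
  fix x show "((\<lambda>x. a + L x) has_derivative blinfun_apply (Blinfun L)) (at x)"
    using has_derivative_add[OF has_derivative_const bounded_linear_imp_has_derivative[OF assms]]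
    by (simp add: bounded_linear_Blinfun_apply[OF assms])
qed simp

lemma C2_on_compose:
  assumes f: "C2_on S f" and g: "C2_on T g" and sub: "f ` S \<subseteq> T"
  shows "C2_on S (\<lambda>x. g (f x))"
proof -
  obtain f' where f': "\<And>x. x \<in> S \<Longrightarrow> (f has_derivative blinfun_apply (f' x)) (at x)"
    "C1_on S f'" using f by (rule C2_onE) blast
  obtain g' where g': "\<And>x. x \<in> T \<Longrightarrow> (g has_derivative blinfun_apply (g' x)) (at x)"
    "C1_on T g'" using g by (rule C2_onE) blast
  show ?thesis
  proof (rule C2_onI[where f' = "\<lambda>x. g' (f x) o\<^sub>L f' x"])
    fix x assume "x \<in> S"
    then show "((\<lambda>x. g (f x)) has_derivative blinfun_apply (g' (f x) o\<^sub>L f' x)) (at x)"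
      using has_derivative_compose[OF f'(1)[OF \<open>x \<in> S\<close>] g'(1)[of "f x"]] assms(3)
      by (auto simp: blinfun_compose.rep_eq comp_def)
  next
    show "C1_on S (\<lambda>x. g' (f x) o\<^sub>L f' x)"
      by (intro C1_on_bilinear[OF bounded_bilinear_blinfun_compose] f'(2)
          C1_on_compose[OF C2_on_imp_C1_on[OF f] g'(2) sub])
  qed
qed

section \<open>Local inverses of class C1\<close>

text \<open>C1 asks for derivatives that are continuous in operator norm, also for a local inverse.
  If \<open>z y\<close> solves \<open>A y (z y) = i\<close>, then A y (z y - z y0) = - (A y - A y0)
  (z y0), and the lower bound \<open>m\<close> of \<open>A y0\<close> turns this identity into a
  Lipschitz estimate at \<open>y0\<close>.\<close>

lemma continuous_on_blinfun_inv:
  fixes A :: "'b::metric_space \<Rightarrow> 'a::euclidean_space \<Rightarrow>\<^sub>L 'a"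
  assumes A: "continuous_on V A" and bij: "\<And>y. y \<in> V \<Longrightarrow> bij (blinfun_apply (A y))"
  shows "continuous_on V (\<lambda>y. Blinfun (inv (blinfun_apply (A y))))"
proof (rule continuous_on_blinfun_componentwise)
  fix i :: 'a
  have lin: "bounded_linear (inv (blinfun_apply (A y)))" if "y \<in> V" for y
  proof -
    obtain k where k: "linear k" "\<forall>x. k (A y x) = x" "\<forall>x. A y (k x) = x"
      using linear_injective_isomorphism[of "blinfun_apply (A y)"] bij_is_inj[OF bij[OF \<open>y \<in> V\<close>]]
        blinfun.bounded_linear_right[of "A y"] by (auto simp: linear_conv_bounded_linear)
    then have "inv (blinfun_apply (A y)) = k" by (intro inv_equality) auto
    then show ?thesis using k(1) by (simp add: linear_conv_bounded_linear)
  qed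
  show "continuous_on V (\<lambda>y. blinfun_apply (Blinfun (inv (blinfun_apply (A y)))) i)"
    unfolding continuous_on_def
  proof
    fix y0 assume y0: "y0 \<in> V"
    define z where "z y = inv (blinfun_apply (A y)) i" for y
    have Az: "A y (z y) = i" if "y \<in> V" for y
      using bij[OF that] unfolding z_def by (simp add: bij_is_surj surj_f_inv_f)
    obtain m where m: "m > 0" "\<And>x. norm (A y0 x) \<ge> m * norm x"
      using linear_inj_bounded_below_pos[of "blinfun_apply (A y0)"] bij[OF y0]
      by (metis bij_is_inj bounded_linear.linear blinfun.bounded_linear_right mult.commute)
    have lim: "((\<lambda>y. norm (A y - A y0)) \<longlongrightarrow> 0) (at y0 within V)"
      using A y0 unfolding continuous_on_def by (metis Lim_null tendsto_norm_zero)
    have ev: "eventually (\<lambda>y. norm (z y - z y0) \<le> 2 / m * norm (A y - A y0) * norm (z y0)) (at y0 within V)"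
    proof -
      \<comment> \<open>A perturbation below half of the lower bound is absorbed on the left, which
        leaves the factor 2 / m.\<close>
      have "eventually (\<lambda>y. norm (A y - A y0) < m / 2) (at y0 within V)"
        using order_tendstoD(2)[OF lim, of "m/2"] m(1) by simp
      moreover have "eventually (\<lambda>y. y \<in> V) (at y0 within V)"
        by (simp add: eventually_at_filter)
      ultimately show ?thesis
      proof eventually_elim
        case (elim y)
        let ?d = "z y - z y0"
        have eq: "A y ?d = - ((A y - A y0) (z y0))"
          using Az[OF elim(2)] Az[OF y0] by (simp add: blinfun.diff_right blinfun.diff_left)
        have "m * norm ?d \<le> norm (A y0 ?d)" by (rule m)
        also have "A y0 ?d = A y ?d - (A y - A y0) ?d" by (simp add: blinfun.diff_left)
        also have "norm \<dots> \<le> norm (A y ?d) + norm ((A y - A y0) ?d)" by (rule norm_triangle_ineq4)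
        also have "\<dots> \<le> norm (A y - A y0) * norm (z y0) + m / 2 * norm ?d"
          unfolding eq norm_minus_cancel
          by (intro add_mono norm_blinfun order_trans[OF norm_blinfun] mult_right_mono)
             (use elim(1) in auto)
        finally have "m / 2 * norm ?d \<le> norm (A y - A y0) * norm (z y0)" by simp
        then show ?case using m(1) by (simp add: field_simps)
      qed
    qed
    have "((\<lambda>y. z y - z y0) \<longlongrightarrow> 0) (at y0 within V)"
      by (rule Lim_null_comparison[OF ev]) (intro tendsto_mult_left_zero tendsto_mult_right_zero lim)
    then have "(z \<longlongrightarrow> z y0) (at y0 within V)" by (rule Lim_null[THEN iffD2])
    moreover have eq: "blinfun_apply (Blinfun (inv (blinfun_apply (A y)))) i = z y" if "y \<in> V" for y
      using lin[OF that] by (simp add: z_def bounded_linear_Blinfun_apply)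
    ultimately show "((\<lambda>y. blinfun_apply (Blinfun (inv (blinfun_apply (A y)))) i) \<longlongrightarrow>
        blinfun_apply (Blinfun (inv (blinfun_apply (A y0)))) i) (at y0 within V)"
      unfolding eq[OF y0] by (subst Lim_cong_within[OF refl refl refl eq]) auto
  qed
qed

text \<open>An injective linear map has the left inverse \<open>k\<close> that the inverse function
  theorem asks for; the preceding lemma then makes the pointwise derivatives of the inverse
  continuous.\<close>

lemma C1_inverse_function:
  fixes f :: "'a::euclidean_space \<Rightarrow> 'a"
  assumes "open U" "C1_on U f" "x0 \<in> U" "(f has_derivative D) (at x0)" "inj D"
  obtains V g where "open V" "f x0 \<in> V" "C1_on V g" "g (f x0) = x0"
    "\<And>y. y \<in> V \<Longrightarrow> g y \<in> U \<and> f (g y) = y"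
proof -
  obtain f' where f': "\<And>x. x \<in> U \<Longrightarrow> (f has_derivative blinfun_apply (f' x)) (at x)"
    "continuous_on U f'" using assms(2) by (rule C1_onE) blast
  have D: "D = blinfun_apply (f' x0)"
    using has_derivative_unique[OF assms(4) f'(1)] assms(3) by auto
  obtain k where k: "linear k" "k \<circ> D = id"
    using linear_injective_left_inverse[OF _ assms(5)] assms(4) has_derivative_linear by blast
  have "Blinfun k o\<^sub>L f' x0 = id_blinfun"
    using k D by (auto intro!: blinfun_eqI simp: bounded_linear_Blinfun_apply linear_conv_bounded_linear fun_eq_iff)
  then obtain U' V g g' where g: "open U'" "U' \<subseteq> U" "x0 \<in> U'" "open V" "f x0 \<in> V" "homeomorphism U' V f g"
    "\<And>y. y \<in> V \<Longrightarrow> (g has_derivative (g' y)) (at y)"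
    "\<And>y. y \<in> V \<Longrightarrow> g' y = inv (blinfun_apply (f'(g y)))"
    "\<And>y. y \<in> V \<Longrightarrow> bij (blinfun_apply (f'(g y)))"
    using inverse_function_theorem[OF assms(1) f'(1) f'(2) assms(3)] by metis
  have img: "g ` V = U'" using g(6) by (auto simp: homeomorphism_def)
  have "continuous_on V (\<lambda>y. f' (g y))"
    using continuous_on_compose2[OF f'(2), of V g] g(2,6) img by (auto simp: homeomorphism_def)
  then have "continuous_on V (\<lambda>y. Blinfun (inv (blinfun_apply (f' (g y)))))"
    by (rule continuous_on_blinfun_inv) (use g(9) in auto)
  moreover have "(g has_derivative blinfun_apply (Blinfun (inv (blinfun_apply (f' (g y)))))) (at y)"
    if "y \<in> V" for y
    using g(7)[OF that] g(8)[OF that] has_derivative_bounded_linear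
    by (metis bounded_linear_Blinfun_apply)
  ultimately have "C1_on V g" by (intro C1_onI) auto
  moreover have "g (f x0) = x0" using g(3,6) by (auto simp: homeomorphism_def)
  moreover have "g y \<in> U \<and> f (g y) = y" if "y \<in> V" for y
    using that img g(2,6) by (auto simp: homeomorphism_def)
  ultimately show thesis using that g(4,5) by blast
qed

section \<open>Symmetry of second derivatives\<close>

text \<open>The mean value theorem in direction \<open>u\<close>, applied to the increment of
  \<open>h\<close> in direction \<open>w\<close>, produces a difference of two values of
  \<open>g\<close>; the expansion of \<open>g\<close> at 0 replaces it by
  \<open>s *\<^sub>R B w\<close>. The second difference itself is symmetric in \<open>u\<close> and
  \<open>w\<close>, which is what makes the estimate useful.\<close>

lemma second_difference_approx:
  fixes h :: "'a::euclidean_space \<Rightarrow> real"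
  assumes r: "r > 0" and h: "\<And>x. x \<in> ball 0 r \<Longrightarrow> (h has_derivative (\<lambda>d. g x \<bullet> d)) (at x)"
    and lin: "linear B" and e: "e > 0"
    and B: "\<And>x. norm x < r \<Longrightarrow> norm (g x - g 0 - B x) \<le> e * norm x"
    and s: "0 < s" "s * (norm u + norm w) < r"
  shows "\<bar>h (s *\<^sub>R u + s *\<^sub>R w) - h (s *\<^sub>R u) - h (s *\<^sub>R w) + h 0 - s\<^sup>2 * (B w \<bullet> u)\<bar>
    \<le> 2 * e * s\<^sup>2 * (norm u + norm w)\<^sup>2"
proof -
  let ?N = "norm u + norm w"
  have nb: "norm (\<tau> *\<^sub>R u + c *\<^sub>R w) \<le> s * ?N" if "0 \<le> \<tau>" "\<tau> \<le> s" "0 \<le> c" "c \<le> s" for \<tau> c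
  proof -
    have "norm (\<tau> *\<^sub>R u + c *\<^sub>R w) \<le> \<tau> * norm u + c * norm w"
      using norm_triangle_ineq[of "\<tau> *\<^sub>R u" "c *\<^sub>R w"] that by simp
    also have "\<dots> \<le> s * norm u + s * norm w"
      by (intro add_mono mult_right_mono) (use that in auto)
    finally show ?thesis by (simp add: algebra_simps)
  qed
  \<comment> \<open>The zero multiple of \<open>w\<close> is kept so that both terms follow one
    pattern, with coefficient \<open>s\<close> or 0, to which \<open>nb\<close> applies.\<close>
  define \<phi> where "\<phi> \<tau> = h (\<tau> *\<^sub>R u + s *\<^sub>R w) - h (\<tau> *\<^sub>R u + 0 *\<^sub>R w)" for \<tau>
  have der: "(\<phi> has_derivative (\<lambda>d. g (\<tau> *\<^sub>R u + s *\<^sub>R w) \<bullet> (d *\<^sub>R u) - g (\<tau> *\<^sub>R u + 0 *\<^sub>R w) \<bullet> (d *\<^sub>R u)))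
      (at \<tau> within {0..s})" if \<tau>: "0 \<le> \<tau>" "\<tau> \<le> s" for \<tau>
  proof -
    have 1: "((\<lambda>\<tau>. \<tau> *\<^sub>R u + c *\<^sub>R w) has_derivative (\<lambda>d. d *\<^sub>R u)) (at \<tau> within {0..s})" for c
      by (auto intro!: derivative_eq_intros)
    have "(h has_derivative (\<lambda>d. g (\<tau> *\<^sub>R u + c *\<^sub>R w) \<bullet> d)) (at (\<tau> *\<^sub>R u + c *\<^sub>R w))"
      if "0 \<le> c" "c \<le> s" for c
      by (rule h) (use nb[OF \<tau> that] s in auto)
    from has_derivative_compose[OF 1 this] show ?thesis
      unfolding \<phi>_def using s by (intro has_derivative_diff) (simp_all only: order_refl less_imp_le)
  qed
  obtain \<tau> where \<tau>: "\<tau> \<in> {0<..<s}"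
    "\<phi> s - \<phi> 0 = g (\<tau> *\<^sub>R u + s *\<^sub>R w) \<bullet> ((s - 0) *\<^sub>R u) - g (\<tau> *\<^sub>R u + 0 *\<^sub>R w) \<bullet> ((s - 0) *\<^sub>R u)"
    using mvt_simple[OF s(1) der] by auto
  let ?x = "\<tau> *\<^sub>R u + s *\<^sub>R w" and ?y = "\<tau> *\<^sub>R u + 0 *\<^sub>R w"
  have nx: "norm ?x \<le> s * ?N" "norm ?y \<le> s * ?N" using \<tau> s by (intro nb; auto)+
  have Bxy: "B ?x - B ?y = s *\<^sub>R B w"
    using lin by (simp add: linear_add linear_cmul)
  have "norm (g ?x - g ?y - s *\<^sub>R B w) = norm ((g ?x - g 0 - B ?x) - (g ?y - g 0 - B ?y))"
    using Bxy by (simp add: algebra_simps)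
  also have "\<dots> \<le> e * norm ?x + e * norm ?y"
    by (rule order_trans[OF norm_triangle_ineq4], rule add_mono; rule B) (use nx s in linarith)+
  also have "\<dots> \<le> 2 * e * (s * ?N)"
    using mult_left_mono[OF nx(1) less_imp_le[OF e]] mult_left_mono[OF nx(2) less_imp_le[OF e]] by linarith
  finally have n1: "norm (g ?x - g ?y - s *\<^sub>R B w) \<le> 2 * e * (s * ?N)" .
  have "h (s *\<^sub>R u + s *\<^sub>R w) - h (s *\<^sub>R u) - h (s *\<^sub>R w) + h 0 - s\<^sup>2 * (B w \<bullet> u)
      = s * ((g ?x - g ?y - s *\<^sub>R B w) \<bullet> u)"
    using \<tau>(2) unfolding \<phi>_def by (simp add: inner_diff_left algebra_simps power2_eq_square)
  also have "\<bar>\<dots>\<bar> \<le> s * (2 * e * (s * ?N) * norm u)"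
    using s mult_right_mono[OF n1, of "norm u"] Cauchy_Schwarz_ineq2[of "g ?x - g ?y - s *\<^sub>R B w" u]
    by (auto simp: abs_mult intro!: mult_left_mono)
  also have "\<dots> \<le> s * (2 * e * (s * ?N) * ?N)"
    using s e by (intro mult_left_mono) auto
  finally show ?thesis by (simp add: power2_eq_square algebra_simps)
qed

text \<open>The estimate for (u, w) and the one for (w, u) share the same second difference, so the
  asymmetry of \<open>B\<close> is smaller than any positive constant. It is later used to recover a
  bilinear form from its diagonal values.\<close>

lemma symmetric_second_derivative:
  fixes h :: "'a::euclidean_space \<Rightarrow> real"
  assumes r: "r > 0" and h: "\<And>x. x \<in> ball 0 r \<Longrightarrow> (h has_derivative (\<lambda>d. g x \<bullet> d)) (at x)"
    and B: "(g has_derivative B) (at 0)"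
  shows "B u \<bullet> w = B w \<bullet> u"
proof (rule ccontr)
  assume ne: "B u \<bullet> w \<noteq> B w \<bullet> u"
  define N where "N = norm u + norm w + 1"
  have N: "N > 0" unfolding N_def by (simp add: add_nonneg_pos)
  \<comment> \<open>Each of the two estimates costs at most 2 e s^2 N^2; the 8 makes their sum half
    of the asymmetry. The + 1 in \<open>N\<close> keeps the denominator positive.\<close>
  define e where "e = \<bar>B u \<bullet> w - B w \<bullet> u\<bar> / (8 * N\<^sup>2)"
  have e: "e > 0" using ne N by (simp add: e_def)
  have lin: "linear B" using B by (rule has_derivative_linear)
  obtain d where d: "d > 0" "\<And>x. norm (x - 0) < d \<Longrightarrow> norm (g x - g 0 - B (x - 0)) \<le> e * norm (x - 0)"
    using B e unfolding has_derivative_at_alt by blast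
  define r' where "r' = min r d"
  have r': "r' > 0" using r d by (simp add: r'_def)
  define s where "s = r' / (2 * N)"
  have s: "0 < s" using r' N by (simp add: s_def)
  have "s * (norm u + norm w) \<le> s * N" using s by (simp add: N_def)
  also have "\<dots> < r'" using r' N by (simp add: s_def)
  finally have sN: "s * (norm u + norm w) < r'" .
  have app: "\<bar>h (s *\<^sub>R u + s *\<^sub>R w) - h (s *\<^sub>R u) - h (s *\<^sub>R w) + h 0 - s\<^sup>2 * (B w \<bullet> u)\<bar>
    \<le> 2 * e * s\<^sup>2 * (norm u + norm w)\<^sup>2" if "s * (norm u + norm w) < r'" for u w
    by (rule second_difference_approx[OF r' _ lin e _ s that]) (use h d in \<open>auto simp: r'_def\<close>)
  have "s\<^sup>2 * \<bar>B u \<bullet> w - B w \<bullet> u\<bar> = \<bar>s\<^sup>2 * (B u \<bullet> w) - s\<^sup>2 * (B w \<bullet> u)\<bar>"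
    by (simp add: abs_mult right_diff_distrib[symmetric])
  also have "\<dots> \<le> 4 * e * s\<^sup>2 * (norm u + norm w)\<^sup>2"
    using app[OF sN] app[of w u] sN by (simp add: add.commute)
  also have "\<dots> \<le> 4 * e * s\<^sup>2 * N\<^sup>2"
    using e s by (intro mult_left_mono power_mono) (auto simp: N_def)
  also have "\<dots> = s\<^sup>2 * (\<bar>B u \<bullet> w - B w \<bullet> u\<bar> / 2)"
    using N by (simp add: e_def field_simps)
  finally show False using s ne by simp
qed

subsection \<open>Symmetric matrices and their smallest eigenvalue\<close>

lemma symmetric_matrix_dot:
  fixes A :: "real^'k^'k"
  assumes "transpose A = A"
  shows "x \<bullet> (A *v y) = (A *v x) \<bullet> y"
  using assms by (metis dot_lmul_matrix transpose_matrix_vector)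

text \<open>As a trace inner product the quadratic form is visibly linear in the matrix, so
  expectations and differentials pass through it, and the smallest eigenvalue becomes a minimum of
  linear functionals.\<close>

lemma matrix_quadratic_form:
  fixes A :: "real^'k^'k"
  shows "x \<bullet> (A *v x) = A \<bullet> outer_square x"
  by (simp add: inner_vec_def matrix_vector_mult_def outer_square_def sum_distrib_left mult_ac)

lemma norm_outer_square: "norm (outer_square x) = (norm x)\<^sup>2"
proof -
  have "outer_square x \<bullet> outer_square x = (x \<bullet> x)\<^sup>2"
    by (simp add: inner_vec_def outer_square_def sum_product mult_ac power2_eq_square)
  then show ?thesis
    unfolding norm_eq_sqrt_inner[of "outer_square x"] by (simp add: power2_norm_eq_inner)
qed

text \<open>\<open>Min\<close> in \<open>lambda_min\<close> says something only about a finite set.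
  Eigenvectors chosen for distinct eigenvalues are orthogonal, hence independent, hence finitely
  many.\<close>

lemma finite_eigenvalues_symmetric:
  fixes A :: "real^'k^'k"
  assumes A: "transpose A = A"
  shows "finite {c. \<exists>v. v \<noteq> 0 \<and> A *v v = c *\<^sub>R v}" (is "finite ?E")
proof -
  define w where "w c = (SOME v. v \<noteq> 0 \<and> A *v v = c *\<^sub>R v)" for c
  have w: "w c \<noteq> 0 \<and> A *v w c = c *\<^sub>R w c" if "c \<in> ?E" for c
    unfolding w_def by (rule someI_ex) (use that in simp)
  have orth: "w c \<bullet> w d = 0" if "c \<in> ?E" "d \<in> ?E" "c \<noteq> d" for c d
  proof -
    have "c * (w c \<bullet> w d) = d * (w c \<bullet> w d)"
      using symmetric_matrix_dot[OF A, of "w c" "w d"] w[OF that(1)] w[OF that(2)] by auto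
    then show ?thesis using that(3) by auto
  qed
  have inj: "inj_on w ?E"
  proof (rule inj_onI, rule ccontr)
    fix c d assume cd: "c \<in> ?E" "d \<in> ?E" "w c = w d" "c \<noteq> d"
    then show False using orth[OF cd(1,2,4)] w[OF cd(1)] by simp
  qed
  have "pairwise orthogonal (w ` ?E)"
    unfolding pairwise_def orthogonal_def using orth by blast
  then have "independent (w ` ?E)"
    by (rule pairwise_orthogonal_independent) (use w in force)
  then have "finite (w ` ?E)" by (rule independent_imp_finite)
  then show ?thesis using inj finite_imageD by blast
qed

lemma nonneg_quadratic_imp_zero:
  fixes x y :: real
  assumes "\<And>t. 0 \<le> 2 * t * x + t\<^sup>2 * y"
  shows "x = 0"
proof (rule ccontr)
  assume x: "x \<noteq> 0"
  define k where "k = \<bar>y\<bar> + 1"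
  have k: "k > 0" "y \<le> k" by (auto simp: k_def)
  let ?t = "- x / k"
  have "2 * ?t * x + ?t\<^sup>2 * y \<le> 2 * ?t * x + ?t\<^sup>2 * k"
    using k by (intro add_left_mono mult_left_mono) auto
  also have "\<dots> = - x\<^sup>2 / k"
    using k by (simp add: power2_eq_square field_simps)
  also have "\<dots> < 0" using x k by (simp add: divide_neg_pos)
  finally show False using assms[of ?t] by simp
qed

text \<open>A minimizer of the quadratic form on the compact unit sphere is an eigenvector by its
  first-order condition, and its value bounds every eigenvalue from below. This identifies
  \<open>lambda_min\<close> with the minimum of the Rayleigh quotient.\<close>

lemma symmetric_matrix_min_eigenvector:
  fixes A :: "real^'k^'k"
  assumes A: "transpose A = A"
  obtains u where "norm u = 1" "A *v u = lambda_min A *\<^sub>R u"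
    "\<And>x. lambda_min A * (norm x)\<^sup>2 \<le> x \<bullet> (A *v x)"
proof -
  have "continuous_on (sphere 0 1) (\<lambda>x. x \<bullet> (A *v x))"
    by (intro continuous_intros matrix_vector_mult_linear_continuous_on)
  moreover have "axis undefined 1 \<in> sphere (0::real^'k) 1" by simp
  ultimately obtain u where u: "u \<in> sphere 0 1" "\<And>x. x \<in> sphere 0 1 \<Longrightarrow> u \<bullet> (A *v u) \<le> x \<bullet> (A *v x)"
    using continuous_attains_inf[of "sphere 0 1" "\<lambda>x. x \<bullet> (A *v x)"] compact_sphere by blast
  define c where "c = u \<bullet> (A *v u)"
  have nu: "norm u = 1" using u(1) by simp
  have le: "c * (norm x)\<^sup>2 \<le> x \<bullet> (A *v x)" for x
  proof (cases "x = 0")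
    case False
    have "c \<le> (x /\<^sub>R norm x) \<bullet> (A *v (x /\<^sub>R norm x))"
      unfolding c_def by (rule u(2)) (use False in simp)
    also have "\<dots> = (x \<bullet> (A *v x)) / (norm x)\<^sup>2"
      by (simp add: matrix_vector_mult_scaleR power2_eq_square divide_inverse mult_ac)
    finally show ?thesis using False by (simp add: field_simps)
  qed simp
  have eig: "A *v u = c *\<^sub>R u"
  proof -
    \<comment> \<open>\<open>w\<close> is the residual of the eigenvalue equation. Moving
      \<open>u\<close> along it by \<open>t\<close> gives a nonnegative quadratic in
      \<open>t\<close> with linear coefficient 2 (w . w), which must vanish.\<close>
    define w where "w = A *v u - c *\<^sub>R u"
    have "0 \<le> 2 * t * (w \<bullet> w) + t\<^sup>2 * (w \<bullet> (A *v w) - c * (w \<bullet> w))" for t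
    proof -
      have "(u + t *\<^sub>R w) \<bullet> (A *v (u + t *\<^sub>R w)) - c * (norm (u + t *\<^sub>R w))\<^sup>2 =
          2 * t * (w \<bullet> (A *v u) - c * (w \<bullet> u)) + t\<^sup>2 * (w \<bullet> (A *v w) - c * (w \<bullet> w))"
        using nu symmetric_matrix_dot[OF A, of u w] unfolding power2_norm_eq_inner
        by (simp add: matrix_vector_right_distrib matrix_vector_mult_scaleR inner_add_left
            inner_add_right c_def[symmetric] inner_commute norm_eq_1 power2_eq_square algebra_simps)
      moreover have "w \<bullet> (A *v u) - c * (w \<bullet> u) = w \<bullet> w"
        by (simp add: w_def inner_diff_right)
      ultimately show ?thesis using le[of "u + t *\<^sub>R w"] by simp
    qed
    then have "w \<bullet> w = 0" by (rule nonneg_quadratic_imp_zero)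
    then show ?thesis by (simp add: w_def)
  qed
  have "lambda_min A = c"
    unfolding lambda_min_def
  proof (rule Min_eqI[OF finite_eigenvalues_symmetric[OF A]])
    show "c \<in> {c. \<exists>v. v \<noteq> 0 \<and> A *v v = c *\<^sub>R v}" 
      by (intro CollectI exI[of _ u]) (use eig nu in auto)
    fix y assume "y \<in> {c. \<exists>v. v \<noteq> 0 \<and> A *v v = c *\<^sub>R v}"
    then obtain v where v: "v \<noteq> 0" "A *v v = y *\<^sub>R v" by blast
    then show "c \<le> y" using le[of v] by (simp add: power2_norm_eq_inner)
  qed
  then show thesis using that nu eig le by simp
qed

lemma lambda_min_le:
  assumes "transpose A = A" "norm u = 1"
  shows "lambda_min A \<le> A \<bullet> outer_square u"
  using symmetric_matrix_min_eigenvector[OF assms(1)] assms(2)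
  by (metis matrix_quadratic_form mult.right_neutral power_one)

text \<open>The minimal eigenvector of \<open>B\<close> is a competitor for \<open>A\<close>, and
  its outer square has Frobenius norm 1, so Cauchy-Schwarz gives one inequality; exchanging the
  matrices gives the other.\<close>

lemma lambda_min_Lipschitz:
  assumes A: "transpose A = A" and B: "transpose B = B"
  shows "\<bar>lambda_min A - lambda_min B\<bar> \<le> norm (A - B)"
proof -
  have *: "lambda_min A \<le> lambda_min B + norm (A - B)"
    if A: "transpose A = A" and B: "transpose B = B" for A B :: "real^'a^'a"
  proof -
    obtain u where u: "norm u = 1" "B *v u = lambda_min B *\<^sub>R u"
      using symmetric_matrix_min_eigenvector[OF B] by metis
    have "lambda_min A \<le> A \<bullet> outer_square u" by (rule lambda_min_le[OF A u(1)])
    also have "\<dots> = B \<bullet> outer_square u + (A - B) \<bullet> outer_square u" by (simp add: inner_diff_left)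
    also have "B \<bullet> outer_square u = lambda_min B"
      using u by (simp add: matrix_quadratic_form[symmetric] norm_eq_1)
    also have "(A - B) \<bullet> outer_square u \<le> norm (A - B)"
      using Cauchy_Schwarz_ineq2[of "A - B" "outer_square u"] u by (simp add: norm_outer_square)
    finally show ?thesis by simp
  qed
  show ?thesis using *[OF A B] *[OF B A] by (simp add: norm_minus_commute)
qed

text \<open>Treating the adjoint as bilinear in operator and vector gives access to the product rule
  and to continuity for expressions such as the adjoint of D psi(c) applied to a tilt v, where both
  arguments vary.\<close>

lemma bounded_bilinear_adjoint:
  "bounded_bilinear (\<lambda>X. adjoint (blinfun_apply (X :: 'a::euclidean_space \<Rightarrow>\<^sub>L 'b::euclidean_space)))"
proof -
  have adj: "d \<bullet> adjoint (blinfun_apply X) v = blinfun_apply X d \<bullet> v" for d v and X :: "'a \<Rightarrow>\<^sub>L 'b"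
    by (rule adjoint_works) (simp add: bounded_linear.linear blinfun.bounded_linear_right)
  show ?thesis
  proof
    fix X Y :: "'a \<Rightarrow>\<^sub>L 'b" and v w :: 'b and t :: real
    let ?adj = "\<lambda>X. adjoint (blinfun_apply X)"
    show "?adj (X + Y) v = ?adj X v + ?adj Y v"
      "?adj X (v + w) = ?adj X v + ?adj X w"
      "?adj (t *\<^sub>R X) v = t *\<^sub>R ?adj X v"
      "?adj X (t *\<^sub>R v) = t *\<^sub>R ?adj X v"
      by (subst vector_eq_ldot[symmetric],
          simp add: adj inner_add_right inner_add_left blinfun.add_left blinfun.scaleR_left)+
    have "norm (adjoint (blinfun_apply X) v) \<le> norm X * norm v * 1" for X :: "'a \<Rightarrow>\<^sub>L 'b" and v
    proof (cases "adjoint (blinfun_apply X) v = 0")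
      case False
      let ?y = "adjoint (blinfun_apply X) v"
      have "norm ?y * norm ?y = blinfun_apply X ?y \<bullet> v"
        by (metis adj power2_eq_square power2_norm_eq_inner)
      also have "\<dots> \<le> norm (blinfun_apply X ?y) * norm v" by (rule norm_cauchy_schwarz)
      also have "\<dots> \<le> (norm X * norm ?y) * norm v" by (intro mult_right_mono norm_blinfun) auto
      finally show ?thesis using False by (simp add: mult_ac)
    qed simp
    then show "\<exists>K. \<forall>(X :: 'a \<Rightarrow>\<^sub>L 'b) v. norm (adjoint (blinfun_apply X) v) \<le> norm X * norm v * K" by blast
  qed
qed

lemma adjoint_blinfun_dot:
  fixes X :: "'a::euclidean_space \<Rightarrow>\<^sub>L 'b::euclidean_space"
  shows "adjoint (blinfun_apply X) v \<bullet> d = v \<bullet> blinfun_apply X d"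
  by (metis adjoint_works bounded_linear.linear blinfun.bounded_linear_right inner_commute)

subsection \<open>Charts of an embedded submanifold\<close>

text \<open>For orthonormal \<open>e\<close> this is the isometry J of the overview;
  \<open>coframe e\<close> is its adjoint, the coordinates of the orthogonal projection onto the
  tangent space.\<close>

definition frame :: "('k::finite \<Rightarrow> 'e::euclidean_space) \<Rightarrow> real^'k \<Rightarrow> 'e" where
  "frame e c = (\<Sum>i\<in>UNIV. (c $ i) *\<^sub>R e i)"

definition coframe :: "('k::finite \<Rightarrow> 'e::euclidean_space) \<Rightarrow> 'e \<Rightarrow> real^'k" where
  "coframe e x = (\<chi> i. x \<bullet> e i)"

lemma frame_dot: "frame e c \<bullet> x = c \<bullet> coframe e x"
  by (simp add: frame_def coframe_def inner_vec_def inner_sum_left) (simp add: inner_commute)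

lemma bounded_linear_frame: "bounded_linear (frame e)"
  by (rule linear_conv_bounded_linear[THEN iffD1])
    (auto intro!: linearI simp: frame_def scaleR_left_distrib sum.distrib scaleR_sum_right)

lemma bounded_linear_coframe: "bounded_linear (coframe e)"
  by (rule linear_conv_bounded_linear[THEN iffD1])
    (auto intro!: linearI simp: coframe_def vec_eq_iff inner_add_left)

lemma frame_axis: "frame e (axis i 1) = e i"
  by (simp add: frame_def axis_def if_distrib[of "\<lambda>a. a *\<^sub>R _"] cong: if_cong)

lemma range_frame: "range (frame e) = span (range e)"
proof
  show "range (frame e) \<subseteq> span (range e)"
    unfolding frame_def by (intro image_subsetI span_sum span_scale span_base rangeI)
  have "subspace (range (frame e))"
    using bounded_linear_frame[of e] by (metis bounded_linear.linear subspace_UNIV linear_subspace_image)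
  moreover have "range e \<subseteq> range (frame e)" using frame_axis[of e] by (metis image_subsetI rangeI)
  ultimately show "span (range e) \<subseteq> range (frame e)" by (rule span_minimal[rotated])
qed

lemma coframe_frame:
  assumes "orthonormal_basis_of e T"
  shows "coframe e (frame e c) = c"
  using assms
  by (simp add: frame_def coframe_def orthonormal_basis_of_def inner_sum_left vec_eq_iff
      if_distrib[of "\<lambda>a. _ * a"] cong: if_cong)

lemma frame_coframe:
  assumes "orthonormal_basis_of e T" "x \<in> T"
  shows "frame e (coframe e x) = x"
proof -
  have "x \<in> range (frame e)"
    using assms unfolding range_frame orthonormal_basis_of_def by simp
  then show ?thesis using coframe_frame[OF assms(1)] by auto
qed

lemma norm_frame:
  assumes "orthonormal_basis_of e T"
  shows "norm (frame e c) = norm c"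
  by (simp add: norm_eq_sqrt_inner frame_dot coframe_frame[OF assms])

lemma norm_coframe_le:
  assumes "orthonormal_basis_of e T"
  shows "norm (coframe e x) \<le> norm x"
proof (cases "coframe e x = 0")
  case False
  let ?c = "coframe e x"
  have "norm ?c * norm ?c = frame e ?c \<bullet> x"
    by (simp add: frame_dot power2_norm_eq_inner[symmetric] power2_eq_square)
  also have "\<dots> \<le> norm ?c * norm x"
    using norm_cauchy_schwarz[of "frame e ?c" x] norm_frame[OF assms] by simp
  finally show ?thesis using False by simp
qed simp

lemma ex_orthonormal_basis_of:
  fixes S :: "'e::euclidean_space set"
  assumes "subspace S" "dim S = CARD('k::finite)"
  obtains s :: "'k::finite \<Rightarrow> 'e" where "orthonormal_basis_of s S"
proof -
  obtain B where B: "B \<subseteq> S" "pairwise orthogonal B" "\<And>x. x \<in> B \<Longrightarrow> norm x = 1"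
    "independent B" "card B = dim S" "span B = S"
    using orthonormal_basis_subspace[OF assms(1)] by metis
  have "finite B" using B(4) by (rule independent_imp_finite)
  then obtain s :: "'k \<Rightarrow> 'e" where s: "bij_betw s UNIV B"
    using finite_same_card_bij[of "UNIV :: 'k set" B] B(5) assms(2) by auto
  have "s i \<bullet> s j = (if i = j then 1 else 0)" for i j
    using s B(2,3) unfolding bij_betw_def pairwise_def orthogonal_def
    by (auto simp: inj_eq norm_eq_1)
  moreover have "span (range s) = S" using s B(6) by (simp add: bij_betw_def)
  ultimately show thesis using that unfolding orthonormal_basis_of_def by blast
qed

text \<open>Restricting the inverse of the straightening map to the linear piece, in orthonormal
  coordinates, gives a chart \<open>\<psi>0\<close> with some differential \<open>J0\<close> at 0; a
  linear change of coordinates turns that differential into the frame. The coordinate map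
  \<open>\<kappa>\<close> lives on an ambient open set, so that it can be composed with tilt maps
  and differentiated. The prescribed \<open>W\<close> leaves room for a local extension of the
  objective.\<close>

lemma C2_submanifold_chart:
  fixes e :: "'k::finite \<Rightarrow> 'e::euclidean_space"
  assumes M: "C2_submanifold CARD('k) M" "p \<in> M"
    and e: "orthonormal_basis_of e (tangent_space M p)"
    and W: "open W" "p \<in> W"
  obtains r \<psi> \<kappa> U where "r > 0" "open U" "p \<in> U" "U \<subseteq> W" "C2_on (ball 0 r) (\<psi> :: real^'k \<Rightarrow> 'e)"
    "\<psi> 0 = p" "(\<psi> has_derivative frame e) (at 0)"
    "\<forall>c\<in>ball 0 r. \<psi> c \<in> M \<inter> U \<and> \<kappa> (\<psi> c) = c"
    "\<forall>x\<in>M \<inter> U. \<kappa> x \<in> ball 0 r \<and> \<psi> (\<kappa> x) = x" "C1_on U \<kappa>"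
proof -
  obtain U0 V \<Phi> \<Psi> and S :: "'e set" where ch: "open U0" "p \<in> U0" "open V" "C2_on U0 \<Phi>" "C2_on V \<Psi>"
    "homeomorphism U0 V \<Phi> \<Psi>" "subspace S" "dim S = CARD('k)" "\<Phi> ` (M \<inter> U0) = S \<inter> V"
    using M unfolding C2_submanifold_def by metis
  obtain s :: "'k \<Rightarrow> 'e" where s: "orthonormal_basis_of s S"
    using ex_orthonormal_basis_of[OF ch(7,8)] by metis
  have frS: "frame s c \<in> S" for c
    using s range_frame[of s] by (auto simp: orthonormal_basis_of_def)
  have inv: "\<Psi> (\<Phi> x) = x" "\<Phi> x \<in> V" if "x \<in> U0" for x using ch(6) that by (auto simp: homeomorphism_def)
  have inv': "\<Phi> (\<Psi> y) = y" "\<Psi> y \<in> U0" if "y \<in> V" for y using ch(6) that by (auto simp: homeomorphism_def)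
  define z0 where "z0 = \<Phi> p"
  have z0: "z0 \<in> S" "z0 \<in> V" using ch(2,9) M(2) z0_def by auto
  define \<alpha> where "\<alpha> c = z0 + frame s c" for c
  have \<alpha>S: "\<alpha> c \<in> S" for c using z0 frS ch(7) by (simp add: \<alpha>_def subspace_add)
  have \<alpha>0: "\<alpha> 0 = z0" using bounded_linear_frame[of s] by (simp add: \<alpha>_def linear_0 bounded_linear.linear)
  have \<alpha>C2: "C2_on T \<alpha>" for T unfolding \<alpha>_def by (rule C2_on_affine[OF bounded_linear_frame])
  have "open (\<alpha> -` V)"
    using continuous_open_vimage[OF ch(3)] C1_on_continuous[OF C2_on_imp_C1_on[OF \<alpha>C2]]
    by (metis continuous_on_open_vimage open_UNIV Int_UNIV_right ch(3))
  then obtain r0 where r0: "r0 > 0" "ball 0 r0 \<subseteq> \<alpha> -` V"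
    using z0 \<alpha>0 by (metis openE vimage_eq)
  define \<psi>0 where "\<psi>0 c = \<Psi> (\<alpha> c)" for c
  define \<kappa>0 where "\<kappa>0 x = coframe s (\<Phi> x - z0)" for x
  have \<psi>0C2: "C2_on (ball 0 r0) \<psi>0"
    unfolding \<psi>0_def by (rule C2_on_compose[OF \<alpha>C2 ch(5)]) (use r0 in auto)
  have \<psi>0M: "\<psi>0 c \<in> M \<inter> U0" if "c \<in> ball 0 r0" for c
  proof -
    have "\<alpha> c \<in> \<Phi> ` (M \<inter> U0)" using ch(9) \<alpha>S r0 that by blast
    then show ?thesis using inv unfolding \<psi>0_def by auto
  qed
  have \<psi>00: "\<psi>0 0 = p" using inv ch(2) by (simp add: \<psi>0_def \<alpha>0 z0_def)
  have \<kappa>\<psi>0: "\<kappa>0 (\<psi>0 c) = c" if "c \<in> ball 0 r0" for c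
    using inv' r0 that coframe_frame[OF s] by (auto simp: \<kappa>0_def \<psi>0_def \<alpha>_def subset_iff)
  have \<psi>\<kappa>0: "\<psi>0 (\<kappa>0 x) = x" if "x \<in> M \<inter> U0" for x
  proof -
    have "\<Phi> x \<in> S" using ch(9) that by auto
    then have "frame s (coframe s (\<Phi> x - z0)) = \<Phi> x - z0"
      using frame_coframe[OF s] z0 ch(7) subspace_diff by blast
    then show ?thesis using inv that by (simp add: \<psi>0_def \<kappa>0_def \<alpha>_def)
  qed
  have \<kappa>0C1: "C1_on U0 \<kappa>0"
  proof -
    have "C1_on U0 (\<lambda>x. \<Phi> x + (- z0))" by (intro C1_on_add C2_on_imp_C1_on ch C1_on_const)
    from C1_on_bounded_linear[OF bounded_linear_coframe[of s] this] show ?thesis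
      by (simp add: \<kappa>0_def[abs_def])
  qed
  obtain J0 where J0: "(\<psi>0 has_derivative J0) (at 0)"
    using \<psi>0C2 r0 by (metis C2_onE centre_in_ball)
  have linJ0: "linear J0" using J0 by (rule has_derivative_linear)
  obtain Q where Q: "(\<kappa>0 has_derivative Q) (at p)"
    using \<kappa>0C1 ch(2) by (metis C1_onE)
  have QJ: "Q (J0 c) = c" for c
  proof -
    have "((\<lambda>c. \<kappa>0 (\<psi>0 c)) has_derivative (\<lambda>c. Q (J0 c))) (at 0)"
      by (rule has_derivative_compose[OF J0]) (simp add: \<psi>00 Q)
    moreover have "((\<lambda>c. \<kappa>0 (\<psi>0 c)) has_derivative (\<lambda>c. c)) (at 0)"
      by (rule has_derivative_transform_within_open[OF has_derivative_ident, of "ball 0 r0"])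
        (use r0 \<kappa>\<psi>0 in auto)
    ultimately show ?thesis using has_derivative_unique by metis
  qed
  \<comment> \<open>Lines through 0 in the chart become C2 curves in \<open>M\<close> with velocity
    \<open>J0 c\<close>. The radius \<open>\<delta>\<close> keeps them in the ball, the + 1 covering
    c = 0.\<close>
  have J0T: "J0 c \<in> tangent_space M p" for c
  proof -
    define \<delta> where "\<delta> = r0 / (norm c + 1)"
    have \<delta>: "\<delta> > 0" using r0 by (simp add: \<delta>_def add_nonneg_pos)
    have in_ball: "t *\<^sub>R c \<in> ball 0 r0" if "t \<in> {-\<delta><..<\<delta>}" for t
    proof -
      have "\<bar>t\<bar> * norm c \<le> \<bar>t\<bar> * (norm c + 1)" by (intro mult_left_mono) auto
      also have "\<dots> < \<delta> * (norm c + 1)" using that by (intro mult_strict_right_mono) (auto simp: add_nonneg_pos)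
      also have "\<dots> = r0" by (simp add: \<delta>_def add_nonneg_eq_0_iff)
      finally show ?thesis by simp
    qed
    have "C2_on {-\<delta><..<\<delta>} (\<lambda>t. \<psi>0 (0 + t *\<^sub>R c))"
      by (rule C2_on_compose[OF C2_on_affine[OF bounded_linear_scaleR_left] \<psi>0C2]) (use in_ball in auto)
    moreover have "(\<lambda>t. \<psi>0 (t *\<^sub>R c)) ` {-\<delta><..<\<delta>} \<subseteq> M" using \<psi>0M in_ball by blast
    moreover have "((\<lambda>t. \<psi>0 (t *\<^sub>R c)) has_vector_derivative J0 c) (at 0)"
    proof -
      have 1: "((\<lambda>t. t *\<^sub>R c) has_derivative (\<lambda>t. t *\<^sub>R c)) (at 0)"
        by (auto intro!: derivative_eq_intros)
      have "((\<lambda>t. \<psi>0 (t *\<^sub>R c)) has_derivative (\<lambda>t. J0 (t *\<^sub>R c))) (at 0)"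
        by (rule has_derivative_compose[OF 1]) (simp add: J0)
      then show ?thesis using linJ0 by (simp add: has_vector_derivative_def linear_cmul)
    qed
    ultimately have "C2_curve_in M p (J0 c) (\<lambda>t. \<psi>0 (t *\<^sub>R c))"
      unfolding C2_curve_in_def using \<delta> \<psi>00 by auto
    then show ?thesis unfolding tangent_space_def by blast
  qed
  \<comment> \<open>\<open>R\<close> is \<open>J0\<close> expressed in the basis \<open>e\<close>.
    It is injective because \<open>Q\<close> is a left inverse of \<open>J0\<close>, and it maps
    \<open>real^'k\<close> to itself, so it is invertible; its inverse \<open>k\<close> is the
    change of coordinates.\<close>
  define R where "R c = coframe e (J0 c)" for c
  have linR: "linear R" unfolding R_def
    using linear_compose[OF linJ0 bounded_linear.linear[OF bounded_linear_coframe]] by (simp add: comp_def)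
  have fR: "frame e (R c) = J0 c" for c unfolding R_def by (rule frame_coframe[OF e J0T])
  have "inj R" using fR QJ by (metis injI)
  then obtain k where k: "linear k" "\<And>x. k (R x) = x" "\<And>x. R (k x) = x"
    using linear_injective_isomorphism[OF linR] by metis
  have bk: "bounded_linear k" using k(1) by (simp add: linear_conv_bounded_linear)
  define \<psi> where "\<psi> c = \<psi>0 (k c)" for c
  define \<kappa> where "\<kappa> x = R (\<kappa>0 x)" for x
  have openk: "open (k -` ball 0 r0)"
    using bk by (metis bounded_linear_def continuous_open_vimage linear_continuous_at open_ball)
  have \<psi>C2: "C2_on (k -` ball 0 r0) \<psi>"
  proof -
    have "C2_on (k -` ball 0 r0) (\<lambda>c. \<psi>0 (0 + k c))"
      by (rule C2_on_compose[OF C2_on_affine[OF bk] \<psi>0C2]) auto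
    then show ?thesis by (simp add: \<psi>_def[abs_def])
  qed
  have "open (k -` ball 0 r0 \<inter> \<psi> -` W)"
    by (rule continuous_open_preimage[OF C1_on_continuous[OF C2_on_imp_C1_on[OF \<psi>C2]] openk W(1)])
  moreover have k0: "k 0 = 0" using k(1) by (simp add: linear_0)
  moreover have \<psi>0p: "\<psi> 0 = p" by (simp add: \<psi>_def k0 \<psi>00)
  ultimately obtain r where r: "r > 0" "ball 0 r \<subseteq> k -` ball 0 r0 \<inter> \<psi> -` W"
    using r0 W(2) by (metis IntI centre_in_ball openE vimage_eq)
  have \<kappa>C1: "C1_on U0 \<kappa>"
    unfolding \<kappa>_def using C1_on_bounded_linear[OF _ \<kappa>0C1] linR by (simp add: linear_conv_bounded_linear)
  define U where "U = (U0 \<inter> W) \<inter> \<kappa> -` ball 0 r"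
  have "open U" unfolding U_def
    by (rule continuous_open_preimage[OF C1_on_continuous[OF C1_on_subset[OF \<kappa>C1]]]) (use ch W in auto)
  have \<kappa>\<psi>: "\<kappa> (\<psi> c) = c" if "c \<in> ball 0 r" for c
    using r that \<kappa>\<psi>0[of "k c"] k by (auto simp: \<kappa>_def \<psi>_def subset_iff)
  have \<psi>M: "\<psi> c \<in> M \<inter> U" if "c \<in> ball 0 r" for c
  proof -
    have "k c \<in> ball 0 r0" "\<psi> c \<in> W" using r that by auto
    then have "\<psi> c \<in> M \<inter> U0 \<inter> W" using \<psi>0M by (simp add: \<psi>_def)
    then show ?thesis using \<kappa>\<psi>[OF that] that by (simp add: U_def)
  qed
  show thesis
  proof (rule that[of r U \<psi> \<kappa>])
    show "r > 0" "open U" "\<psi> 0 = p" by fact+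
    show "p \<in> U" using \<psi>M[of 0] r \<psi>0p by simp
    show "U \<subseteq> W" by (auto simp: U_def)
    show "C2_on (ball 0 r) \<psi>" by (rule C2_on_subset[OF \<psi>C2]) (use r in auto)
    have "(\<psi> has_derivative (\<lambda>c. J0 (k c))) (at 0)"
      unfolding \<psi>_def by (rule has_derivative_compose[OF bounded_linear_imp_has_derivative[OF bk]])
        (simp add: k0 J0)
    moreover have "(\<lambda>c. J0 (k c)) = frame e" using fR k by (metis ext)
    ultimately show "(\<psi> has_derivative frame e) (at 0)" by simp
    show "\<forall>c\<in>ball 0 r. \<psi> c \<in> M \<inter> U \<and> \<kappa> (\<psi> c) = c" using \<psi>M \<kappa>\<psi> by blast
    show "\<forall>x\<in>M \<inter> U. \<kappa> x \<in> ball 0 r \<and> \<psi> (\<kappa> x) = x"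
      using k \<psi>\<kappa>0 by (auto simp: U_def \<psi>_def \<kappa>_def)
    show "C1_on U \<kappa>" by (rule C1_on_subset[OF \<kappa>C1]) (auto simp: U_def)
  qed
qed

subsection \<open>Tilt stability in a chart\<close>

lemma adjoint_frame: "adjoint (frame e) = coframe e"
  by (rule adjoint_unique) (simp add: frame_dot)

text \<open>On the segment from the critical point \<open>c0\<close> to \<open>c\<close>, the slope
  of the function starts at 0 and has positive derivative, so it is positive afterwards.\<close>

lemma strict_minimum_of_monotone_gradient:
  fixes \<phi> :: "'a::euclidean_space \<Rightarrow> real"
  assumes \<phi>: "\<And>c. c \<in> ball 0 \<rho> \<Longrightarrow> (\<phi> has_derivative (\<lambda>d. G c \<bullet> d)) (at c)"
    and G: "\<And>c. c \<in> ball 0 \<rho> \<Longrightarrow> \<exists>Q. (G has_derivative Q) (at c) \<and> (\<forall>d. d \<noteq> 0 \<longrightarrow> Q d \<bullet> d > 0)"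
    and c0: "c0 \<in> ball 0 \<rho>" "G c0 = 0" and c: "c \<in> ball 0 \<rho>" "c \<noteq> c0"
  shows "\<phi> c0 < \<phi> c"
proof -
  define d where "d = c - c0"
  have d: "d \<noteq> 0" using c by (simp add: d_def)
  have seg: "c0 + t *\<^sub>R d \<in> ball 0 \<rho>" if "0 \<le> t" "t \<le> 1" for t
  proof -
    have "(1 - t) *\<^sub>R c0 + t *\<^sub>R c \<in> ball 0 \<rho>"
      by (rule convexD_alt[OF convex_ball c0(1) c(1)]) (use that in auto)
    then show ?thesis by (simp add: d_def algebra_simps)
  qed
  have line: "((\<lambda>t. c0 + t *\<^sub>R d) has_derivative (\<lambda>t. t *\<^sub>R d)) (at t)" for t
    by (auto intro!: derivative_eq_intros)
  have slope_pos: "G (c0 + t *\<^sub>R d) \<bullet> d > 0" if t: "0 < t" "t \<le> 1" for t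
  proof -
    have "G (c0 + 0 *\<^sub>R d) \<bullet> d < G (c0 + t *\<^sub>R d) \<bullet> d"
    proof (rule DERIV_pos_imp_increasing[OF t(1), of "\<lambda>t. G (c0 + t *\<^sub>R d) \<bullet> d"])
      fix x assume x: "0 \<le> x" "x \<le> t"
      obtain Q where Q: "(G has_derivative Q) (at (c0 + x *\<^sub>R d))" "\<forall>d. d \<noteq> 0 \<longrightarrow> Q d \<bullet> d > 0"
        using G[OF seg] x t by (meson order_trans)
      have "((\<lambda>t. G (c0 + t *\<^sub>R d) \<bullet> d) has_derivative (\<lambda>t. Q (t *\<^sub>R d) \<bullet> d)) (at x)"
        by (intro has_derivative_inner_left has_derivative_compose[OF line] Q)
      then have "((\<lambda>t. G (c0 + t *\<^sub>R d) \<bullet> d) has_real_derivative Q d \<bullet> d) (at x)"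
        using has_derivative_linear[OF Q(1)]
        by (simp add: has_field_derivative_def linear_cmul mult_commute_abs)
      then show "\<exists>y. ((\<lambda>t. G (c0 + t *\<^sub>R d) \<bullet> d) has_real_derivative y) (at x) \<and> 0 < y"
        using Q d by blast
    qed
    then show ?thesis using c0 by simp
  qed
  have der: "((\<lambda>t. \<phi> (c0 + t *\<^sub>R d)) has_real_derivative G (c0 + t *\<^sub>R d) \<bullet> d) (at t)"
    if "0 \<le> t" "t \<le> 1" for t
  proof -
    have "((\<lambda>t. \<phi> (c0 + t *\<^sub>R d)) has_derivative (\<lambda>s. G (c0 + t *\<^sub>R d) \<bullet> (s *\<^sub>R d))) (at t)"
      by (rule has_derivative_compose[OF line \<phi>[OF seg[OF that]]])
    then show ?thesis by (simp add: has_field_derivative_def mult_commute_abs)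
  qed
  have "\<phi> (c0 + 0 *\<^sub>R d) < \<phi> (c0 + 1 *\<^sub>R d)"
  proof (rule DERIV_pos_imp_increasing_open[of 0 1 "\<lambda>t. \<phi> (c0 + t *\<^sub>R d)"])
    show "\<exists>y. ((\<lambda>t. \<phi> (c0 + t *\<^sub>R d)) has_real_derivative y) (at x) \<and> 0 < y" if "0 < x" "x < 1" for x
      using der[of x] slope_pos[of x] that by auto
    show "continuous_on {0..1} (\<lambda>t. \<phi> (c0 + t *\<^sub>R d))"
      by (intro continuous_at_imp_continuous_on ballI DERIV_isCont[OF der]) auto
  qed simp
  then show ?thesis by (simp add: d_def)
qed

text \<open>Regularity is assumed of the pullback f o psi: off \<open>M\<close> the objective is
  arbitrary, and only its local extensions are smooth there.\<close>

locale tilt_chart =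
  fixes M :: "'e::euclidean_space set" and f :: "'e \<Rightarrow> real" and p :: 'e
    and e :: "'k::finite \<Rightarrow> 'e" and T :: "'e set" and H :: "real^'k^'k"
    and r :: real and U :: "'e set" and \<psi> :: "real^'k \<Rightarrow> 'e" and \<kappa> :: "'e \<Rightarrow> real^'k"
  assumes r: "r > 0" and U: "open U" "p \<in> U"
    and \<psi>_C2: "C2_on (ball 0 r) \<psi>" and \<psi>0: "\<psi> 0 = p"
    and d\<psi>0: "(\<psi> has_derivative frame e) (at 0)"
    and \<psi>_in: "\<And>c. c \<in> ball 0 r \<Longrightarrow> \<psi> c \<in> M \<inter> U \<and> \<kappa> (\<psi> c) = c"
    and \<kappa>_in: "\<And>x. x \<in> M \<inter> U \<Longrightarrow> \<kappa> x \<in> ball 0 r \<and> \<psi> (\<kappa> x) = x"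
    and \<kappa>_C1: "C1_on U \<kappa>"
    and f_C2: "C2_on (ball 0 r) (\<lambda>c. f (\<psi> c))"
    and basis: "orthonormal_basis_of e T"
    and f_min: "\<And>x. x \<in> M \<Longrightarrow> f p \<le> f x"
    and hess: "has_covariant_hessian M f p e H"
begin

lemma \<kappa>p: "\<kappa> p = 0"
  using \<psi>_in[of 0] \<psi>0 r by simp

lemma H_sym: "transpose H = H"
  using hess unfolding has_covariant_hessian_def by blast

text \<open>Since the differential of the chart at 0 is the frame, the image of the line t c is an
  admissible curve for the covariant Hessian with coordinate velocity \<open>c\<close>. The second
  derivative along it is then an ordinary one.\<close>

lemma second_derivative_along_line:
  assumes g: "\<And>c. c \<in> ball 0 r \<Longrightarrow> ((\<lambda>c. f (\<psi> c)) has_derivative (\<lambda>d. g c \<bullet> d)) (at c)"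
    and B: "(g has_derivative B) (at 0)"
  shows "B c \<bullet> c = c \<bullet> (H *v c)"
proof -
  let ?\<gamma> = "\<lambda>t. \<psi> (t *\<^sub>R c)"
  define \<delta> where "\<delta> = r / (norm c + 1)"
  have \<delta>: "\<delta> > 0" using r by (simp add: \<delta>_def add_nonneg_pos)
  have in_ball: "t *\<^sub>R c \<in> ball 0 r" if "t \<in> {-\<delta><..<\<delta>}" for t
  proof -
    have "\<bar>t\<bar> * norm c \<le> \<bar>t\<bar> * (norm c + 1)" by (intro mult_left_mono) auto
    also have "\<dots> < \<delta> * (norm c + 1)" using that by (intro mult_strict_right_mono) (auto simp: add_nonneg_pos)
    also have "\<dots> = r" by (simp add: \<delta>_def add_nonneg_eq_0_iff)
    finally show ?thesis by simp
  qed
  have line: "((\<lambda>t. t *\<^sub>R c) has_derivative (\<lambda>t. t *\<^sub>R c)) (at t)" for t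
    by (auto intro!: derivative_eq_intros)
  have "C2_on {-\<delta><..<\<delta>} (\<lambda>t. \<psi> (0 + t *\<^sub>R c))"
    by (rule C2_on_compose[OF C2_on_affine[OF bounded_linear_scaleR_left] \<psi>_C2]) (use in_ball in auto)
  moreover have "?\<gamma> ` {-\<delta><..<\<delta>} \<subseteq> M" using \<psi>_in in_ball by blast
  moreover have "(?\<gamma> has_vector_derivative frame e c) (at 0)"
  proof -
    have "(?\<gamma> has_derivative (\<lambda>t. frame e (t *\<^sub>R c))) (at 0)"
      by (rule has_derivative_compose[OF line]) (simp add: d\<psi>0)
    then show ?thesis using bounded_linear_frame[of e]
      by (simp add: has_vector_derivative_def linear_cmul bounded_linear.linear)
  qed
  ultimately have "C2_curve_in M p (\<Sum>i\<in>UNIV. (c $ i) *\<^sub>R e i) ?\<gamma>"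
    unfolding C2_curve_in_def using \<delta> \<psi>0 by (auto simp: frame_def)
  then have hessian: "deriv (deriv (f \<circ> ?\<gamma>)) 0 = c \<bullet> (H *v c)"
    using hess unfolding has_covariant_hessian_def by blast
  have d1: "deriv (f \<circ> ?\<gamma>) t = g (t *\<^sub>R c) \<bullet> c" if "t \<in> {-\<delta><..<\<delta>}" for t
  proof (rule DERIV_imp_deriv)
    have "((\<lambda>t. f (\<psi> (t *\<^sub>R c))) has_derivative (\<lambda>s. g (t *\<^sub>R c) \<bullet> (s *\<^sub>R c))) (at t)"
      by (rule has_derivative_compose[OF line g[OF in_ball[OF that]]])
    then show "((f \<circ> ?\<gamma>) has_field_derivative g (t *\<^sub>R c) \<bullet> c) (at t)"
      unfolding has_field_derivative_def comp_def by (simp add: mult_commute_abs)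
  qed
  have "((\<lambda>t. g (t *\<^sub>R c)) has_derivative (\<lambda>t. B (t *\<^sub>R c))) (at 0)"
    by (rule has_derivative_compose[OF line]) (simp add: B)
  then have "((\<lambda>t. g (t *\<^sub>R c) \<bullet> c) has_derivative (\<lambda>t. B (t *\<^sub>R c) \<bullet> c)) (at 0)"
    by (rule has_derivative_inner_left)
  then have "((\<lambda>t. g (t *\<^sub>R c) \<bullet> c) has_field_derivative B c \<bullet> c) (at 0)"
    using has_derivative_linear[OF B]
    by (simp add: has_field_derivative_def linear_cmul mult_commute_abs)
  \<comment> \<open>The inner \<open>deriv\<close> is known only for times within
    \<open>\<delta>\<close>, so the outer one is computed from a function that agrees near
    0.\<close>
  moreover have "eventually (\<lambda>t. deriv (f \<circ> ?\<gamma>) t = g (t *\<^sub>R c) \<bullet> c) (nhds 0)"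
    using eventually_nhds_in_open[of "{-\<delta><..<\<delta>}" 0] \<delta> d1 by (auto elim: eventually_mono)
  ultimately have "(deriv (f \<circ> ?\<gamma>) has_field_derivative B c \<bullet> c) (at 0)"
    by (subst DERIV_cong_ev[OF refl _ refl])
  then have "deriv (deriv (f \<circ> ?\<gamma>)) 0 = B c \<bullet> c" by (rule DERIV_imp_deriv)
  with hessian show ?thesis by simp
qed

text \<open>Minimality of \<open>p\<close> kills the gradient at 0. Its derivative there has the
  diagonal values of \<open>H\<close>, and both forms are symmetric, so polarization identifies
  them.\<close>

lemma gradient_exists:
  obtains g where "\<And>c. c \<in> ball 0 r \<Longrightarrow> ((\<lambda>c. f (\<psi> c)) has_derivative (\<lambda>d. g c \<bullet> d)) (at c)"
    "C1_on (ball 0 r) g" "g 0 = 0" "(g has_derivative (\<lambda>d. H *v d)) (at 0)"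
proof -
  obtain h' where h': "\<And>c. c \<in> ball 0 r \<Longrightarrow> ((\<lambda>c. f (\<psi> c)) has_derivative blinfun_apply (h' c)) (at c)"
    "C1_on (ball 0 r) h'" using f_C2 by (rule C2_onE) blast
  \<comment> \<open>The adjoint of a functional at the real number 1 is its Riesz
    representative.\<close>
  define g where "g c = adjoint (blinfun_apply (h' c)) 1" for c
  have gd: "((\<lambda>c. f (\<psi> c)) has_derivative (\<lambda>d. g c \<bullet> d)) (at c)" if "c \<in> ball 0 r" for c
    using h'(1)[OF that] by (simp add: g_def adjoint_blinfun_dot)
  have gC1: "C1_on (ball 0 r) g"
    using C1_on_bilinear[OF bounded_bilinear_adjoint h'(2) C1_on_const] by (simp add: g_def[abs_def])
  have "(\<lambda>d. g 0 \<bullet> d) = (\<lambda>d. 0)"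
  proof (rule differential_zero_maxmin[where S = "ball 0 r"])
    show "((\<lambda>c. f (\<psi> c)) has_derivative (\<lambda>d. g 0 \<bullet> d)) (at 0)" using gd r by simp
    show "(\<forall>y\<in>ball 0 r. f (\<psi> y) \<le> f (\<psi> 0)) \<or> (\<forall>y\<in>ball 0 r. f (\<psi> 0) \<le> f (\<psi> y))"
      using f_min \<psi>_in \<psi>0 by simp
  qed (use r in auto)
  then have g0: "g 0 = 0" by (metis inner_eq_zero_iff)
  obtain B where B: "(g has_derivative B) (at 0)" using gC1 r by (metis C1_onE centre_in_ball)
  have linB: "linear B" using B by (rule has_derivative_linear)
  have Bsym: "B u \<bullet> w = B w \<bullet> u" for u w
    by (rule symmetric_second_derivative[OF r gd B])
  have BH: "B c \<bullet> c = c \<bullet> (H *v c)" for c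
    by (rule second_derivative_along_line[OF gd B])
  have "B u \<bullet> w = (H *v u) \<bullet> w" for u w
    using BH[of "u + w"] BH[of u] BH[of w] Bsym[of u w] symmetric_matrix_dot[OF H_sym, of u w] linB
    by (simp add: linear_add inner_add_left inner_add_right matrix_vector_right_distrib inner_commute)
  then have "B = (\<lambda>d. H *v d)" by (metis ext vector_eq_rdot)
  then have B': "(g has_derivative (\<lambda>d. H *v d)) (at 0)" using B by simp
  show thesis by (rule that, erule gd, rule gC1, rule g0, rule B')
qed

text \<open>At a tilt map \<open>\<sigma>\<close> the first-order condition reads \<open>\<nabla>(f \<circ> \<psi>)(\<kappa> (\<sigma> v)) = D\<psi>(\<kappa> (\<sigma> v))\<^sup>* v\<close>;
  it is differentiated at \<open>v = 0\<close>.\<close>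

lemma tilt_map_derivative:
  assumes "is_tilt_map M f p \<sigma>"
  obtains Z where "\<And>v. H *v Z v = coframe e v" "(\<sigma> has_derivative (\<lambda>v. frame e (Z v))) (at 0)"
proof -
  obtain \<epsilon> \<delta> where \<sigma>: "\<sigma> 0 = p" "\<epsilon> > 0" "\<delta> > 0" "\<And>v. v \<in> ball 0 \<delta> \<Longrightarrow> tilt_argmin M f p \<epsilon> v = {\<sigma> v}"
    "C1_on (ball 0 \<delta>) \<sigma>"
    using assms unfolding is_tilt_map_def by blast
  obtain g where g: "\<And>c. c \<in> ball 0 r \<Longrightarrow> ((\<lambda>c. f (\<psi> c)) has_derivative (\<lambda>d. g c \<bullet> d)) (at c)"
    "C1_on (ball 0 r) g" "g 0 = 0" "(g has_derivative (\<lambda>d. H *v d)) (at 0)"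
    using gradient_exists by blast
  obtain \<psi>' where \<psi>': "\<And>c. c \<in> ball 0 r \<Longrightarrow> (\<psi> has_derivative blinfun_apply (\<psi>' c)) (at c)"
    "C1_on (ball 0 r) \<psi>'" using \<psi>_C2 by (rule C2_onE) blast
  have \<psi>'0: "blinfun_apply (\<psi>' 0) = frame e"
    using has_derivative_unique[OF \<psi>'(1) d\<psi>0] r by simp
  define z where "z v = \<kappa> (\<sigma> v)" for v
  obtain S0 where S0: "(\<sigma> has_derivative S0) (at 0)" using \<sigma>(3,5) by (metis C1_onE centre_in_ball)
  obtain K0 where K0: "(\<kappa> has_derivative K0) (at p)" using \<kappa>_C1 U by (metis C1_onE)
  have dz: "(z has_derivative (\<lambda>v. K0 (S0 v))) (at 0)"
    unfolding z_def[abs_def] by (rule has_derivative_compose[OF S0]) (simp add: \<sigma> K0)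
  have z0: "z 0 = 0" by (simp add: z_def \<sigma> \<kappa>p)
  \<comment> \<open>For these tilts the minimizer lies in the chart domain and strictly inside the
    truncation ball, so it is an interior minimizer in coordinates.\<close>
  define O1 where "O1 = ball 0 \<delta> \<inter> \<sigma> -` (U \<inter> ball p \<epsilon>)"
  have O1: "open O1" unfolding O1_def
    by (rule continuous_open_preimage[OF C1_on_continuous[OF \<sigma>(5)]]) (use U in auto)
  have O10: "0 \<in> O1" using \<sigma> U by (simp add: O1_def)
  have in_M: "\<sigma> v \<in> M \<inter> U" if "v \<in> O1" for v
    using \<sigma>(4)[of v] that by (auto simp: O1_def tilt_argmin_def)
  have crit: "g (z v) = adjoint (blinfun_apply (\<psi>' (z v))) v" if v: "v \<in> O1" for v
  proof -
    have zr: "z v \<in> ball 0 r" "\<psi> (z v) = \<sigma> v" using \<kappa>_in in_M[OF v] by (auto simp: z_def)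
    define S where "S = ball 0 r \<inter> \<psi> -` ball p \<epsilon>"
    have "open S" unfolding S_def
      by (rule continuous_open_preimage[OF C1_on_continuous[OF C2_on_imp_C1_on[OF \<psi>_C2]]]) auto
    have zS: "z v \<in> S" using zr v by (simp add: S_def O1_def)
    have arg: "\<sigma> v \<in> tilt_argmin M f p \<epsilon> v" using \<sigma>(4)[of v] v by (simp add: O1_def)
    have min: "f (\<psi> (z v)) - v \<bullet> \<psi> (z v) \<le> f (\<psi> c) - v \<bullet> \<psi> c" if "c \<in> S" for c
      using arg that \<psi>_in[of c] unfolding tilt_argmin_def zr(2) S_def by force
    have "((\<lambda>c. f (\<psi> c) - v \<bullet> \<psi> c) has_derivative (\<lambda>d. g (z v) \<bullet> d - v \<bullet> blinfun_apply (\<psi>' (z v)) d)) (at (z v))"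
      by (intro has_derivative_diff g(1) has_derivative_inner_right \<psi>'(1) zr)
    then have "(\<lambda>d. g (z v) \<bullet> d - v \<bullet> blinfun_apply (\<psi>' (z v)) d) = (\<lambda>d. 0)"
      by (rule differential_zero_maxmin[OF zS \<open>open S\<close>]) (use min in blast)
    then have "g (z v) \<bullet> d = adjoint (blinfun_apply (\<psi>' (z v))) v \<bullet> d" for d
      by (simp add: adjoint_blinfun_dot fun_eq_iff)
    then show ?thesis by (metis vector_eq_rdot)
  qed
  obtain P where P: "(\<psi>' has_derivative P) (at 0)" using \<psi>'(2) r by (metis C1_onE centre_in_ball)
  have L: "((\<lambda>v. g (z v)) has_derivative (\<lambda>v. H *v (K0 (S0 v)))) (at 0)"
    by (rule has_derivative_compose[OF dz]) (simp add: z0 g(4))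
  have P': "((\<lambda>v. \<psi>' (z v)) has_derivative (\<lambda>v. P (K0 (S0 v)))) (at 0)"
    by (rule has_derivative_compose[OF dz]) (simp add: z0 P)
  \<comment> \<open>In the product rule the term that differentiates \<open>\<psi>'\<close> is
    paired with the tilt 0 and drops out, leaving the adjoint of the frame.\<close>
  have R: "((\<lambda>v. adjoint (blinfun_apply (\<psi>' (z v))) v) has_derivative
      (\<lambda>v. adjoint (blinfun_apply (\<psi>' (z 0))) v + adjoint (blinfun_apply (P (K0 (S0 v)))) 0)) (at 0)"
    by (rule bounded_bilinear.FDERIV[OF bounded_bilinear_adjoint P' has_derivative_ident])
  have "((\<lambda>v. g (z v)) has_derivative
      (\<lambda>v. adjoint (blinfun_apply (\<psi>' (z 0))) v + adjoint (blinfun_apply (P (K0 (S0 v)))) 0)) (at 0)"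
    by (rule has_derivative_transform_within_open[OF R O1 O10]) (simp add: crit)
  from has_derivative_unique[OF L this]
  have "H *v (K0 (S0 v)) = coframe e v" for v
    by (simp add: z0 \<psi>'0 adjoint_frame fun_eq_iff bounded_bilinear.zero_right[OF bounded_bilinear_adjoint])
  moreover have "(\<sigma> has_derivative (\<lambda>v. frame e (K0 (S0 v)))) (at 0)"
  proof (rule has_derivative_transform_within_open[OF _ O1 O10])
    show "((\<lambda>v. \<psi> (z v)) has_derivative (\<lambda>v. frame e (K0 (S0 v)))) (at 0)"
      by (rule has_derivative_compose[OF dz]) (simp add: z0 d\<psi>0)
    show "\<psi> (z v) = \<sigma> v" if "v \<in> O1" for v using \<kappa>_in in_M[OF that] by (simp add: z_def)
  qed
  ultimately show thesis by (rule that)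
qed

text \<open>The derivative of the tilted gradient is H plus two errors: the variation of
  \<open>g'\<close> near 0, and the second derivative of the chart paired with the tilt. Each is
  kept to half of the smallest eigenvalue, uniformly over small points and small tilts, the second
  one strictly.\<close>

lemma strongly_monotone_gradient:
  assumes pos: "lambda_min H > 0"
    and g: "C1_on (ball 0 r) g" "(g has_derivative (\<lambda>d. H *v d)) (at 0)"
    and \<psi>': "C1_on (ball 0 r) \<psi>'"
  shows "\<exists>\<rho>>0. \<exists>\<delta>>0. \<rho> \<le> r \<and> (\<forall>v c. norm v < \<delta> \<longrightarrow> c \<in> ball 0 \<rho> \<longrightarrow>
      (\<exists>Q. ((\<lambda>c. g c - adjoint (blinfun_apply (\<psi>' c :: (real^'k) \<Rightarrow>\<^sub>L 'e)) v) has_derivative Q) (at c) \<and>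
          (\<forall>d. d \<noteq> 0 \<longrightarrow> Q d \<bullet> d > 0)))"
proof -
  obtain g' where g': "\<And>c. c \<in> ball 0 r \<Longrightarrow> (g has_derivative blinfun_apply (g' c)) (at c)"
    "continuous_on (ball 0 r) g'" using g(1) by (rule C1_onE) blast
  obtain \<psi>'' where \<psi>'': "\<And>c. c \<in> ball 0 r \<Longrightarrow> (\<psi>' has_derivative blinfun_apply (\<psi>'' c)) (at c)"
    "continuous_on (ball 0 r) \<psi>''" using \<psi>' by (rule C1_onE) blast
  define l where "l = lambda_min H"
  define k where "k = norm (\<psi>'' 0) + 1"
  have k: "k > 0" by (simp add: k_def add_nonneg_pos)
  have g'0: "blinfun_apply (g' 0) = (\<lambda>d. H *v d)"
    using has_derivative_unique[OF g'(1) g(2)] r by simp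
  have "isCont g' 0" "isCont \<psi>'' 0"
    using g'(2) \<psi>''(2) r by (auto simp: continuous_on_eq_continuous_at)
  moreover have "l / 2 > 0" using pos by (simp add: l_def)
  ultimately have "\<exists>s>0. \<forall>c. dist c 0 < s \<longrightarrow> dist (g' c) (g' 0) < l / 2"
    "\<exists>s>0. \<forall>c. dist c 0 < s \<longrightarrow> dist (\<psi>'' c) (\<psi>'' 0) < 1"
    using zero_less_one unfolding continuous_at_eps_delta by blast+
  then obtain s1 s2 where s: "s1 > 0" "\<And>c. norm c < s1 \<Longrightarrow> norm (g' c - g' 0) < l / 2"
    "s2 > 0" "\<And>c. norm c < s2 \<Longrightarrow> norm (\<psi>'' c - \<psi>'' 0) < 1" unfolding dist_norm by auto
  define \<rho> where "\<rho> = min r (min s1 s2)"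
  \<comment> \<open>\<open>k\<close> bounds the second derivative of the chart on the ball, so tilts
    shorter than l / (2 k) contribute less than l / 2.\<close>
  define \<delta> where "\<delta> = l / (2 * k)"
  have "0 < \<rho>" "0 < \<delta>" using r s pos k by (auto simp: \<rho>_def \<delta>_def l_def)
  moreover have "\<rho> \<le> r \<and> (\<forall>v c. norm v < \<delta> \<longrightarrow> c \<in> ball 0 \<rho> \<longrightarrow>
      (\<exists>Q. ((\<lambda>c. g c - adjoint (blinfun_apply (\<psi>' c)) v) has_derivative Q) (at c) \<and>
          (\<forall>d. d \<noteq> 0 \<longrightarrow> Q d \<bullet> d > 0)))"
  proof (intro conjI allI impI)
    show "\<rho> \<le> r" by (simp add: \<rho>_def)
    fix v :: 'e and c assume v: "norm v < \<delta>" and c: "c \<in> ball (0 :: real^'k) \<rho>"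
    have cr: "c \<in> ball 0 r" using c by (simp add: \<rho>_def)
    let ?Q = "\<lambda>d. blinfun_apply (g' c) d - (adjoint (blinfun_apply (\<psi>' c)) 0 + adjoint (blinfun_apply (blinfun_apply (\<psi>'' c) d)) v)"
    have "((\<lambda>c. g c - adjoint (blinfun_apply (\<psi>' c)) v) has_derivative ?Q) (at c)"
      by (intro has_derivative_diff g'(1) cr
          bounded_bilinear.FDERIV[OF bounded_bilinear_adjoint \<psi>''(1) has_derivative_const])
    moreover have "?Q d \<bullet> d > 0" if "d \<noteq> 0" for d
    proof -
      obtain u where "\<And>x. l * (norm x)\<^sup>2 \<le> x \<bullet> (H *v x)"
        using symmetric_matrix_min_eigenvector[OF H_sym] unfolding l_def by metis
      then have "l * (norm d)\<^sup>2 \<le> blinfun_apply (g' 0) d \<bullet> d"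
        by (simp add: g'0 inner_commute)
      also have "\<dots> = blinfun_apply (g' c) d \<bullet> d - blinfun_apply (g' c - g' 0) d \<bullet> d"
        by (simp add: blinfun.diff_left inner_diff_left)
      also have "\<dots> \<le> blinfun_apply (g' c) d \<bullet> d + l / 2 * (norm d)\<^sup>2"
      proof -
        have "\<bar>blinfun_apply (g' c - g' 0) d \<bullet> d\<bar> \<le> norm (blinfun_apply (g' c - g' 0) d) * norm d"
          by (rule Cauchy_Schwarz_ineq2)
        also have "\<dots> \<le> (norm (g' c - g' 0) * norm d) * norm d"
          by (intro mult_right_mono norm_blinfun) auto
        also have "\<dots> \<le> (l / 2 * norm d) * norm d"
          by (intro mult_right_mono) (use s(2)[of c] c in \<open>auto simp: \<rho>_def\<close>)
        finally show ?thesis by (simp add: power2_eq_square)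
      qed
      finally have 1: "l / 2 * (norm d)\<^sup>2 \<le> blinfun_apply (g' c) d \<bullet> d" by simp
      have "adjoint (blinfun_apply (blinfun_apply (\<psi>'' c) d)) v \<bullet> d = v \<bullet> blinfun_apply (blinfun_apply (\<psi>'' c) d) d"
        by (rule adjoint_blinfun_dot)
      also have "\<dots> \<le> norm v * norm (blinfun_apply (blinfun_apply (\<psi>'' c) d) d)"
        by (rule norm_cauchy_schwarz)
      also have "\<dots> \<le> norm v * ((norm (\<psi>'' c) * norm d) * norm d)"
        by (intro mult_left_mono order_trans[OF norm_blinfun] mult_right_mono norm_blinfun) auto
      also have "\<dots> \<le> norm v * ((k * norm d) * norm d)"
      proof -
        have "norm (\<psi>'' c) \<le> k"
          using s(4)[of c] c norm_triangle_sub[of "\<psi>'' c" "\<psi>'' 0"] by (simp add: \<rho>_def k_def)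
        then show ?thesis by (intro mult_left_mono mult_right_mono) auto
      qed
      also have "\<dots> < \<delta> * ((k * norm d) * norm d)"
        using v k that by (intro mult_strict_right_mono) auto
      also have "\<dots> = l / 2 * (norm d)\<^sup>2" using k by (simp add: \<delta>_def power2_eq_square)
      finally show ?thesis using 1
        by (simp add: inner_diff_left inner_add_left bounded_bilinear.zero_right[OF bounded_bilinear_adjoint])
    qed
    ultimately show "\<exists>Q. ((\<lambda>c. g c - adjoint (blinfun_apply (\<psi>' c)) v) has_derivative Q) (at c) \<and>
          (\<forall>d. d \<noteq> 0 \<longrightarrow> Q d \<bullet> d > 0)" by blast
  qed
  ultimately show ?thesis by blast
qed

text \<open>The first-order condition is solved for the point as a C1 function of the tilt. Local
  strict monotonicity of the tilted gradient then makes this critical point the unique minimizer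
  over a whole truncated piece of \<open>M\<close>.\<close>

lemma tilt_stable_of_pos:
  assumes pos: "lambda_min H > 0"
  shows "tilt_stable M f p"
proof -
  obtain g where g: "\<And>c. c \<in> ball 0 r \<Longrightarrow> ((\<lambda>c. f (\<psi> c)) has_derivative (\<lambda>d. g c \<bullet> d)) (at c)"
    "C1_on (ball 0 r) g" "g 0 = 0" "(g has_derivative (\<lambda>d. H *v d)) (at 0)"
    using gradient_exists by blast
  obtain \<psi>' where \<psi>': "\<And>c. c \<in> ball 0 r \<Longrightarrow> (\<psi> has_derivative blinfun_apply (\<psi>' c)) (at c)"
    "C1_on (ball 0 r) \<psi>'" using \<psi>_C2 by (rule C2_onE) blast
  have \<psi>'0: "blinfun_apply (\<psi>' 0) = frame e"
    using has_derivative_unique[OF \<psi>'(1) d\<psi>0] r by simp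
  define A where "A c v = adjoint (blinfun_apply (\<psi>' c)) v" for c v
  \<comment> \<open>Carrying the tilt along as a second component makes an implicit equation a
    matter of inverting \<open>G\<close>, whose differential at the origin is block triangular with
    diagonal blocks H and the identity.\<close>
  define G where "G y = (g (fst y) - A (fst y) (snd y), snd y)" for y :: "(real^'k) \<times> 'e"
  have GC1: "C1_on (ball 0 r \<times> UNIV) G"
  proof -
    have fst: "C1_on (ball 0 r \<times> UNIV) (fst :: (real^'k) \<times> 'e \<Rightarrow> _)" by (intro C1_on_linear bounded_linear_fst)
    have snd: "C1_on (ball 0 r \<times> UNIV) (snd :: (real^'k) \<times> 'e \<Rightarrow> _)" by (intro C1_on_linear bounded_linear_snd)
    have "C1_on (ball 0 r \<times> UNIV) (\<lambda>y. A (fst y) (snd y))"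
      unfolding A_def
      by (intro C1_on_bilinear[OF bounded_bilinear_adjoint] C1_on_compose[OF fst \<psi>'(2)] snd) auto
    then have "C1_on (ball 0 r \<times> UNIV) (\<lambda>y. (g (fst y) + - 1 *\<^sub>R A (fst y) (snd y), snd y))"
      by (intro C1_on_Pair C1_on_add C1_on_compose[OF fst g(2)] snd
          C1_on_bounded_linear[OF bounded_linear_scaleR_right]) auto
    then show ?thesis by (simp add: G_def[abs_def])
  qed
  obtain P where P: "(\<psi>' has_derivative P) (at 0)" using \<psi>'(2) r by (metis C1_onE centre_in_ball)
  have dG: "(G has_derivative (\<lambda>y. (H *v fst y - (A 0 (snd y) + adjoint (blinfun_apply (P (fst y))) 0), snd y))) (at (0,0))"
  proof -
    have fst: "(fst has_derivative fst) (at (0::real^'k, 0::'e))" and snd: "(snd has_derivative snd) (at (0::real^'k, 0::'e))"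
      by (auto intro!: derivative_eq_intros)
    have 1: "((\<lambda>y. g (fst y)) has_derivative (\<lambda>y. H *v fst y)) (at (0::real^'k, 0::'e))"
      by (rule has_derivative_compose[OF fst]) (simp add: g(4))
    have 2: "((\<lambda>y. \<psi>' (fst y)) has_derivative (\<lambda>y. P (fst y))) (at (0::real^'k, 0::'e))"
      by (rule has_derivative_compose[OF fst]) (simp add: P)
    show ?thesis unfolding G_def[abs_def] A_def
      using has_derivative_Pair[OF has_derivative_diff[OF 1 bounded_bilinear.FDERIV[OF bounded_bilinear_adjoint 2 snd]] snd]
      by simp
  qed
  have A0: "A c 0 = 0" for c by (simp add: A_def bounded_bilinear.zero_right[OF bounded_bilinear_adjoint])
  have Hinj: "x = 0" if "H *v x = 0" for x
  proof -
    have "lambda_min H * (norm x)\<^sup>2 \<le> x \<bullet> (H *v x)"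
      using symmetric_matrix_min_eigenvector[OF H_sym] by metis
    then show ?thesis using that pos by (simp add: mult_le_0_iff)
  qed
  have "inj (\<lambda>y. (H *v fst y - (A 0 (snd y) + adjoint (blinfun_apply (P (fst y))) 0), snd y))"
  proof (rule injI)
    fix x y :: "(real^'k) \<times> 'e"
    assume "(H *v fst x - (A 0 (snd x) + adjoint (blinfun_apply (P (fst x))) 0), snd x) =
      (H *v fst y - (A 0 (snd y) + adjoint (blinfun_apply (P (fst y))) 0), snd y)"
    then have "H *v (fst x - fst y) = 0" "snd x = snd y"
      by (auto simp: bounded_bilinear.zero_right[OF bounded_bilinear_adjoint] matrix_vector_mult_diff_distrib)
    then show "x = y" using Hinj[of "fst x - fst y"] by (simp add: prod_eq_iff)
  qed
  then obtain V0 \<Gamma> where \<Gamma>: "open V0" "G (0,0) \<in> V0" "C1_on V0 \<Gamma>" "\<Gamma> (G (0,0)) = (0,0)"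
    "\<And>y. y \<in> V0 \<Longrightarrow> \<Gamma> y \<in> ball 0 r \<times> UNIV \<and> G (\<Gamma> y) = y"
    using C1_inverse_function[OF _ GC1 _ dG] r by (auto simp: open_Times)
  have G0: "G (0,0) = (0,0)" by (simp add: G_def g A0)
  define z where "z v = fst (\<Gamma> (0, v))" for v
  define V where "V = (\<lambda>v. (0 :: real^'k, v)) -` V0"
  have "open V" unfolding V_def
    by (rule continuous_open_vimage[OF \<Gamma>(1)]) (auto intro!: continuous_intros)
  have zC1: "C1_on V z"
  proof -
    have "C1_on V (\<lambda>v. \<Gamma> (0, v))"
      by (rule C1_on_compose[OF C1_on_linear \<Gamma>(3)])
        (auto simp: V_def intro!: bounded_linear_Pair bounded_linear_zero bounded_linear_ident)
    from C1_on_bounded_linear[OF bounded_linear_fst this] show ?thesis by (simp add: z_def[abs_def])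
  qed
  have z0: "z 0 = 0" using \<Gamma>(4) by (simp add: z_def G0)
  have z: "z v \<in> ball 0 r \<and> g (z v) - A (z v) v = 0" if "v \<in> V" for v
    using \<Gamma>(5)[of "(0, v)"] that by (auto simp: V_def z_def G_def mem_Times_iff prod_eq_iff)
  obtain \<rho> \<delta>1 where mono: "0 < \<rho>" "0 < \<delta>1" "\<rho> \<le> r"
    "\<forall>v c. norm v < \<delta>1 \<longrightarrow> c \<in> ball 0 \<rho> \<longrightarrow>
      (\<exists>Q. ((\<lambda>c. g c - A c v) has_derivative Q) (at c) \<and> (\<forall>d. d \<noteq> 0 \<longrightarrow> Q d \<bullet> d > 0))"
    using strongly_monotone_gradient[OF pos g(2,4) \<psi>'(2)] unfolding A_def by blast
  \<comment> \<open>The truncation radius is fixed after \<open>\<rho>\<close>, so that every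
    competitor in the truncated problem has coordinates where the monotonicity holds.\<close>
  have "open (U \<inter> \<kappa> -` ball 0 \<rho>)"
    by (rule continuous_open_preimage[OF C1_on_continuous[OF \<kappa>_C1] U(1)]) auto
  then obtain \<epsilon> where \<epsilon>: "\<epsilon> > 0" "cball p \<epsilon> \<subseteq> U \<inter> \<kappa> -` ball 0 \<rho>"
    using open_contains_cball U(2) \<kappa>p mono(1) by (metis IntI centre_in_ball vimage_eq)
  define \<sigma> where "\<sigma> v = \<psi> (z v)" for v
  have \<sigma>C1: "C1_on V \<sigma>" unfolding \<sigma>_def
    by (rule C1_on_compose[OF zC1 C2_on_imp_C1_on[OF \<psi>_C2]]) (use z in auto)
  define O2 where "O2 = (V \<inter> z -` ball 0 \<rho>) \<inter> (V \<inter> \<sigma> -` ball p \<epsilon>) \<inter> ball 0 \<delta>1"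
  have "open O2" unfolding O2_def
    by (intro open_Int continuous_open_preimage[OF C1_on_continuous[OF zC1]]
        continuous_open_preimage[OF C1_on_continuous[OF \<sigma>C1]] \<open>open V\<close> open_ball)
  moreover have "0 \<in> O2" using \<Gamma>(2) mono \<epsilon> by (simp add: O2_def z0 \<sigma>_def \<psi>0 V_def G0)
  ultimately obtain \<delta> where \<delta>: "\<delta> > 0" "ball 0 \<delta> \<subseteq> O2" by (meson openE)
  have "tilt_argmin M f p \<epsilon> v = {\<sigma> v}" if "v \<in> ball 0 \<delta>" for v
  proof -
    have v: "v \<in> V" "z v \<in> ball 0 \<rho>" "\<sigma> v \<in> ball p \<epsilon>" "norm v < \<delta>1" using \<delta> that by (auto simp: O2_def)
    have \<sigma>M: "\<sigma> v \<in> M \<inter> cball p \<epsilon>" using \<psi>_in[of "z v"] z[OF v(1)] v(3) by (simp add: \<sigma>_def less_imp_le)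
    have strict: "f (\<sigma> v) - v \<bullet> \<sigma> v < f y - v \<bullet> y" if y: "y \<in> M \<inter> cball p \<epsilon>" "y \<noteq> \<sigma> v" for y
    proof -
      have y': "\<kappa> y \<in> ball 0 \<rho>" "\<psi> (\<kappa> y) = y" using y \<epsilon> \<kappa>_in by auto
      have der: "((\<lambda>c. f (\<psi> c) - v \<bullet> \<psi> c) has_derivative (\<lambda>d. (g c - A c v) \<bullet> d)) (at c)"
        if "c \<in> ball 0 \<rho>" for c
      proof -
        have "((\<lambda>c. f (\<psi> c) - v \<bullet> \<psi> c) has_derivative (\<lambda>d. g c \<bullet> d - v \<bullet> blinfun_apply (\<psi>' c) d)) (at c)"
          by (intro has_derivative_diff g(1) has_derivative_inner_right \<psi>'(1)) (use that mono in auto)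
        then show ?thesis by (simp add: A_def inner_diff_left adjoint_blinfun_dot)
      qed
      have "f (\<psi> (z v)) - v \<bullet> \<psi> (z v) < f (\<psi> (\<kappa> y)) - v \<bullet> \<psi> (\<kappa> y)"
        by (rule strict_minimum_of_monotone_gradient[OF der mono(4)[rule_format, OF v(4)] v(2) _ y'(1)])
          (use z[OF v(1)] y y' in \<open>auto simp: \<sigma>_def\<close>)
      then show ?thesis by (simp add: \<sigma>_def y')
    qed
    show ?thesis unfolding tilt_argmin_def
    proof (intro equalityI subsetI)
      fix x assume "x \<in> {x \<in> M \<inter> cball p \<epsilon>. \<forall>y\<in>M \<inter> cball p \<epsilon>. f x - v \<bullet> x \<le> f y - v \<bullet> y}"
      then show "x \<in> {\<sigma> v}" using strict[of x] \<sigma>M by force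
    next
      fix x assume "x \<in> {\<sigma> v}"
      then show "x \<in> {x \<in> M \<inter> cball p \<epsilon>. \<forall>y\<in>M \<inter> cball p \<epsilon>. f x - v \<bullet> x \<le> f y - v \<bullet> y}"
        using strict \<sigma>M by (auto intro: less_imp_le) (metis less_imp_le order_refl IntI mem_cball)
    qed
  qed
  moreover have "C1_on (ball 0 \<delta>) \<sigma>" by (rule C1_on_subset[OF \<sigma>C1]) (use \<delta> in \<open>auto simp: O2_def\<close>)
  moreover have "\<sigma> 0 = p" by (simp add: \<sigma>_def z0 \<psi>0)
  ultimately have "is_tilt_map M f p \<sigma>" unfolding is_tilt_map_def using \<delta>(1) \<epsilon>(1) by blast
  then show ?thesis unfolding tilt_stable_def by blast
qed

text \<open>The derivative of the tilt map is the frame applied to \<open>Z\<close>, with H Z equal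
  to the coframe. Testing at the frame image of a minimal eigenvector gives l (u . Z) = 1, which
  excludes l = 0 and bounds the norm from below; the Rayleigh bound at \<open>Z v\<close> gives the
  opposite inequality.\<close>

lemma pos_of_tilt_map:
  assumes \<sigma>: "is_tilt_map M f p \<sigma>" and psd: "H \<in> psd_cone"
  shows "lambda_min H > 0" "onorm (frechet_derivative \<sigma> (at 0)) = 1 / lambda_min H"
proof -
  obtain Z where Z: "\<And>v. H *v Z v = coframe e v" "(\<sigma> has_derivative (\<lambda>v. frame e (Z v))) (at 0)"
    using tilt_map_derivative[OF \<sigma>] by blast
  obtain u where u: "norm u = 1" "H *v u = lambda_min H *\<^sub>R u"
    "\<And>x. lambda_min H * (norm x)\<^sup>2 \<le> x \<bullet> (H *v x)"
    using symmetric_matrix_min_eigenvector[OF H_sym] by metis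
  define l where "l = lambda_min H"
  have Zu: "H *v Z (frame e x) = x" for x using Z coframe_frame[OF basis] by simp
  have luZ: "l * (u \<bullet> Z (frame e u)) = 1"
    using symmetric_matrix_dot[OF H_sym, of u "Z (frame e u)"] u by (simp add: Zu l_def norm_eq_1)
  have "u \<bullet> (H *v u) = l" using u by (simp add: l_def norm_eq_1)
  then have "l \<ge> 0" using psd unfolding psd_cone_def by fastforce
  moreover have "l \<noteq> 0" using luZ by auto
  ultimately have l: "l > 0" by simp
  then show "lambda_min H > 0" by (simp add: l_def)
  have fd: "frechet_derivative \<sigma> (at 0) = (\<lambda>v. frame e (Z v))"
    using frechet_derivative_at[OF Z(2)] by simp
  have bd: "norm (frame e (Z v)) \<le> 1 / l * norm v" for v
  proof -
    have "l * (norm (Z v))\<^sup>2 \<le> Z v \<bullet> coframe e v" using u(3)[of "Z v"] Z by (simp add: l_def)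
    also have "\<dots> \<le> norm (Z v) * norm v"
      by (rule order_trans[OF norm_cauchy_schwarz mult_left_mono[OF norm_coframe_le[OF basis]]]) simp
    finally have "norm (Z v) \<le> norm v / l"
      using l by (cases "Z v = 0") (auto simp: power2_eq_square field_simps)
    then show ?thesis by (simp add: norm_frame[OF basis])
  qed
  show "onorm (frechet_derivative \<sigma> (at 0)) = 1 / lambda_min H"
  proof (rule antisym)
    show "onorm (frechet_derivative \<sigma> (at 0)) \<le> 1 / lambda_min H"
      unfolding fd l_def[symmetric] by (rule onorm_bound) (use bd l in auto)
    have "1 / l = u \<bullet> Z (frame e u)" using luZ l by (simp add: field_simps)
    also have "\<dots> \<le> norm (frame e (Z (frame e u)))"
      using norm_cauchy_schwarz[of u "Z (frame e u)"] u by (simp add: norm_frame[OF basis])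
    also have "\<dots> \<le> onorm (\<lambda>v. frame e (Z v)) * norm (frame e u)"
      by (rule onorm) (use Z(2) has_derivative_bounded_linear in blast)
    finally show "1 / lambda_min H \<le> onorm (frechet_derivative \<sigma> (at 0))"
      unfolding fd l_def using u by (simp add: norm_frame[OF basis])
  qed
qed

end

text \<open>A chart is taken inside the domain of a C2 extension \<open>g\<close> of
  \<open>f\<close>. On chart points \<open>f\<close> and \<open>g\<close> agree, so f o psi inherits
  its regularity.\<close>

lemma tilt_stable_REG:
  fixes e :: "'k::finite \<Rightarrow> 'e::euclidean_space"
  assumes M: "C2_submanifold CARD('k) M" "p \<in> M"
    and e: "orthonormal_basis_of e (tangent_space M p)"
    and f: "C2_smooth_on_manifold M f" "\<And>x. x \<in> M \<Longrightarrow> f p \<le> f x"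
    and H: "has_covariant_hessian M f p e H" "H \<in> psd_cone"
  shows "tilt_stable M f p \<longleftrightarrow> lambda_min H > 0"
    and "REG M f p = (if lambda_min H > 0 then ereal (1 / lambda_min H) else \<infinity>)"
proof -
  obtain W g where W: "open W" "p \<in> W" "C2_on W g" "\<forall>x \<in> M \<inter> W. g x = f x"
    using bspec[OF f(1)[unfolded C2_smooth_on_manifold_def] M(2)] by auto
  obtain r \<psi> \<kappa> U where ch: "r > 0" "open U" "p \<in> U" "U \<subseteq> W" "C2_on (ball 0 r) (\<psi> :: real^'k \<Rightarrow> 'e)"
    "\<psi> 0 = p" "(\<psi> has_derivative frame e) (at 0)"
    "\<forall>c\<in>ball 0 r. \<psi> c \<in> M \<inter> U \<and> \<kappa> (\<psi> c) = c"
    "\<forall>x\<in>M \<inter> U. \<kappa> x \<in> ball 0 r \<and> \<psi> (\<kappa> x) = x" "C1_on U \<kappa>"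
    by (rule C2_submanifold_chart[OF M e W(1,2)]) (rule that; assumption)
  have "C2_on (ball 0 r) (\<lambda>c. g (\<psi> c))"
    by (rule C2_on_compose[OF ch(5) W(3)]) (use ch in blast)
  then obtain h' where h': "\<And>c. c \<in> ball 0 r \<Longrightarrow> ((\<lambda>c. g (\<psi> c)) has_derivative blinfun_apply (h' c)) (at c)"
    "C1_on (ball 0 r) h'" by (rule C2_onE) blast
  have fC2: "C2_on (ball 0 r) (\<lambda>c. f (\<psi> c))"
  proof (rule C2_onI[OF _ h'(2)])
    fix c :: "real^'k" assume c: "c \<in> ball 0 r"
    show "((\<lambda>c. f (\<psi> c)) has_derivative blinfun_apply (h' c)) (at c)"
      by (rule has_derivative_transform_within_open[OF h'(1)[OF c] open_ball c]) (use ch W in blast)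
  qed
  interpret tilt_chart M f p e "tangent_space M p" H r U \<psi> \<kappa>
    using ch fC2 e f(2) H(1) by unfold_locales auto
  show 1: "tilt_stable M f p \<longleftrightarrow> lambda_min H > 0"
    using tilt_stable_of_pos pos_of_tilt_map(1) H(2) unfolding tilt_stable_def by blast
  show "REG M f p = (if lambda_min H > 0 then ereal (1 / lambda_min H) else \<infinity>)"
  proof (cases "tilt_stable M f p")
    case True
    \<comment> \<open>The norm was computed for an arbitrary tilt map, hence also for the chosen
      one.\<close>
    then have "is_tilt_map M f p (SOME \<sigma>. is_tilt_map M f p \<sigma>)"
      unfolding tilt_stable_def by (rule someI_ex)
    then show ?thesis using pos_of_tilt_map(2)[OF _ H(2)] True 1 by (simp add: REG_def)
  qed (use 1 in \<open>simp add: REG_def\<close>)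
qed

subsection \<open>Descent and growth principles\<close>

text \<open>Concavity of the power, obtained from Young's inequality. The value y = 0 is included
  because descent may end at a singular matrix.\<close>

lemma powr_le_tangent:
  fixes x y p :: real
  assumes "x > 0" "y \<ge> 0" "0 < p" "p \<le> 1"
  shows "y powr p \<le> x powr p + p * x powr (p - 1) * (y - x)"
proof (cases "y = 0")
  case True
  have "x powr (p - 1) * x = x powr p" using assms powr_mult_base[of x "p - 1"] by (simp add: mult.commute)
  then have "x powr p + p * x powr (p - 1) * (y - x) = (1 - p) * x powr p"
    using True by (simp add: algebra_simps)
  then show ?thesis using True assms by simp
next
  case False
  have e: "x powr (1 - p) * x powr (p - 1) = 1" using assms by (simp flip: powr_add)
  have "x powr (p - 1) * x = x powr p" using assms powr_mult_base[of x "p - 1"] by (simp add: mult.commute)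
  moreover have "y powr p * x powr (1 - p) \<le> p * y + (1 - p) * x"
    using Youngs_inequality_0[of p "1 - p" y x] assms False by simp
  then have "y powr p * x powr (1 - p) * x powr (p - 1) \<le> (p * y + (1 - p) * x) * x powr (p - 1)"
    by (rule mult_right_mono) simp
  ultimately show ?thesis using e by (simp add: algebra_simps)
qed

text \<open>Caristi's fixed-point argument for a pseudometric: each step \<open>X n \<mapsto> X (Suc n)\<close> moves inside
  the set of points reachable at rate \<open>c\<close> and realises at least half of the decrease of \<open>G\<close>
  available there.\<close>

lemma descent_reaches_zero:
  fixes d :: "'a \<Rightarrow> 'a \<Rightarrow> real" and G :: "'a \<Rightarrow> real"
  assumes d0: "\<And>x. x \<in> S \<Longrightarrow> d x x = 0"
    and dpos: "\<And>x y. x \<in> S \<Longrightarrow> y \<in> S \<Longrightarrow> 0 \<le> d x y"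
    and tri: "\<And>x y z. x \<in> S \<Longrightarrow> y \<in> S \<Longrightarrow> z \<in> S \<Longrightarrow> d x z \<le> d x y + d y z"
    and c: "c > 0" and Gpos: "\<And>x. x \<in> S \<Longrightarrow> 0 \<le> G x"
    and complete: "\<And>X. (\<And>n. X n \<in> S) \<Longrightarrow> summable (\<lambda>n. d (X n) (X (Suc n))) \<Longrightarrow>
        \<exists>z\<in>S. (\<lambda>n. d (X n) z) \<longlonglongrightarrow> 0"
    and cont: "\<And>X z. (\<And>n. X n \<in> S) \<Longrightarrow> z \<in> S \<Longrightarrow> (\<lambda>n. d (X n) z) \<longlonglongrightarrow> 0 \<Longrightarrow> (\<lambda>n. G (X n)) \<longlonglongrightarrow> G z"
    and descent: "\<And>x. x \<in> S \<Longrightarrow> G x > 0 \<Longrightarrow> \<exists>y\<in>S. d x y > 0 \<and> G y + c * d x y \<le> G x"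
    and x0: "x0 \<in> S"
  shows "\<exists>z\<in>S. G z = 0 \<and> c * d x0 z \<le> G x0"
proof -
  define R where "R x = {y\<in>S. G y + c * d x y \<le> G x}" for x
  have self: "x \<in> R x" if "x \<in> S" for x using that d0 by (simp add: R_def)
  have bdd: "bdd_below (G ` R x)" for x using Gpos by (auto simp: R_def intro!: bdd_belowI[of _ 0])
  have "\<exists>y. y \<in> R x \<and> G y \<le> (G x + Inf (G ` R x)) / 2" if x: "x \<in> S" for x
  proof (cases "Inf (G ` R x) < G x")
    case True
    then have "Inf (G ` R x) < (G x + Inf (G ` R x)) / 2" by simp
    then obtain y where "y \<in> R x" "G y < (G x + Inf (G ` R x)) / 2"
      using cInf_lessD[of "G ` R x" "(G x + Inf (G ` R x)) / 2"] self[OF x] by blast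
    then show ?thesis by (auto intro: less_imp_le)
  next
    case False
    moreover have "Inf (G ` R x) \<le> G x" using cInf_lower[OF _ bdd] self[OF x] by blast
    ultimately show ?thesis using self[OF x] by (intro exI[of _ x]) auto
  qed
  then have "\<forall>x\<in>S. \<exists>y. y \<in> R x \<and> G y \<le> (G x + Inf (G ` R x)) / 2" by blast
  from bchoice[OF this] obtain nxt
    where nxt: "\<forall>x\<in>S. nxt x \<in> R x \<and> G (nxt x) \<le> (G x + Inf (G ` R x)) / 2" ..
  define X where "X n = (nxt ^^ n) x0" for n
  have XS: "X n \<in> S" for n
    by (induction n) (use x0 nxt in \<open>auto simp: X_def R_def\<close>)
  have step: "G (X (Suc n)) + c * d (X n) (X (Suc n)) \<le> G (X n)"
    "G (X (Suc n)) \<le> (G (X n) + Inf (G ` R (X n))) / 2" for n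
    using bspec[OF nxt XS[of n]] by (auto simp: X_def R_def)
  have far: "G (X (n + k)) + c * d (X n) (X (n + k)) \<le> G (X n)" for n k
  proof (induction k)
    case 0 then show ?case using d0[OF XS] by simp
  next
    case (Suc k)
    have "c * d (X n) (X (n + Suc k)) \<le> c * (d (X n) (X (n + k)) + d (X (n + k)) (X (Suc (n + k))))"
      using tri[OF XS XS XS] c by (intro mult_left_mono) auto
    then show ?case using Suc step(1)[of "n + k"] by (simp add: distrib_left)
  qed
  have "summable (\<lambda>n. d (X n) (X (Suc n)))"
  proof (rule summableI_nonneg_bounded[where x = "G x0 / c"])
    show "0 \<le> d (X n) (X (Suc n))" for n by (rule dpos[OF XS XS])
    show "(\<Sum>i<n. d (X i) (X (Suc i))) \<le> G x0 / c" for n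
    proof -
      have "c * (\<Sum>i<n. d (X i) (X (Suc i))) \<le> G (X 0) - G (X n)"
      proof (induction n)
        case (Suc n) then show ?case using step(1)[of n] by (simp add: distrib_left)
      qed simp
      also have "\<dots> \<le> G x0" using Gpos[OF XS[of n]] by (simp add: X_def)
      finally show ?thesis using c by (simp add: field_simps)
    qed
  qed
  then obtain z where z: "z \<in> S" "(\<lambda>n. d (X n) z) \<longlonglongrightarrow> 0" using complete XS by blast
  have Gz: "(\<lambda>n. G (X n)) \<longlonglongrightarrow> G z" by (rule cont[OF XS z])
  \<comment> \<open>The limit is still reachable from every \<open>X n\<close>; the triangle
    inequality stands in for continuity of \<open>d (X n)\<close>.\<close>
  have reach: "G z + c * d (X n) z \<le> G (X n)" for n
  proof (rule LIMSEQ_le_const2)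
    show "(\<lambda>k. G (X (n + k)) + c * (d (X n) z - d (X (n + k)) z)) \<longlonglongrightarrow> G z + c * d (X n) z"
      using LIMSEQ_ignore_initial_segment[OF Gz, of n] LIMSEQ_ignore_initial_segment[OF z(2), of n]
      by (auto intro!: tendsto_eq_intros simp: add.commute)
    have "G (X (n + k)) + c * (d (X n) z - d (X (n + k)) z) \<le> G (X n)" for k
    proof -
      have "c * (d (X n) z - d (X (n + k)) z) \<le> c * d (X n) (X (n + k))"
        using tri[OF XS[of n] XS[of "n + k"] z(1)] c by (intro mult_left_mono) auto
      then show ?thesis using far[of n k] by simp
    qed
    then show "\<exists>N. \<forall>k\<ge>N. G (X (n + k)) + c * (d (X n) z - d (X (n + k)) z) \<le> G (X n)" by blast
  qed
  have "G z = 0"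
  proof (rule ccontr)
    assume "G z \<noteq> 0"
    then obtain y where y: "y \<in> S" "d z y > 0" "G y + c * d z y \<le> G z"
      using descent[OF z(1)] Gpos[OF z(1)] by force
    \<comment> \<open>A point \<open>y\<close> reachable from the limit is reachable from every
      \<open>X n\<close>, so each step closes at least half of the gap to \<open>G y\<close>. In the
      limit G z is at most G y, against the strict descent from \<open>z\<close>.\<close>
    have "G (X (Suc n)) \<le> (G (X n) + G y) / 2" for n
    proof -
      have "c * d (X n) y \<le> c * (d (X n) z + d z y)"
        using tri[OF XS z(1) y(1)] c by (intro mult_left_mono) auto
      then have "y \<in> R (X n)" using y reach[of n] by (simp add: R_def distrib_left)
      then have "Inf (G ` R (X n)) \<le> G y" using cInf_lower[OF _ bdd] by blast
      then show ?thesis using step(2)[of n] by simp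
    qed
    then have "G z \<le> (G z + G y) / 2"
      by (intro LIMSEQ_le[OF LIMSEQ_Suc[OF Gz], of "\<lambda>n. (G (X n) + G y) / 2"] tendsto_intros Gz) auto
    moreover have "c * d z y > 0" using c y by simp
    ultimately show False using y(3) by simp
  qed
  then show ?thesis using z(1) reach[of 0] by (auto simp: X_def)
qed

text \<open>A barrier argument: the line of slope K + eps, raised by eps, cannot be crossed for the
  first time. The slope is assumed only where \<open>\<phi>\<close> is positive, because the power
  of the eigenvalue has no usable tangent at 0.\<close>

lemma growth_bound_of_upper_slope:
  fixes \<phi> :: "real \<Rightarrow> real"
  assumes ab: "a \<le> b" and cont: "continuous_on {a..b} \<phi>" and zero: "\<phi> a = 0" and K: "K \<ge> 0"
    and slope: "\<And>t \<epsilon>. a \<le> t \<Longrightarrow> t < b \<Longrightarrow> \<phi> t > 0 \<Longrightarrow> \<epsilon> > 0 \<Longrightarrow>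
      \<exists>\<delta>>0. \<forall>s. t < s \<longrightarrow> s < t + \<delta> \<longrightarrow> s \<le> b \<longrightarrow> \<phi> s \<le> \<phi> t + (s - t) * (K + \<epsilon>)"
  shows "\<phi> b \<le> K * (b - a)"
proof -
  have main: "\<phi> b \<le> (K + \<epsilon>) * (b - a) + \<epsilon>" if \<epsilon>: "\<epsilon> > 0" for \<epsilon>
  proof (rule ccontr)
    define B where "B s = (K + \<epsilon>) * (s - a) + \<epsilon>" for s
    have Bmono: "B s \<le> B t" if "s \<le> t" for s t
      using that K \<epsilon> unfolding B_def by (intro add_right_mono mult_left_mono) auto
    define D where "D = {t\<in>{a..b}. \<phi> t > B t}"
    assume "\<not> \<phi> b \<le> (K + \<epsilon>) * (b - a) + \<epsilon>"
    then have bD: "b \<in> D" using ab by (simp add: D_def B_def)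
    define t where "t = Inf D"
    have bdd: "bdd_below D" by (auto simp: D_def intro!: bdd_belowI[of _ a])
    have t_le: "t \<le> s" if "s \<in> D" for s using cInf_lower[OF that bdd] by (simp add: t_def)
    have at: "a \<le> t" unfolding t_def by (rule cInf_greatest) (use bD in \<open>auto simp: D_def\<close>)
    have tb: "t \<le> b" by (rule t_le[OF bD])
    have near: "\<exists>s\<in>D. s < t + \<delta>" if "\<delta> > 0" for \<delta>
      using cInf_less_iff[of D "t + \<delta>"] bD bdd that by (auto simp: t_def)
    have contB: "continuous_on {a..b} (\<lambda>s. \<phi> s - B s)"
      unfolding B_def by (intro continuous_intros cont)
    have tD: "\<phi> t \<le> B t"
    proof (rule ccontr)
      assume h: "\<not> \<phi> t \<le> B t"
      then have "t \<noteq> a" using zero \<epsilon> by (auto simp: B_def)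
      obtain \<delta> where \<delta>: "\<delta> > 0" "\<And>s. s \<in> {a..b} \<Longrightarrow> dist s t < \<delta> \<Longrightarrow> dist (\<phi> s - B s) (\<phi> t - B t) < \<phi> t - B t"
        using contB at tb h unfolding continuous_on_iff
        by (metis atLeastAtMost_iff diff_gt_0_iff_gt not_le)
      let ?s = "max a (t - \<delta> / 2)"
      have "dist ?s t < \<delta>" "?s \<in> {a..b}" "?s < t" using \<delta>(1) at tb \<open>t \<noteq> a\<close> by (auto simp: dist_real_def)
      then have "?s \<in> D" using \<delta>(2)[of ?s] by (auto simp: D_def dist_real_def abs_if split: if_splits)
      then show False using t_le \<open>?s < t\<close> by fastforce
    qed
    then have tnD: "t \<notin> D" by (simp add: D_def)
    then have tltb: "t < b" using bD tb by (metis antisym_conv2)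
    \<comment> \<open>Just after \<open>t\<close> the barrier persists: by the slope if
      \<open>\<phi>\<close> is positive there, and otherwise by continuity, since the raised line
      stays at least eps above 0.\<close>
    have "\<exists>\<delta>>0. \<forall>s. t < s \<longrightarrow> s < t + \<delta> \<longrightarrow> s \<le> b \<longrightarrow> \<phi> s \<le> B s"
    proof (cases "\<phi> t > 0")
      case True
      then obtain \<delta> where \<delta>: "\<delta> > 0" "\<forall>s. t < s \<longrightarrow> s < t + \<delta> \<longrightarrow> s \<le> b \<longrightarrow> \<phi> s \<le> \<phi> t + (s - t) * (K + \<epsilon>)"
        using slope[OF at tltb _ \<epsilon>] by blast
      have "\<phi> s \<le> B s" if "\<phi> s \<le> \<phi> t + (s - t) * (K + \<epsilon>)" for s
        using that tD unfolding B_def by (simp add: algebra_simps)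
      then show ?thesis using \<delta> by blast
    next
      case False
      obtain \<delta> where \<delta>: "\<delta> > 0" "\<And>s. s \<in> {a..b} \<Longrightarrow> dist s t < \<delta> \<Longrightarrow> dist (\<phi> s) (\<phi> t) < \<epsilon>"
        using cont at tb \<epsilon> unfolding continuous_on_iff by (metis atLeastAtMost_iff)
      have "\<phi> s \<le> B s" if "t < s" "s < t + \<delta>" "s \<le> b" for s
      proof -
        have "\<phi> s < \<epsilon>" using \<delta>(2)[of s] that at False by (auto simp: dist_real_def)
        moreover have "B a \<le> B s" by (rule Bmono) (use that at in simp)
        ultimately show ?thesis by (simp add: B_def)
      qed
      then show ?thesis using \<delta> by blast
    qed
    then obtain \<delta> where \<delta>: "\<delta> > 0" "\<And>s. t < s \<Longrightarrow> s < t + \<delta> \<Longrightarrow> s \<le> b \<Longrightarrow> \<phi> s \<le> B s" by blast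
    obtain s where s: "s \<in> D" "s < t + \<delta>" using near[OF \<delta>(1)] by blast
    have "s \<noteq> t" using s tnD by auto
    then show False using \<delta>(2)[of s] s t_le[OF s(1)] by (auto simp: D_def)
  qed
  have "((\<lambda>\<epsilon>. (K + \<epsilon>) * (b - a) + \<epsilon>) \<longlongrightarrow> (K + 0) * (b - a) + 0) (at_right 0)"
    by (intro tendsto_intros)
  then have "\<phi> b \<le> (K + 0) * (b - a) + 0"
    by (rule tendsto_lowerbound) (auto intro!: eventually_at_right_less[THEN eventually_mono] main)
  then show ?thesis by simp
qed

subsection \<open>Square-integrable random vectors\<close>

text \<open>Actual functions, not classes modulo null sets: they can be composed with
  \<open>F\<close> directly, and the L2 distance is then only a pseudometric, as the descent
  principle allows.\<close>

definition sq_integrable :: "'w measure \<Rightarrow> ('w \<Rightarrow> 'a::euclidean_space) set" where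
  "sq_integrable P = {X. X \<in> borel_measurable P \<and> integrable P (\<lambda>w. (norm (X w))\<^sup>2)}"

definition L2norm :: "'w measure \<Rightarrow> ('w \<Rightarrow> 'a::euclidean_space) \<Rightarrow> real" where
  "L2norm P X = sqrt (\<integral>w. (norm (X w))\<^sup>2 \<partial>P)"

lemma L2norm_nonneg [simp]: "0 \<le> L2norm P X"
  by (simp add: L2norm_def)

lemma L2norm_power2: "(L2norm P X)\<^sup>2 = (\<integral>w. (norm (X w))\<^sup>2 \<partial>P)"
  by (simp add: L2norm_def)

lemma integrable_dominated:
  fixes f g :: "'w \<Rightarrow> real"
  assumes "integrable P f" "g \<in> borel_measurable P" "\<And>w. 0 \<le> g w" "\<And>w. g w \<le> f w"
  shows "integrable P g"
  using assms by (intro Bochner_Integration.integrable_bound[OF assms(1,2)] AE_I2)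
    (metis abs_of_nonneg order_trans real_norm_def)

lemma sq_integrable_bound:
  fixes X :: "'w \<Rightarrow> 'a::euclidean_space" and Y :: "'w \<Rightarrow> 'b::euclidean_space"
  assumes "X \<in> sq_integrable P" "Y \<in> borel_measurable P" "\<And>w. norm (Y w) \<le> C * norm (X w)"
  shows "Y \<in> sq_integrable P"
proof -
  have i1: "integrable P (\<lambda>w. C\<^sup>2 * (norm (X w))\<^sup>2)" using assms(1) by (simp add: sq_integrable_def)
  have i2: "(norm (Y w))\<^sup>2 \<le> C\<^sup>2 * (norm (X w))\<^sup>2" for w
    using power_mono[OF assms(3)[of w], of 2] by (simp add: power_mult_distrib)
  have "integrable P (\<lambda>w. (norm (Y w))\<^sup>2)"
    by (rule integrable_dominated[OF i1 _ _ i2]) (use assms(2) in auto)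
  then show ?thesis using assms(2) by (simp add: sq_integrable_def)
qed

lemma sq_integrable_norm:
  assumes "X \<in> sq_integrable P"
  shows "(\<lambda>w. norm (X w)) \<in> sq_integrable P"
  using assms by (auto simp: sq_integrable_def)

lemma sq_integrable_scaleR:
  assumes "X \<in> sq_integrable P"
  shows "(\<lambda>w. s *\<^sub>R X w) \<in> sq_integrable P"
  by (rule sq_integrable_bound[OF assms, where C = "\<bar>s\<bar>"]) (use assms in \<open>auto simp: sq_integrable_def\<close>)

lemma sq_integrable_add:
  assumes X: "X \<in> sq_integrable P" and Y: "Y \<in> sq_integrable P"
  shows "(\<lambda>w. X w + Y w) \<in> sq_integrable P"
proof -
  have m: "X \<in> borel_measurable P" "Y \<in> borel_measurable P" using X Y by (auto simp: sq_integrable_def)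
  have i1: "integrable P (\<lambda>w. 2 * (norm (X w))\<^sup>2 + 2 * (norm (Y w))\<^sup>2)"
    using X Y by (simp add: sq_integrable_def)
  have i2: "(norm (X w + Y w))\<^sup>2 \<le> 2 * (norm (X w))\<^sup>2 + 2 * (norm (Y w))\<^sup>2" for w
  proof -
    have "(norm (X w + Y w))\<^sup>2 \<le> (norm (X w) + norm (Y w))\<^sup>2"
      by (intro power_mono norm_triangle_ineq) auto
    also have "\<dots> \<le> 2 * (norm (X w))\<^sup>2 + 2 * (norm (Y w))\<^sup>2"
      using sum_squares_bound[of "norm (X w)" "norm (Y w)"] by (simp add: power2_sum)
    finally show ?thesis .
  qed
  have "integrable P (\<lambda>w. (norm (X w + Y w))\<^sup>2)"
    by (rule integrable_dominated[OF i1 _ _ i2]) (use m in auto)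
  then show ?thesis using m by (simp add: sq_integrable_def)
qed

lemma sq_integrable_diff:
  assumes "X \<in> sq_integrable P" "Y \<in> sq_integrable P"
  shows "(\<lambda>w. X w - Y w) \<in> sq_integrable P"
  using sq_integrable_add[OF assms(1) sq_integrable_scaleR[OF assms(2), of "- 1"]] by simp

lemma (in prob_space) sq_integrable_const: "(\<lambda>w. c) \<in> sq_integrable M"
  by (simp add: sq_integrable_def)

lemma integrable_norm_mult:
  assumes X: "X \<in> sq_integrable P" and Y: "Y \<in> sq_integrable P"
  shows "integrable P (\<lambda>w. norm (X w) * norm (Y w))"
proof -
  have m: "X \<in> borel_measurable P" "Y \<in> borel_measurable P" using X Y by (auto simp: sq_integrable_def)
  have i1: "integrable P (\<lambda>w. (norm (X w))\<^sup>2 + (norm (Y w))\<^sup>2)" using X Y by (simp add: sq_integrable_def)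
  have i2: "norm (X w) * norm (Y w) \<le> (norm (X w))\<^sup>2 + (norm (Y w))\<^sup>2" for w
  proof -
    have "0 \<le> norm (X w) * norm (Y w)" by simp
    then show ?thesis using sum_squares_bound[of "norm (X w)" "norm (Y w)"] by linarith
  qed
  show ?thesis
    by (rule integrable_dominated[OF i1 _ _ i2]) (use m in auto)
qed

text \<open>The weighted inequality between arithmetic and geometric means is integrated with the
  weight \<open>r\<close> that balances the two norms. The added eps keeps \<open>r\<close> defined
  and positive when a norm vanishes, and is removed in the limit.\<close>

lemma integral_Cauchy_Schwarz:
  assumes X: "X \<in> sq_integrable P" and Y: "Y \<in> sq_integrable P"
  shows "(\<integral>w. norm (X w) * norm (Y w) \<partial>P) \<le> L2norm P X * L2norm P Y"
proof -
  let ?a = "L2norm P X" and ?b = "L2norm P Y"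
  let ?I = "\<integral>w. norm (X w) * norm (Y w) \<partial>P"
  have "?I \<le> (?a + \<epsilon>) * (?b + \<epsilon>)" if \<epsilon>: "\<epsilon> > 0" for \<epsilon>
  proof -
    define r where "r = (?b + \<epsilon>) / (?a + \<epsilon>)"
    have pos: "?a + \<epsilon> > 0" "?b + \<epsilon> > 0" using \<epsilon> by (simp_all add: add_nonneg_pos)
    have r: "r > 0" using pos by (simp add: r_def)
    have alg: "B / A / 2 * A\<^sup>2 + 1 / (2 * (B / A)) * B\<^sup>2 = A * B" if "A > 0" "B > 0" for A B :: real
      using that by (simp add: power2_eq_square field_simps)
    have pw: "norm (X w) * norm (Y w) \<le> r / 2 * (norm (X w))\<^sup>2 + 1 / (2 * r) * (norm (Y w))\<^sup>2" for w
    proof -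
      have "0 \<le> (r * norm (X w) - norm (Y w))\<^sup>2 / (2 * r)" using r by simp
      also have "\<dots> = r / 2 * (norm (X w))\<^sup>2 + 1 / (2 * r) * (norm (Y w))\<^sup>2 - norm (X w) * norm (Y w)"
        using r by (simp add: power2_eq_square field_simps)
      finally show ?thesis by simp
    qed
    have "?I \<le> (\<integral>w. r / 2 * (norm (X w))\<^sup>2 + 1 / (2 * r) * (norm (Y w))\<^sup>2 \<partial>P)"
      by (rule integral_mono[OF integrable_norm_mult[OF X Y] _ pw]) (use X Y in \<open>simp add: sq_integrable_def\<close>)
    also have "\<dots> = r / 2 * ?a\<^sup>2 + 1 / (2 * r) * ?b\<^sup>2"
      unfolding L2norm_power2 using X Y by (subst Bochner_Integration.integral_add) (auto simp: sq_integrable_def)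
    also have "\<dots> \<le> r / 2 * (?a + \<epsilon>)\<^sup>2 + 1 / (2 * r) * (?b + \<epsilon>)\<^sup>2"
      using r \<epsilon> by (intro add_mono mult_left_mono power_mono) auto
    also have "\<dots> = (?a + \<epsilon>) * (?b + \<epsilon>)"
      unfolding r_def by (rule alg[OF pos])
    finally show ?thesis .
  qed
  moreover have "((\<lambda>\<epsilon>. (?a + \<epsilon>) * (?b + \<epsilon>)) \<longlongrightarrow> (?a + 0) * (?b + 0)) (at_right 0)"
    by (intro tendsto_intros)
  ultimately have "?I \<le> (?a + 0) * (?b + 0)"
    by (intro tendsto_lowerbound[where F = "at_right 0"])
      (auto intro!: eventually_at_right_less[THEN eventually_mono])
  then show ?thesis by simp
qed

lemma L2norm_triangle:
  assumes X: "X \<in> sq_integrable P" and Y: "Y \<in> sq_integrable P"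
  shows "L2norm P (\<lambda>w. X w + Y w) \<le> L2norm P X + L2norm P Y"
proof -
  have i: "integrable P (\<lambda>w. (norm (X w))\<^sup>2)" "integrable P (\<lambda>w. (norm (Y w))\<^sup>2)"
    "integrable P (\<lambda>w. (norm (X w + Y w))\<^sup>2)" "integrable P (\<lambda>w. norm (X w) * norm (Y w))"
    using X Y sq_integrable_add[OF X Y] integrable_norm_mult[OF X Y] by (auto simp: sq_integrable_def)
  have "(L2norm P (\<lambda>w. X w + Y w))\<^sup>2 = (\<integral>w. (norm (X w + Y w))\<^sup>2 \<partial>P)" by (rule L2norm_power2)
  also have "\<dots> \<le> (\<integral>w. ((norm (X w))\<^sup>2 + 2 * (norm (X w) * norm (Y w))) + (norm (Y w))\<^sup>2 \<partial>P)"
  proof (rule integral_mono)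
    show "(norm (X w + Y w))\<^sup>2 \<le> ((norm (X w))\<^sup>2 + 2 * (norm (X w) * norm (Y w))) + (norm (Y w))\<^sup>2" for w
      using power_mono[OF norm_triangle_ineq[of "X w" "Y w"], of 2] by (simp add: power2_sum mult_ac)
  qed (use i in \<open>auto intro!: Bochner_Integration.integrable_add integrable_mult_right\<close>)
  also have "\<dots> = (L2norm P X)\<^sup>2 + 2 * (\<integral>w. norm (X w) * norm (Y w) \<partial>P) + (L2norm P Y)\<^sup>2"
    unfolding L2norm_power2 using i
    by (subst Bochner_Integration.integral_add; (intro Bochner_Integration.integrable_add integrable_mult_right)?; simp)
  also have "\<dots> \<le> (L2norm P X)\<^sup>2 + 2 * (L2norm P X * L2norm P Y) + (L2norm P Y)\<^sup>2"
    using integral_Cauchy_Schwarz[OF X Y] by simp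
  also have "\<dots> = (L2norm P X + L2norm P Y)\<^sup>2" by (simp add: power2_sum)
  finally show ?thesis by (rule power2_le_imp_le) simp
qed

lemma L2norm_scaleR: "L2norm P (\<lambda>w. s *\<^sub>R X w) = \<bar>s\<bar> * L2norm P X"
  by (simp add: L2norm_def power_mult_distrib real_sqrt_mult)

lemma L2norm_norm: "L2norm P (\<lambda>w. norm (X w)) = L2norm P X"
  by (simp add: L2norm_def)

lemma L2dist_triangle:
  assumes "X \<in> sq_integrable P" "Y \<in> sq_integrable P" "Z \<in> sq_integrable P"
  shows "L2norm P (\<lambda>w. X w - Z w) \<le> L2norm P (\<lambda>w. X w - Y w) + L2norm P (\<lambda>w. Y w - Z w)"
  using L2norm_triangle[OF sq_integrable_diff[OF assms(1,2)] sq_integrable_diff[OF assms(2,3)]] by simp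

lemma (in prob_space) L2norm_const: "L2norm M (\<lambda>w. c :: real) = \<bar>c\<bar>"
  by (simp add: L2norm_def prob_space)

lemma (in prob_space) sq_integrable_imp_integrable_norm:
  assumes X: "X \<in> sq_integrable M"
  shows "integrable M (\<lambda>w. norm (X w))" "(\<integral>w. norm (X w) \<partial>M) \<le> L2norm M X"
  using integrable_norm_mult[OF X sq_integrable_const[of "1::real"]]
    integral_Cauchy_Schwarz[OF X sq_integrable_const[of "1::real"]] by (simp_all add: L2norm_const)

text \<open>The Riesz-Fischer argument: on a probability space summable L2 increments are summable
  in L1, hence the increments are summable almost everywhere and the sequence converges there. The
  L2 estimate for the limit comes from Fatou's lemma and the tails \<open>\<tau>\<close>.\<close>

lemma (in prob_space) sq_integrable_complete:
  fixes X :: "nat \<Rightarrow> 'a \<Rightarrow> 'b::euclidean_space"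
  assumes X: "\<And>n. X n \<in> sq_integrable M"
    and sum: "summable (\<lambda>n. L2norm M (\<lambda>w. X n w - X (Suc n) w))"
  shows "\<exists>Z\<in>sq_integrable M. (\<lambda>n. L2norm M (\<lambda>w. X n w - Z w)) \<longlonglongrightarrow> 0"
proof -
  define d where "d n = L2norm M (\<lambda>w. X n w - X (Suc n) w)" for n
  have d0: "0 \<le> d n" for n by (simp add: d_def)
  have sumd: "summable d" using sum by (simp add: d_def[abs_def])
  have [measurable]: "X n \<in> borel_measurable M" for n using X by (simp add: sq_integrable_def)
  have L1: "(\<integral>\<^sup>+w. ennreal (norm (X n w - X (Suc n) w)) \<partial>M) \<le> ennreal (d n)" for n
  proof -
    have "X n \<in> sq_integrable M" "X (Suc n) \<in> sq_integrable M" by (rule X)+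
    from sq_integrable_imp_integrable_norm[OF sq_integrable_diff[OF this]]
    show ?thesis by (simp add: nn_integral_eq_integral d_def ennreal_leI)
  qed
  have "(\<integral>\<^sup>+w. (\<Sum>n. ennreal (norm (X n w - X (Suc n) w))) \<partial>M) =
      (\<Sum>n. (\<integral>\<^sup>+w. ennreal (norm (X n w - X (Suc n) w)) \<partial>M))"
    by (rule nn_integral_suminf) simp
  also have "\<dots> \<le> (\<Sum>n. ennreal (d n))" by (intro suminf_le L1 summableI)
  also have "\<dots> = ennreal (suminf d)" by (rule suminf_ennreal2[OF d0 sumd])
  also have "\<dots> < \<infinity>" by simp
  finally have "AE w in M. (\<Sum>n. ennreal (norm (X n w - X (Suc n) w))) \<noteq> \<infinity>"
    by (intro nn_integral_PInf_AE) auto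
  then have conv: "AE w in M. (\<lambda>n. X n w) \<longlonglongrightarrow> lim (\<lambda>n. X n w)"
  proof eventually_elim
    case (elim w)
    then have "summable (\<lambda>n. norm (X n w - X (Suc n) w))"
      by (intro summable_suminf_not_top) auto
    then have "summable (\<lambda>n. X n w - X (Suc n) w)" by (rule summable_norm_cancel)
    then have "convergent (\<lambda>n. \<Sum>i<n. X i w - X (Suc i) w)" by (simp add: summable_iff_convergent)
    moreover have "(\<Sum>i<n. X i w - X (Suc i) w) = X 0 w - X n w" for n by (rule sum_lessThan_telescope')
    ultimately have "convergent (\<lambda>n. X 0 w - X n w)" by simp
    then have "convergent (\<lambda>n. X 0 w - (X 0 w - X n w))" by (rule convergent_diff[OF convergent_const])
    then show ?case by (simp add: convergent_LIMSEQ_iff)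
  qed
  define Z where "Z w = lim (\<lambda>n. X n w)" for w
  have Zm [measurable]: "Z \<in> borel_measurable M" unfolding Z_def by measurable
  define \<tau> where "\<tau> n = (\<Sum>k. d (k + n))" for n
  have \<tau>0: "\<tau> \<longlonglongrightarrow> 0" unfolding \<tau>_def by (rule suminf_exist_split2[OF sumd])
  have \<tau>nn: "0 \<le> \<tau> n" for n
    unfolding \<tau>_def by (rule suminf_nonneg[OF summable_ignore_initial_segment[OF sumd]]) (rule d0)
  have tail: "L2norm M (\<lambda>w. X n w - X (n + m) w) \<le> \<tau> n" for n m
  proof -
    have "L2norm M (\<lambda>w. X n w - X (n + m) w) \<le> (\<Sum>k<m. d (k + n))"
    proof (induction m)
      case 0 then show ?case by (simp add: L2norm_def)
    next
      case (Suc m)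
      then show ?case
        using L2dist_triangle[OF X[of n] X[of "n + m"] X[of "Suc (n + m)"]] by (simp add: d_def add.commute)
    qed
    also have "\<dots> \<le> \<tau> n" unfolding \<tau>_def
      by (rule sum_le_suminf[OF summable_ignore_initial_segment[OF sumd]]) (auto simp: d0)
    finally show ?thesis .
  qed
  have fatou: "(\<integral>\<^sup>+w. ennreal ((norm (X n w - Z w))\<^sup>2) \<partial>M) \<le> ennreal ((\<tau> n)\<^sup>2)" for n
  proof -
    have "(\<integral>\<^sup>+w. ennreal ((norm (X n w - Z w))\<^sup>2) \<partial>M) =
        (\<integral>\<^sup>+w. liminf (\<lambda>m. ennreal ((norm (X n w - X (n + m) w))\<^sup>2)) \<partial>M)"
    proof (rule nn_integral_cong_AE, use conv in eventually_elim)
      case (elim w)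
      then have "(\<lambda>m. X (m + n) w) \<longlonglongrightarrow> Z w" unfolding Z_def by (rule LIMSEQ_ignore_initial_segment)
      then have "(\<lambda>m. ennreal ((norm (X n w - X (n + m) w))\<^sup>2)) \<longlonglongrightarrow> ennreal ((norm (X n w - Z w))\<^sup>2)"
        by (intro tendsto_intros tendsto_ennrealI) (simp add: add.commute)
      then show ?case by (rule lim_imp_Liminf[OF sequentially_bot, symmetric])
    qed
    also have "\<dots> \<le> liminf (\<lambda>m. (\<integral>\<^sup>+w. ennreal ((norm (X n w - X (n + m) w))\<^sup>2) \<partial>M))"
      by (rule nn_integral_liminf) simp
    also have "\<dots> \<le> ennreal ((\<tau> n)\<^sup>2)"
    proof (rule Liminf_le[OF sequentially_bot], rule always_eventually, rule allI)
      fix m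
      have "(\<integral>\<^sup>+w. ennreal ((norm (X n w - X (n + m) w))\<^sup>2) \<partial>M) = ennreal ((L2norm M (\<lambda>w. X n w - X (n + m) w))\<^sup>2)"
        unfolding L2norm_power2 using sq_integrable_diff[OF X[of n] X[of "n + m"]]
        by (intro nn_integral_eq_integral) (auto simp: sq_integrable_def)
      also have "\<dots> \<le> ennreal ((\<tau> n)\<^sup>2)" by (intro ennreal_leI power_mono tail) simp
      finally show "(\<integral>\<^sup>+w. ennreal ((norm (X n w - X (n + m) w))\<^sup>2) \<partial>M) \<le> ennreal ((\<tau> n)\<^sup>2)" .
    qed
    finally show ?thesis .
  qed
  have XZ: "(\<lambda>w. X n w - Z w) \<in> sq_integrable M" for n
  proof -
    have "integrable M (\<lambda>w. (norm (X n w - Z w))\<^sup>2)"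
      by (rule integrableI_bounded) (use order.strict_trans1[OF fatou, of n \<infinity>] in auto)
    then show ?thesis by (simp add: sq_integrable_def)
  qed
  have bound: "L2norm M (\<lambda>w. X n w - Z w) \<le> \<tau> n" for n
  proof -
    have "ennreal ((L2norm M (\<lambda>w. X n w - Z w))\<^sup>2) \<le> ennreal ((\<tau> n)\<^sup>2)"
      using fatou[of n] XZ[of n] unfolding L2norm_power2
      by (subst (asm) nn_integral_eq_integral) (auto simp: sq_integrable_def)
    then have "(L2norm M (\<lambda>w. X n w - Z w))\<^sup>2 \<le> (\<tau> n)\<^sup>2" by simp
    then show ?thesis by (rule power2_le_imp_le) (rule \<tau>nn)
  qed
  have "(\<lambda>n. L2norm M (\<lambda>w. X n w - Z w)) \<longlonglongrightarrow> 0"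
    by (rule tendsto_sandwich[OF _ _ tendsto_const \<tau>0]) (auto simp: bound)
  moreover have "Z \<in> sq_integrable M" using sq_integrable_diff[OF X[of 0] XZ[of 0]] by simp
  ultimately show ?thesis by blast
qed

subsection \<open>Smallest eigenvalues of expected matrices\<close>

lemma bounded_linear_transpose: "bounded_linear (transpose :: real^'n^'m \<Rightarrow> real^'m^'n)"
  by (rule linear_conv_bounded_linear[THEN iffD1])
    (auto intro!: linearI simp: transpose_def vec_eq_iff)

lemma lambda_min_nonneg:
  assumes "A \<in> psd_cone"
  shows "0 \<le> lambda_min A"
proof -
  have A: "transpose A = A" using assms by (simp add: psd_cone_def)
  obtain u where u: "norm u = 1" "A *v u = lambda_min A *\<^sub>R u"
    using symmetric_matrix_min_eigenvector[OF A] by metis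
  have "0 \<le> u \<bullet> (A *v u)" using assms by (simp add: psd_cone_def)
  then show ?thesis using u by (simp add: norm_eq_1)
qed

locale psd_map =
  fixes F :: "'a::euclidean_space \<Rightarrow> real^'k^'k" and L :: real
  assumes F_C1: "C1_on UNIV F" and F_psd: "\<And>x. F x \<in> psd_cone" and L_pos: "0 < L"
    and DF_growth: "\<And>x. onorm (frechet_derivative F (at x)) \<le> L * (1 + norm x)"
begin

text \<open>\<open>V u\<close> is the gradient of the scalar function that tests \<open>F\<close>
  against the outer square of \<open>u\<close>; see \<open>V_dot\<close>.\<close>

definition V :: "real^'k \<Rightarrow> 'a \<Rightarrow> 'a" where
  "V u x = adjoint (frechet_derivative F (at x)) (outer_square u)"

lemma F_has_derivative: "(F has_derivative frechet_derivative F (at x)) (at x)"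
  using F_C1 by (metis C1_onE UNIV_I differentiableI frechet_derivative_works)

lemma F_measurable [measurable]: "F \<in> borel_measurable borel"
  by (rule borel_measurable_continuous_onI[OF C1_on_continuous[OF F_C1]])

lemma V_measurable [measurable]: "V u \<in> borel_measurable borel"
proof -
  obtain F' where F': "\<And>x. (F has_derivative blinfun_apply (F' x)) (at x)" "continuous_on UNIV F'"
    using F_C1 by (metis C1_onE UNIV_I)
  have "frechet_derivative F (at x) = blinfun_apply (F' x)" for x
    using frechet_derivative_at[OF F'(1)] by simp
  then have "V u = (\<lambda>x. adjoint (blinfun_apply (F' x)) (outer_square u))"
    by (simp add: V_def[abs_def])
  moreover have "continuous_on UNIV (\<lambda>x. adjoint (blinfun_apply (F' x)) (outer_square u))"
    by (intro bounded_bilinear.continuous_on[OF bounded_bilinear_adjoint] F'(2) continuous_on_const)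
  ultimately show ?thesis by (simp add: borel_measurable_continuous_onI)
qed

lemma V_dot: "V u x \<bullet> y = frechet_derivative F (at x) y \<bullet> outer_square u"
  unfolding V_def by (metis adjoint_works F_has_derivative has_derivative_linear inner_commute)

lemma norm_V_le:
  assumes "norm u = 1"
  shows "norm (V u x) \<le> L * (1 + norm x)"
proof (cases "V u x = 0")
  case False
  have "norm (V u x) * norm (V u x) = frechet_derivative F (at x) (V u x) \<bullet> outer_square u"
    by (simp add: V_dot[symmetric] power2_norm_eq_inner[symmetric] power2_eq_square)
  also have "\<dots> \<le> norm (frechet_derivative F (at x) (V u x)) * norm (outer_square u)"
    by (rule norm_cauchy_schwarz)
  also have "\<dots> = norm (frechet_derivative F (at x) (V u x))" using assms by (simp add: norm_outer_square)
  also have "\<dots> \<le> onorm (frechet_derivative F (at x)) * norm (V u x)"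
    by (rule onorm[OF has_derivative_bounded_linear[OF F_has_derivative]])
  also have "\<dots> \<le> L * (1 + norm x) * norm (V u x)" by (intro mult_right_mono DF_growth) simp
  finally show ?thesis using False by simp
qed (use L_pos in simp)

text \<open>Linear growth of DF along the segment. The resulting factor times the increment is a
  product of two L2 functions, hence integrable.\<close>

lemma F_Lipschitz: "norm (F x - F y) \<le> L * (1 + norm x + norm y) * norm (x - y)"
proof (rule differentiable_bound[OF convex_closed_segment])
  fix z assume z: "z \<in> closed_segment x y"
  show "(F has_derivative frechet_derivative F (at z)) (at z within closed_segment x y)"
    by (rule has_derivative_at_withinI[OF F_has_derivative])
  obtain t where t: "0 \<le> t" "t \<le> 1" "z = (1 - t) *\<^sub>R x + t *\<^sub>R y" using z by (auto simp: closed_segment_def)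
  have "norm z \<le> (1 - t) * norm x + t * norm y"
    using norm_triangle_ineq[of "(1 - t) *\<^sub>R x" "t *\<^sub>R y"] t by simp
  also have "\<dots> \<le> norm x + norm y"
    using t by (intro add_mono mult_left_le_one_le) auto
  finally have "L * (1 + norm z) \<le> L * (1 + norm x + norm y)"
    using L_pos by (intro mult_left_mono) auto
  then show "onorm (frechet_derivative F (at z)) \<le> L * (1 + norm x + norm y)"
    using DF_growth[of z] by linarith
qed auto

end

text \<open>The probability space is left general because it is used twice: with P = mu for
  transport maps, and with P a coupling, whose two projections are the random vectors.\<close>

locale psd_map_prob = psd_map F L + prob_space P
  for F :: "'a::euclidean_space \<Rightarrow> real^'k^'k" and L :: real and P :: "'w measure"
begin

definition EF :: "('w \<Rightarrow> 'a) \<Rightarrow> real^'k^'k" where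
  "EF X = (\<integral>w. F (X w) \<partial>P)"

lemma integrable_F:
  assumes X: "X \<in> sq_integrable P"
  shows "integrable P (\<lambda>w. F (X w))"
proof (rule Bochner_Integration.integrable_bound)
  have [measurable]: "X \<in> borel_measurable P" using X by (simp add: sq_integrable_def)
  show "(\<lambda>w. F (X w)) \<in> borel_measurable P" by measurable
  show "integrable P (\<lambda>w. norm (F 0) + (L * norm (X w) + L * (norm (X w))\<^sup>2))"
    using X sq_integrable_imp_integrable_norm(1)[OF X] by (simp add: sq_integrable_def)
  have "norm (F (X w)) \<le> norm (F 0) + (L * norm (X w) + L * (norm (X w))\<^sup>2)" for w
    using norm_triangle_sub[of "F (X w)" "F 0"] F_Lipschitz[of "X w" 0]
    by (simp add: algebra_simps power2_eq_square)
  then show "AE w in P. norm (F (X w)) \<le> norm (norm (F 0) + (L * norm (X w) + L * (norm (X w))\<^sup>2))"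
    by (intro AE_I2) (metis abs_ge_self order_trans real_norm_def)
qed

lemma EF_psd:
  assumes "X \<in> sq_integrable P"
  shows "EF X \<in> psd_cone"
proof -
  note i = integrable_F[OF assms]
  have "transpose (EF X) = (\<integral>w. transpose (F (X w)) \<partial>P)"
    unfolding EF_def by (rule integral_bounded_linear[OF bounded_linear_transpose i, symmetric])
  also have "\<dots> = EF X" using F_psd by (simp add: EF_def psd_cone_def)
  finally have "transpose (EF X) = EF X" .
  moreover have "0 \<le> v \<bullet> (EF X *v v)" for v
  proof -
    have "v \<bullet> (EF X *v v) = (\<integral>w. F (X w) \<bullet> outer_square v \<partial>P)"
      unfolding matrix_quadratic_form EF_def using i by simp
    also have "\<dots> \<ge> 0"
      by (rule Bochner_Integration.integral_nonneg)
        (use F_psd in \<open>simp add: psd_cone_def matrix_quadratic_form[symmetric]\<close>)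
    finally show ?thesis .
  qed
  ultimately show ?thesis by (simp add: psd_cone_def)
qed

lemma EF_sym: "X \<in> sq_integrable P \<Longrightarrow> transpose (EF X) = EF X"
  using EF_psd by (simp add: psd_cone_def)

lemma EF_Lipschitz:
  assumes X: "X \<in> sq_integrable P" and Y: "Y \<in> sq_integrable P"
  shows "norm (EF X - EF Y) \<le> L * (1 + L2norm P X + L2norm P Y) * L2norm P (\<lambda>w. X w - Y w)"
proof -
  define G where "G w = 1 + norm (X w) + norm (Y w)" for w
  have G: "G \<in> sq_integrable P"
    unfolding G_def by (intro sq_integrable_add sq_integrable_const sq_integrable_norm X Y)
  have XY: "(\<lambda>w. X w - Y w) \<in> sq_integrable P" by (rule sq_integrable_diff[OF X Y])
  have G0: "norm (G w) = G w" for w by (simp add: G_def)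
  have nG: "L2norm P G \<le> 1 + L2norm P X + L2norm P Y"
  proof -
    have "L2norm P G \<le> L2norm P (\<lambda>w. 1 + norm (X w)) + L2norm P (\<lambda>w. norm (Y w))"
      unfolding G_def by (intro L2norm_triangle sq_integrable_add sq_integrable_const sq_integrable_norm X Y)
    also have "L2norm P (\<lambda>w. 1 + norm (X w)) \<le> L2norm P (\<lambda>w. 1 :: real) + L2norm P (\<lambda>w. norm (X w))"
      by (intro L2norm_triangle sq_integrable_const sq_integrable_norm X)
    finally show ?thesis by (simp add: L2norm_norm L2norm_const)
  qed
  have "EF X - EF Y = (\<integral>w. F (X w) - F (Y w) \<partial>P)"
    unfolding EF_def by (rule Bochner_Integration.integral_diff[OF integrable_F[OF X] integrable_F[OF Y], symmetric])
  also have "norm \<dots> \<le> (\<integral>w. norm (F (X w) - F (Y w)) \<partial>P)" by (rule integral_norm_bound)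
  also have "\<dots> \<le> (\<integral>w. L * (norm (G w) * norm (X w - Y w)) \<partial>P)"
  proof (rule integral_mono)
    show "norm (F (X w) - F (Y w)) \<le> L * (norm (G w) * norm (X w - Y w))" for w
      using F_Lipschitz[of "X w" "Y w"] unfolding G0 by (simp add: G_def mult.assoc)
  qed (use integrable_F[OF X] integrable_F[OF Y] integrable_norm_mult[OF G XY] in auto)
  also have "\<dots> = L * (\<integral>w. norm (G w) * norm (X w - Y w) \<partial>P)" by simp
  also have "\<dots> \<le> L * (L2norm P G * L2norm P (\<lambda>w. X w - Y w))"
    using L_pos by (intro mult_left_mono integral_Cauchy_Schwarz G XY) auto
  also have "\<dots> \<le> L * ((1 + L2norm P X + L2norm P Y) * L2norm P (\<lambda>w. X w - Y w))"
    using L_pos by (intro mult_left_mono mult_right_mono nG) auto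
  finally show ?thesis by (simp add: mult.assoc)
qed

lemma V_sq_integrable:
  assumes X: "X \<in> sq_integrable P" and u: "norm u = 1"
  shows "(\<lambda>w. V u (X w)) \<in> sq_integrable P"
proof -
  have [measurable]: "X \<in> borel_measurable P" using X by (simp add: sq_integrable_def)
  have "(\<lambda>w. 1 + norm (X w)) \<in> sq_integrable P"
    by (intro sq_integrable_add sq_integrable_const sq_integrable_norm X)
  then show ?thesis
    by (rule sq_integrable_bound[where C = L]) (use norm_V_le[OF u] in \<open>auto simp: add_nonneg_nonneg\<close>)
qed

text \<open>Dominated convergence of difference quotients. Restricting to steps s at most 1 makes
  the bound \<open>L * (norm (G w) * norm (Y w))\<close> independent of s.\<close>

lemma directional_derivative_EF:
  assumes X: "X \<in> sq_integrable P" and Y: "Y \<in> sq_integrable P" and u: "norm u = 1"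
  shows "((\<lambda>s. (EF (\<lambda>w. X w + s *\<^sub>R Y w) \<bullet> outer_square u - EF X \<bullet> outer_square u) / s)
    \<longlongrightarrow> (\<integral>w. V u (X w) \<bullet> Y w \<partial>P)) (at 0 within {0<..1})"
  unfolding tendsto_at_iff_sequentially
proof (intro allI impI)
  fix S :: "nat \<Rightarrow> real" assume S: "\<forall>i. S i \<in> {0<..1} - {0}" "S \<longlonglongrightarrow> 0"
  have S01: "0 < S i" "S i \<le> 1" for i using S(1) by auto
  have [measurable]: "X \<in> borel_measurable P" "Y \<in> borel_measurable P"
    using X Y by (auto simp: sq_integrable_def)
  define q where "q i w = (F (X w + S i *\<^sub>R Y w) \<bullet> outer_square u - F (X w) \<bullet> outer_square u) / S i" for i w
  define G where "G w = 1 + 2 * norm (X w) + norm (Y w)" for w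
  have G: "G \<in> sq_integrable P"
    unfolding G_def using sq_integrable_scaleR[OF sq_integrable_norm[OF X], of 2]
    by (intro sq_integrable_add sq_integrable_const sq_integrable_norm Y) auto
  have XS: "(\<lambda>w. X w + S i *\<^sub>R Y w) \<in> sq_integrable P" for i
    by (intro sq_integrable_add sq_integrable_scaleR X Y)
  have eq: "(EF (\<lambda>w. X w + S i *\<^sub>R Y w) \<bullet> outer_square u - EF X \<bullet> outer_square u) / S i = (\<integral>w. q i w \<partial>P)" for i
    unfolding q_def EF_def using integrable_F[OF XS[of i]] integrable_F[OF X] by simp
  have "(\<lambda>i. \<integral>w. q i w \<partial>P) \<longlonglongrightarrow> (\<integral>w. V u (X w) \<bullet> Y w \<partial>P)"
  proof (rule integral_dominated_convergence[where w = "\<lambda>w. L * (norm (G w) * norm (Y w))"])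
    show "integrable P (\<lambda>w. L * (norm (G w) * norm (Y w)))" using integrable_norm_mult[OF G Y] by simp
    show "AE w in P. norm (q i w) \<le> L * (norm (G w) * norm (Y w))" for i
    proof (rule AE_I2)
      fix w
      have "norm (F (X w + S i *\<^sub>R Y w) - F (X w)) \<le> L * (1 + norm (X w + S i *\<^sub>R Y w) + norm (X w)) * norm (S i *\<^sub>R Y w)"
        using F_Lipschitz[of "X w + S i *\<^sub>R Y w" "X w"] by simp
      also have "\<dots> \<le> L * G w * norm (S i *\<^sub>R Y w)"
      proof (intro mult_right_mono mult_left_mono)
        have "norm (S i *\<^sub>R Y w) \<le> norm (Y w)" using S01[of i] by (simp add: mult_left_le_one_le)
        then show "1 + norm (X w + S i *\<^sub>R Y w) + norm (X w) \<le> G w"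
          using norm_triangle_ineq[of "X w" "S i *\<^sub>R Y w"] unfolding G_def by linarith
      qed (use L_pos in auto)
      finally have b: "norm (F (X w + S i *\<^sub>R Y w) - F (X w)) \<le> S i * (L * (norm (G w) * norm (Y w)))"
        using S01[of i] by (simp add: G_def mult_ac)
      have "norm (q i w) = \<bar>(F (X w + S i *\<^sub>R Y w) - F (X w)) \<bullet> outer_square u\<bar> / S i"
        using S01[of i] by (simp add: q_def inner_diff_left)
      also have "\<dots> \<le> norm (F (X w + S i *\<^sub>R Y w) - F (X w)) / S i"
        using Cauchy_Schwarz_ineq2[of "F (X w + S i *\<^sub>R Y w) - F (X w)" "outer_square u"] u S01[of i]
        by (intro divide_right_mono) (auto simp: norm_outer_square)
      also have "\<dots> \<le> L * (norm (G w) * norm (Y w))" using b S01[of i] by (simp add: field_simps)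
      finally show "norm (q i w) \<le> L * (norm (G w) * norm (Y w))" .
    qed
    show "AE w in P. (\<lambda>i. q i w) \<longlonglongrightarrow> V u (X w) \<bullet> Y w"
    proof (rule AE_I2)
      fix w
      have "((\<lambda>s. X w + s *\<^sub>R Y w) has_derivative (\<lambda>s. s *\<^sub>R Y w)) (at 0)"
        by (auto intro!: derivative_eq_intros)
      from has_derivative_compose[OF this, of F]
      have "((\<lambda>s. F (X w + s *\<^sub>R Y w)) has_derivative (\<lambda>s. frechet_derivative F (at (X w)) (s *\<^sub>R Y w))) (at 0)"
        using F_has_derivative[of "X w"] by simp
      then have "((\<lambda>s. F (X w + s *\<^sub>R Y w) \<bullet> outer_square u) has_derivative
          (\<lambda>s. frechet_derivative F (at (X w)) (s *\<^sub>R Y w) \<bullet> outer_square u)) (at 0)"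
        by (rule has_derivative_inner_left)
      then have "((\<lambda>s. F (X w + s *\<^sub>R Y w) \<bullet> outer_square u) has_field_derivative V u (X w) \<bullet> Y w) (at 0)"
        using has_derivative_linear[OF F_has_derivative[of "X w"]]
        by (simp add: has_field_derivative_def linear_cmul V_dot mult_commute_abs)
      then have lim: "((\<lambda>h. (F (X w + h *\<^sub>R Y w) \<bullet> outer_square u - F (X w) \<bullet> outer_square u) / h) \<longlongrightarrow> V u (X w) \<bullet> Y w) (at 0)"
        by (simp add: DERIV_def)
      have "filterlim S (at 0) sequentially"
        using S(2) S01 by (intro filterlim_atI) (auto intro!: always_eventually simp: less_imp_neq[symmetric])
      from filterlim_compose[OF lim this] show "(\<lambda>i. q i w) \<longlonglongrightarrow> V u (X w) \<bullet> Y w"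
        by (simp add: q_def)
    qed
    show "(\<lambda>w. V u (X w) \<bullet> Y w) \<in> borel_measurable P" by measurable
    show "q i \<in> borel_measurable P" for i unfolding q_def by measurable
  qed
  then show "((\<lambda>s. (EF (\<lambda>w. X w + s *\<^sub>R Y w) \<bullet> outer_square u - EF X \<bullet> outer_square u) / s) \<circ> S)
      \<longlonglongrightarrow> (\<integral>w. V u (X w) \<bullet> Y w \<partial>P)"
    by (simp add: comp_def eq)
qed

text \<open>Only the upper one-sided estimate of \<open>lambda_min\<close> along a line is available, since
  \<open>lambda_min\<close> is a minimum of linear functionals and \<open>u\<close> is optimal at the base point only.\<close>

lemma lambda_min_upper_slope:
  assumes X: "X \<in> sq_integrable P" and Y: "Y \<in> sq_integrable P"
    and u: "norm u = 1" "EF X *v u = lambda_min (EF X) *\<^sub>R u" and \<epsilon>: "\<epsilon> > 0"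
  shows "\<exists>\<delta>>0. \<forall>s. 0 < s \<longrightarrow> s < \<delta> \<longrightarrow> lambda_min (EF (\<lambda>w. X w + s *\<^sub>R Y w))
    \<le> lambda_min (EF X) + s * ((\<integral>w. V u (X w) \<bullet> Y w \<partial>P) + \<epsilon>)"
proof -
  let ?D = "\<integral>w. V u (X w) \<bullet> Y w \<partial>P"
  have "eventually (\<lambda>s. (EF (\<lambda>w. X w + s *\<^sub>R Y w) \<bullet> outer_square u - EF X \<bullet> outer_square u) / s < ?D + \<epsilon>)
      (at 0 within {0<..1})"
    by (rule order_tendstoD(2)[OF directional_derivative_EF[OF X Y u(1)]]) (use \<epsilon> in simp)
  then obtain \<delta> where \<delta>: "\<delta> > 0" "\<And>s. s \<in> {0<..1} \<Longrightarrow> s \<noteq> 0 \<Longrightarrow> dist s 0 < \<delta> \<Longrightarrow>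
      (EF (\<lambda>w. X w + s *\<^sub>R Y w) \<bullet> outer_square u - EF X \<bullet> outer_square u) / s < ?D + \<epsilon>"
    unfolding eventually_at by blast
  have EX: "EF X \<bullet> outer_square u = lambda_min (EF X)"
    using u by (simp add: matrix_quadratic_form[symmetric] norm_eq_1)
  have "lambda_min (EF (\<lambda>w. X w + s *\<^sub>R Y w)) \<le> lambda_min (EF X) + s * (?D + \<epsilon>)" if "0 < s" "s < min \<delta> 1" for s
  proof -
    have "lambda_min (EF (\<lambda>w. X w + s *\<^sub>R Y w)) \<le> EF (\<lambda>w. X w + s *\<^sub>R Y w) \<bullet> outer_square u"
      by (rule lambda_min_le[OF EF_sym u(1)]) (intro sq_integrable_add sq_integrable_scaleR X Y)
    also have "\<dots> \<le> lambda_min (EF X) + s * (?D + \<epsilon>)"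
      using \<delta>(2)[of s] that by (simp add: EX field_simps)
    finally show ?thesis .
  qed
  then show ?thesis using \<delta>(1) by (intro exI[of _ "min \<delta> 1"]) auto
qed

lemma law_P2:
  assumes X: "X \<in> sq_integrable P"
  shows "distr P borel X \<in> P2"
proof -
  have [measurable]: "X \<in> borel_measurable P" using X by (simp add: sq_integrable_def)
  show ?thesis using X by (auto simp: P2_def sq_integrable_def integrable_distr_eq intro!: prob_space_distr)
qed

lemma law_integral_F:
  assumes X: "X \<in> sq_integrable P"
  shows "(\<integral>x. F x \<partial>distr P borel X) = EF X"
  unfolding EF_def by (rule integral_distr) (use X in \<open>auto simp: sq_integrable_def\<close>)

lemma law_integral_V:
  assumes X: "X \<in> sq_integrable P"
  shows "sqrt (\<integral>x. (norm (V u x))\<^sup>2 \<partial>distr P borel X) = L2norm P (\<lambda>w. V u (X w))"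
  unfolding L2norm_def by (subst integral_distr) (use X in \<open>auto simp: sq_integrable_def\<close>)

text \<open>The constant in \<open>EF_Lipschitz\<close> depends on the norms of both vectors; that
  of \<open>X n\<close> is replaced by its distance to \<open>Z\<close> plus the norm of
  \<open>Z\<close>, so the constant stays bounded.\<close>

lemma lambda_min_EF_tendsto:
  assumes X: "\<And>n. X n \<in> sq_integrable P" and Z: "Z \<in> sq_integrable P"
    and lim: "(\<lambda>n :: nat. L2norm P (\<lambda>w. X n w - Z w)) \<longlonglongrightarrow> 0"
  shows "(\<lambda>n. lambda_min (EF (X n))) \<longlonglongrightarrow> lambda_min (EF Z)"
proof -
  have "norm (lambda_min (EF (X n)) - lambda_min (EF Z)) \<le>
      L * (1 + (L2norm P (\<lambda>w. X n w - Z w) + L2norm P Z) + L2norm P Z) * L2norm P (\<lambda>w. X n w - Z w)" for n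
  proof -
    have "L2norm P (X n) \<le> L2norm P (\<lambda>w. X n w - Z w) + L2norm P Z"
      using L2norm_triangle[OF sq_integrable_diff[OF X[of n] Z] Z] by simp
    then have "L * (1 + L2norm P (X n) + L2norm P Z) * L2norm P (\<lambda>w. X n w - Z w) \<le>
        L * (1 + (L2norm P (\<lambda>w. X n w - Z w) + L2norm P Z) + L2norm P Z) * L2norm P (\<lambda>w. X n w - Z w)"
      using L_pos by (intro mult_right_mono mult_left_mono) auto
    then show ?thesis
      using lambda_min_Lipschitz[OF EF_sym[OF X[of n]] EF_sym[OF Z]] EF_Lipschitz[OF X[of n] Z] by simp
  qed
  then have ev: "eventually (\<lambda>n. norm (lambda_min (EF (X n)) - lambda_min (EF Z)) \<le>
      L * (1 + (L2norm P (\<lambda>w. X n w - Z w) + L2norm P Z) + L2norm P Z) * L2norm P (\<lambda>w. X n w - Z w)) sequentially"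
    by (rule always_eventually[OF allI])
  have "(\<lambda>n. L * (1 + (L2norm P (\<lambda>w. X n w - Z w) + L2norm P Z) + L2norm P Z) *
      L2norm P (\<lambda>w. X n w - Z w)) \<longlonglongrightarrow> L * (1 + (0 + L2norm P Z) + L2norm P Z) * 0"
    by (intro tendsto_intros lim)
  then have "(\<lambda>n. L * (1 + (L2norm P (\<lambda>w. X n w - Z w) + L2norm P Z) + L2norm P Z) *
      L2norm P (\<lambda>w. X n w - Z w)) \<longlonglongrightarrow> 0" by simp
  with ev have "(\<lambda>n. lambda_min (EF (X n)) - lambda_min (EF Z)) \<longlonglongrightarrow> 0"
    by (rule Lim_null_comparison)
  then show ?thesis by (rule Lim_null[THEN iffD2])
qed

text \<open>Moving by s against the field, of norm v, covers distance s v and lowers the eigenvalue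
  by s v^2 to first order, of which half is kept. The tangent of the power contributes (1 - q)
  l^(-q), and the slope hypothesis says that l^(-q) v is at least a.\<close>

lemma descent_step:
  assumes X: "X \<in> sq_integrable P" and pos: "lambda_min (EF X) > 0" and a: "a > 0" and q: "0 \<le> q" "q < 1"
    and u: "norm u = 1" "EF X *v u = lambda_min (EF X) *\<^sub>R u"
    and slope: "a * lambda_min (EF X) powr q \<le> L2norm P (\<lambda>w. V u (X w))"
  shows "\<exists>Y\<in>sq_integrable P. L2norm P (\<lambda>w. X w - Y w) > 0 \<and>
    lambda_min (EF Y) powr (1 - q) + (1 - q) * a / 2 * L2norm P (\<lambda>w. X w - Y w) \<le> lambda_min (EF X) powr (1 - q)"
proof -
  define l where "l = lambda_min (EF X)"
  define v where "v = L2norm P (\<lambda>w. V u (X w))"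
  have l: "l > 0" using pos by (simp add: l_def)
  have v: "v > 0" using slope a l by (auto simp: v_def l_def intro: less_le_trans[rotated])
  have VX: "(\<lambda>w. - V u (X w)) \<in> sq_integrable P"
    using sq_integrable_scaleR[OF V_sq_integrable[OF X u(1)], of "- 1"] by simp
  have "(\<integral>w. V u (X w) \<bullet> - V u (X w) \<partial>P) = - v\<^sup>2"
    by (simp add: v_def L2norm_power2 power2_norm_eq_inner)
  \<comment> \<open>The accuracy v^2 / 2 is where half of the descent rate is given up.\<close>
  then obtain \<delta> where \<delta>: "\<delta> > 0" "\<And>s. 0 < s \<Longrightarrow> s < \<delta> \<Longrightarrow>
      lambda_min (EF (\<lambda>w. X w + s *\<^sub>R - V u (X w))) \<le> l + s * (- v\<^sup>2 + v\<^sup>2 / 2)"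
    using lambda_min_upper_slope[OF X VX u, of "v\<^sup>2 / 2"] v unfolding l_def by auto
  define s where "s = \<delta> / 2"
  define Y where "Y w = X w + s *\<^sub>R - V u (X w)" for w
  have s: "0 < s" "s < \<delta>" using \<delta> by (auto simp: s_def)
  have Y: "Y \<in> sq_integrable P" unfolding Y_def by (intro sq_integrable_add sq_integrable_scaleR X VX)
  have dist: "L2norm P (\<lambda>w. X w - Y w) = s * v"
    using s L2norm_scaleR[of P s "\<lambda>w. V u (X w)"] by (simp add: Y_def v_def)
  have le: "lambda_min (EF Y) - l \<le> - s * v\<^sup>2 / 2" using \<delta>(2)[OF s] by (simp add: Y_def[abs_def] algebra_simps)
  have "lambda_min (EF Y) powr (1 - q) \<le> l powr (1 - q) + (1 - q) * l powr (1 - q - 1) * (lambda_min (EF Y) - l)"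
    by (rule powr_le_tangent) (use l q lambda_min_nonneg[OF EF_psd[OF Y]] in auto)
  also have "\<dots> \<le> l powr (1 - q) + (1 - q) * l powr (1 - q - 1) * (- s * v\<^sup>2 / 2)"
    using q by (intro add_left_mono mult_left_mono le) auto
  also have "\<dots> = l powr (1 - q) - (1 - q) * s * v / 2 * (l powr (- q) * v)"
    by (simp add: power2_eq_square)
  also have "\<dots> \<le> l powr (1 - q) - (1 - q) * s * v / 2 * a"
  proof -
    have "l powr (- q) * (a * l powr q) \<le> l powr (- q) * v"
      using slope by (intro mult_left_mono) (auto simp: v_def l_def)
    moreover have "l powr (- q) * l powr q = 1" using l by (simp flip: powr_add)
    ultimately have "a \<le> l powr (- q) * v" by (simp add: mult.left_commute)
    then show ?thesis using q s v by (intro diff_left_mono mult_left_mono) auto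
  qed
  finally have "lambda_min (EF Y) powr (1 - q) + (1 - q) * a / 2 * L2norm P (\<lambda>w. X w - Y w) \<le> l powr (1 - q)"
    by (simp add: dist algebra_simps)
  moreover have "L2norm P (\<lambda>w. X w - Y w) > 0" using s v by (simp add: dist)
  ultimately show ?thesis using Y unfolding l_def by blast
qed

text \<open>The descent principle in L2, with the power 1 - q of the eigenvalue as potential. The
  slope hypothesis concerns measures and is applied to the law of the current vector, so the
  eigenvector may change freely from step to step.\<close>

lemma reach_singular:
  assumes a: "a > 0" and q: "0 \<le> q" "q < 1" and X0: "X0 \<in> sq_integrable P"
    and slope: "\<And>\<nu>. \<nu> \<in> P2 \<Longrightarrow> lambda_min (\<integral>x. F x \<partial>\<nu>) > 0 \<Longrightarrow>
      \<exists>u. norm u = 1 \<and> (\<integral>x. F x \<partial>\<nu>) *v u = lambda_min (\<integral>x. F x \<partial>\<nu>) *\<^sub>R u \<and>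
        a * lambda_min (\<integral>x. F x \<partial>\<nu>) powr q \<le> sqrt (\<integral>x. (norm (V u x))\<^sup>2 \<partial>\<nu>)"
  shows "\<exists>Z\<in>sq_integrable P. lambda_min (EF Z) = 0 \<and>
    L2norm P (\<lambda>w. X0 w - Z w) \<le> 2 / ((1 - q) * a) * lambda_min (EF X0) powr (1 - q)"
proof -
  define c where "c = (1 - q) * a / 2"
  have c: "c > 0" using a q by (simp add: c_def)
  have "\<exists>Z\<in>sq_integrable P. lambda_min (EF Z) powr (1 - q) = 0 \<and>
      c * L2norm P (\<lambda>w. X0 w - Z w) \<le> lambda_min (EF X0) powr (1 - q)"
  proof (rule descent_reaches_zero[where d = "\<lambda>X Y. L2norm P (\<lambda>w. X w - Y w)" and c = c
        and S = "sq_integrable P" and G = "\<lambda>X. lambda_min (EF X) powr (1 - q)"])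
    show "c > 0" "X0 \<in> sq_integrable P" by fact+
    fix X assume X: "X \<in> sq_integrable P" and "lambda_min (EF X) powr (1 - q) > 0"
    then have pos: "lambda_min (EF X) > 0"
      using lambda_min_nonneg[OF EF_psd[OF X]] by (simp add: less_le)
    then obtain u where "norm u = 1" "EF X *v u = lambda_min (EF X) *\<^sub>R u"
      "a * lambda_min (EF X) powr q \<le> L2norm P (\<lambda>w. V u (X w))"
      using slope[OF law_P2[OF X]] law_integral_F[OF X] law_integral_V[OF X] by auto
    then show "\<exists>Y\<in>sq_integrable P. L2norm P (\<lambda>w. X w - Y w) > 0 \<and>
        lambda_min (EF Y) powr (1 - q) + c * L2norm P (\<lambda>w. X w - Y w) \<le> lambda_min (EF X) powr (1 - q)"
      using descent_step[OF X pos a q] unfolding c_def by blast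
  next
    fix X :: "nat \<Rightarrow> 'w \<Rightarrow> 'a" and Z
    assume "\<And>n. X n \<in> sq_integrable P" "Z \<in> sq_integrable P" "(\<lambda>n. L2norm P (\<lambda>w. X n w - Z w)) \<longlonglongrightarrow> 0"
    from lambda_min_EF_tendsto[OF this]
    show "(\<lambda>n. lambda_min (EF (X n)) powr (1 - q)) \<longlonglongrightarrow> lambda_min (EF Z) powr (1 - q)"
      using lambda_min_nonneg[OF EF_psd] \<open>\<And>n. X n \<in> sq_integrable P\<close> q
      by (intro tendsto_powr' tendsto_const disjI2 conjI always_eventually) auto
  next
    show "L2norm P (\<lambda>w. X w - X w) = 0" for X :: "'w \<Rightarrow> 'a" by (simp add: L2norm_def)
    show "\<exists>Z\<in>sq_integrable P. (\<lambda>n. L2norm P (\<lambda>w. X n w - Z w)) \<longlonglongrightarrow> 0"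
      if "\<And>n. X n \<in> sq_integrable P" "summable (\<lambda>n. L2norm P (\<lambda>w. X n w - X (Suc n) w))"
      for X :: "nat \<Rightarrow> 'w \<Rightarrow> 'a"
      by (rule sq_integrable_complete[OF that])
  qed (simp_all add: L2dist_triangle)
  then obtain Z where Z: "Z \<in> sq_integrable P" "lambda_min (EF Z) = 0"
    "c * L2norm P (\<lambda>w. X0 w - Z w) \<le> lambda_min (EF X0) powr (1 - q)" by auto
  moreover have "L2norm P (\<lambda>w. X0 w - Z w) \<le> 2 / ((1 - q) * a) * lambda_min (EF X0) powr (1 - q)"
    using Z(3) c a q by (simp add: c_def field_simps)
  ultimately show ?thesis by blast
qed

text \<open>The segment starts at the singular vector \<open>Z\<close>, where the power of the
  eigenvalue vanishes, and ends at \<open>X\<close>. By Cauchy-Schwarz the growth along it is at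
  most the slope times the norm of X - Z, and the powers of l cancel.\<close>

lemma distance_to_singular:
  assumes b: "b > 0" and q: "0 \<le> q" "q < 1" and X: "X \<in> sq_integrable P" and Z: "Z \<in> sq_integrable P"
    and sing: "lambda_min (EF Z) = 0"
    and slope: "\<And>\<nu>. \<nu> \<in> P2 \<Longrightarrow> lambda_min (\<integral>x. F x \<partial>\<nu>) > 0 \<Longrightarrow>
      \<exists>u. norm u = 1 \<and> (\<integral>x. F x \<partial>\<nu>) *v u = lambda_min (\<integral>x. F x \<partial>\<nu>) *\<^sub>R u \<and>
        sqrt (\<integral>x. (norm (V u x))\<^sup>2 \<partial>\<nu>) \<le> b * lambda_min (\<integral>x. F x \<partial>\<nu>) powr q"
  shows "lambda_min (EF X) powr (1 - q) \<le> (1 - q) * b * L2norm P (\<lambda>w. X w - Z w)"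
proof -
  define Y where "Y w = X w - Z w" for w
  define I where "I t w = Z w + t *\<^sub>R Y w" for t w
  define \<phi> where "\<phi> t = lambda_min (EF (I t)) powr (1 - q)" for t
  define W where "W = L2norm P Y"
  have Y: "Y \<in> sq_integrable P" unfolding Y_def by (rule sq_integrable_diff[OF X Z])
  have I: "I t \<in> sq_integrable P" for t unfolding I_def by (intro sq_integrable_add sq_integrable_scaleR Z Y)
  have nn: "0 \<le> lambda_min (EF (I t))" for t by (rule lambda_min_nonneg[OF EF_psd[OF I]])
  have cont: "continuous_on {0..1} (\<lambda>t. lambda_min (EF (I t)))"
    unfolding continuous_on_sequentially
  proof (intro allI ballI impI)
    fix S :: "nat \<Rightarrow> real" and t assume "t \<in> {0..1}" and S: "(\<forall>n. S n \<in> {0..1}) \<and> S \<longlonglongrightarrow> t"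
    have "L2norm P (\<lambda>w. I (S n) w - I t w) = \<bar>S n - t\<bar> * W" for n
      using L2norm_scaleR[of P "S n - t" Y] by (simp add: I_def W_def scaleR_left_diff_distrib)
    moreover have "(\<lambda>n. \<bar>S n - t\<bar> * W) \<longlonglongrightarrow> \<bar>t - t\<bar> * W" using S by (intro tendsto_intros) auto
    ultimately have "(\<lambda>n. L2norm P (\<lambda>w. I (S n) w - I t w)) \<longlonglongrightarrow> 0" by simp
    from lambda_min_EF_tendsto[OF I I this]
    show "((\<lambda>t. lambda_min (EF (I t))) \<circ> S) \<longlonglongrightarrow> lambda_min (EF (I t))" by (simp add: comp_def)
  qed
  have "\<phi> 1 \<le> (1 - q) * b * W * (1 - 0)"
  proof (rule growth_bound_of_upper_slope)
    show "continuous_on {0..1} \<phi>"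
      unfolding \<phi>_def by (intro continuous_on_powr' cont continuous_on_const) (use nn q in auto)
    have "I 0 = Z" by (simp add: I_def fun_eq_iff)
    then show "\<phi> 0 = 0" using sing by (simp add: \<phi>_def)
    show "0 \<le> (1 - q) * b * W" using b q by (simp add: W_def)
    fix t \<epsilon> :: real assume t: "0 \<le> t" "t < 1" "\<phi> t > 0" and \<epsilon>: "\<epsilon> > 0"
    define l where "l = lambda_min (EF (I t))"
    have l: "l > 0" using t(3) nn[of t] by (auto simp: \<phi>_def l_def less_le)
    obtain u where u: "norm u = 1" "EF (I t) *v u = lambda_min (EF (I t)) *\<^sub>R u"
      "L2norm P (\<lambda>w. V u (I t w)) \<le> b * l powr q"
      using slope[OF law_P2[OF I[of t]]] law_integral_F[OF I[of t]] law_integral_V[OF I[of t]] l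
      unfolding l_def by auto
    have VI: "(\<lambda>w. V u (I t w)) \<in> sq_integrable P" by (rule V_sq_integrable[OF I u(1)])
    have D: "(\<integral>w. V u (I t w) \<bullet> Y w \<partial>P) \<le> b * l powr q * W"
    proof -
      have "(\<integral>w. V u (I t w) \<bullet> Y w \<partial>P) \<le> (\<integral>w. norm (V u (I t w)) * norm (Y w) \<partial>P)"
      proof (rule integral_mono[OF _ integrable_norm_mult[OF VI Y] norm_cauchy_schwarz])
        show "integrable P (\<lambda>w. V u (I t w) \<bullet> Y w)"
          by (rule Bochner_Integration.integrable_bound[OF integrable_norm_mult[OF VI Y]])
            (use VI Y in \<open>auto simp: sq_integrable_def Cauchy_Schwarz_ineq2\<close>)
      qed
      also have "\<dots> \<le> L2norm P (\<lambda>w. V u (I t w)) * W"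
        unfolding W_def by (rule integral_Cauchy_Schwarz[OF VI Y])
      also have "\<dots> \<le> b * l powr q * W" using u(3) by (intro mult_right_mono) (auto simp: W_def)
      finally show ?thesis .
    qed
    \<comment> \<open>\<open>k\<close> is the derivative of the power at l. The eigenvalue is
      estimated with error eps / k so that the error for the power is exactly eps.\<close>
    define k where "k = (1 - q) * l powr (1 - q - 1)"
    have k: "k > 0" using q l by (simp add: k_def)
    have kl: "k * (b * l powr q * W) = (1 - q) * b * W"
    proof -
      have "l powr (- q) * l powr q = 1" using l by (simp flip: powr_add)
      then show ?thesis by (simp add: k_def)
    qed
    obtain \<delta> where \<delta>: "\<delta> > 0" "\<forall>s. 0 < s \<longrightarrow> s < \<delta> \<longrightarrow> lambda_min (EF (\<lambda>w. I t w + s *\<^sub>R Y w))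
        \<le> lambda_min (EF (I t)) + s * ((\<integral>w. V u (I t w) \<bullet> Y w \<partial>P) + \<epsilon> / k)"
      using lambda_min_upper_slope[OF I[of t] Y u(1,2), of "\<epsilon> / k"] \<epsilon> k by auto
    have "\<phi> s \<le> \<phi> t + (s - t) * ((1 - q) * b * W + \<epsilon>)" if s: "t < s" "s < t + \<delta>" for s
    proof -
      have Is: "(\<lambda>w. I t w + (s - t) *\<^sub>R Y w) = I s" by (simp add: I_def fun_eq_iff algebra_simps)
      have "lambda_min (EF (I s)) \<le> l + (s - t) * ((\<integral>w. V u (I t w) \<bullet> Y w \<partial>P) + \<epsilon> / k)"
        using \<delta>(2)[rule_format, of "s - t"] s unfolding Is l_def by simp
      also have "\<dots> \<le> l + (s - t) * (b * l powr q * W + \<epsilon> / k)"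
        using s D by (intro add_left_mono mult_left_mono) auto
      finally have le: "lambda_min (EF (I s)) - l \<le> (s - t) * (b * l powr q * W + \<epsilon> / k)" by simp
      have "\<phi> s \<le> l powr (1 - q) + k * (lambda_min (EF (I s)) - l)"
        unfolding \<phi>_def k_def by (rule powr_le_tangent) (use l q nn in auto)
      also have "\<dots> \<le> l powr (1 - q) + k * ((s - t) * (b * l powr q * W + \<epsilon> / k))"
        using k by (intro add_left_mono mult_left_mono le) auto
      also have "\<dots> = \<phi> t + (s - t) * (k * (b * l powr q * W) + \<epsilon>)"
        using k by (simp add: \<phi>_def l_def field_simps)
      finally show ?thesis by (simp only: kl)
    qed
    then show "\<exists>\<delta>>0. \<forall>s. t < s \<longrightarrow> s < t + \<delta> \<longrightarrow> s \<le> 1 \<longrightarrow> \<phi> s \<le> \<phi> t + (s - t) * ((1 - q) * b * W + \<epsilon>)"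
      using \<delta>(1) by blast
  qed simp
  moreover have "I 1 = X" by (simp add: I_def Y_def fun_eq_iff)
  ultimately show ?thesis by (simp add: \<phi>_def W_def Y_def[abs_def])
qed

end

section \<open>From random vectors to Wasserstein distances\<close>

text \<open>A lower bound for a real-valued infimum requires a nonempty index set, and the product
  measure provides a coupling.\<close>

lemma pair_measure_in_couplings:
  assumes \<mu>: "\<mu> \<in> P2" and \<nu>: "\<nu> \<in> P2"
  shows "\<mu> \<Otimes>\<^sub>M \<nu> \<in> couplings \<mu> \<nu>"
proof -
  have p: "prob_space \<mu>" "prob_space \<nu>" and sets: "sets \<mu> = sets borel" "sets \<nu> = sets borel"
    using \<mu> \<nu> by (auto simp: P2_def)
  interpret pair_prob_space \<mu> \<nu>
    using p by (simp add: pair_prob_space_def pair_sigma_finite_def prob_space_imp_sigma_finite)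
  have "distr (\<mu> \<Otimes>\<^sub>M \<nu>) borel fst = distr (\<mu> \<Otimes>\<^sub>M \<nu>) \<mu> fst"
    by (rule distr_cong) (use sets in auto)
  also have "\<dots> = \<mu>" by (rule prob_space.distr_pair_fst[OF p(2)])
  finally have 1: "distr (\<mu> \<Otimes>\<^sub>M \<nu>) borel fst = \<mu>" .
  have "distr (\<mu> \<Otimes>\<^sub>M \<nu>) borel snd = distr (\<mu> \<Otimes>\<^sub>M \<nu>) \<nu> snd"
    by (rule distr_cong) (use sets in auto)
  also have "\<dots> = distr (distr (\<nu> \<Otimes>\<^sub>M \<mu>) (\<mu> \<Otimes>\<^sub>M \<nu>) (\<lambda>(x, y). (y, x))) \<nu> snd"
    by (simp only: distr_pair_swap[symmetric])
  also have "\<dots> = distr (\<nu> \<Otimes>\<^sub>M \<mu>) \<nu> (snd \<circ> (\<lambda>(x, y). (y, x)))"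
    by (rule distr_distr[OF measurable_snd measurable_pair_swap'])
  also have "snd \<circ> (\<lambda>(x :: 'a, y :: 'a). (y, x)) = fst" by (auto simp: fun_eq_iff)
  also have "distr (\<nu> \<Otimes>\<^sub>M \<mu>) \<nu> fst = \<nu>" by (rule prob_space.distr_pair_fst[OF p(1)])
  finally have 2: "distr (\<mu> \<Otimes>\<^sub>M \<nu>) borel snd = \<nu>" .
  show ?thesis using prob_space_pair[OF p] 1 2 sets_pair_measure_cong[OF sets] by (simp add: couplings_def)
qed

context psd_map
begin

lemma integral_F_psd:
  assumes \<mu>: "\<mu> \<in> P2"
  shows "(\<integral>x. F x \<partial>\<mu>) \<in> psd_cone"
proof -
  interpret prob_space \<mu> using \<mu> by (simp add: P2_def)
  interpret psd_map_prob F L \<mu> ..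
  have "(\<lambda>x. x) \<in> sq_integrable \<mu>"
    using \<mu> by (auto simp: sq_integrable_def P2_def intro: measurable_ident_sets)
  from EF_psd[OF this] show ?thesis by (simp add: EF_def)
qed

text \<open>The base space is mu itself and descent starts at the identity, whose law is mu. The
  endpoint \<open>Z\<close> has a singular law.\<close>

lemma W2_singular_upper:
  assumes a: "a > 0" and q: "0 \<le> q" "q < 1" and \<mu>: "\<mu> \<in> P2"
    and slope: "\<And>\<nu>. \<nu> \<in> P2 \<Longrightarrow> lambda_min (\<integral>x. F x \<partial>\<nu>) > 0 \<Longrightarrow>
      \<exists>u. norm u = 1 \<and> (\<integral>x. F x \<partial>\<nu>) *v u = lambda_min (\<integral>x. F x \<partial>\<nu>) *\<^sub>R u \<and>
        a * lambda_min (\<integral>x. F x \<partial>\<nu>) powr q \<le> sqrt (\<integral>x. (norm (V u x))\<^sup>2 \<partial>\<nu>)"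
  shows "\<exists>\<nu>\<in>P2. lambda_min (\<integral>x. F x \<partial>\<nu>) = 0 \<and>
    W2 \<mu> \<nu> \<le> 2 / ((1 - q) * a) * lambda_min (\<integral>x. F x \<partial>\<mu>) powr (1 - q)"
proof -
  interpret prob_space \<mu> using \<mu> by (simp add: P2_def)
  interpret psd_map_prob F L \<mu> ..
  have sets[measurable_cong]: "sets \<mu> = sets borel" using \<mu> by (simp add: P2_def)
  have id: "(\<lambda>x. x) \<in> sq_integrable \<mu>"
    using \<mu> by (auto simp: sq_integrable_def P2_def intro: measurable_ident_sets)
  obtain Z where Z: "Z \<in> sq_integrable \<mu>" "lambda_min (EF Z) = 0"
    "L2norm \<mu> (\<lambda>x. x - Z x) \<le> 2 / ((1 - q) * a) * lambda_min (EF (\<lambda>x. x)) powr (1 - q)"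
    using reach_singular[OF a q id slope] by blast
  have [measurable]: "Z \<in> borel_measurable \<mu>" using Z by (simp add: sq_integrable_def)
  define \<nu> where "\<nu> = distr \<mu> borel Z"
  \<comment> \<open>The joint law of the identity and \<open>Z\<close> is a coupling whose cost is
    their L2 distance.\<close>
  define \<pi> where "\<pi> = distr \<mu> (borel \<Otimes>\<^sub>M borel) (\<lambda>x. (x, Z x))"
  have mp: "(\<lambda>x. (x, Z x)) \<in> \<mu> \<rightarrow>\<^sub>M borel \<Otimes>\<^sub>M borel" by measurable
  have "\<pi> \<in> couplings \<mu> \<nu>"
    unfolding couplings_def
  proof (intro CollectI conjI)
    show "prob_space \<pi>" unfolding \<pi>_def by (rule prob_space_distr[OF mp])
    show "sets \<pi> = sets (borel \<Otimes>\<^sub>M borel)" by (simp add: \<pi>_def)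
    show "distr \<pi> borel fst = \<mu>"
      unfolding \<pi>_def by (subst distr_distr[OF measurable_fst mp]) (simp add: comp_def distr_id2 sets)
    show "distr \<pi> borel snd = \<nu>"
      unfolding \<pi>_def \<nu>_def by (subst distr_distr[OF measurable_snd mp]) (simp add: comp_def)
  qed
  moreover have "sqrt (\<integral>z. (norm (fst z - snd z))\<^sup>2 \<partial>\<pi>) = L2norm \<mu> (\<lambda>x. x - Z x)"
    unfolding \<pi>_def L2norm_def by (subst integral_distr[OF mp]) auto
  ultimately have "W2 \<mu> \<nu> \<le> L2norm \<mu> (\<lambda>x. x - Z x)"
    unfolding W2_def by (metis (mono_tags, lifting) cINF_lower bdd_belowI2 real_sqrt_ge_zero
        Bochner_Integration.integral_nonneg zero_le_power2)
  moreover have "lambda_min (\<integral>x. F x \<partial>\<nu>) = 0" using Z law_integral_F[OF Z(1)] by (simp add: \<nu>_def)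
  moreover have "\<nu> \<in> P2" unfolding \<nu>_def by (rule law_P2[OF Z(1)])
  ultimately show ?thesis using Z(3) by (intro bexI[of _ \<nu>]) (auto simp: EF_def)
qed

text \<open>Every coupling serves as a base space on which the two projections have laws mu and nu,
  so the L2 estimate bounds each transport cost separately; optimality of a coupling does not
  enter.\<close>

lemma W2_singular_lower:
  assumes b: "b > 0" and q: "0 \<le> q" "q < 1" and \<mu>: "\<mu> \<in> P2" and \<nu>: "\<nu> \<in> P2"
    and sing: "lambda_min (\<integral>x. F x \<partial>\<nu>) = 0"
    and slope: "\<And>\<nu>. \<nu> \<in> P2 \<Longrightarrow> lambda_min (\<integral>x. F x \<partial>\<nu>) > 0 \<Longrightarrow>
      \<exists>u. norm u = 1 \<and> (\<integral>x. F x \<partial>\<nu>) *v u = lambda_min (\<integral>x. F x \<partial>\<nu>) *\<^sub>R u \<and>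
        sqrt (\<integral>x. (norm (V u x))\<^sup>2 \<partial>\<nu>) \<le> b * lambda_min (\<integral>x. F x \<partial>\<nu>) powr q"
  shows "1 / ((1 - q) * b) * lambda_min (\<integral>x. F x \<partial>\<mu>) powr (1 - q) \<le> W2 \<mu> \<nu>"
  unfolding W2_def
proof (rule cINF_greatest)
  show "couplings \<mu> \<nu> \<noteq> {}" using pair_measure_in_couplings[OF \<mu> \<nu>] by blast
next
  fix \<pi> assume "\<pi> \<in> couplings \<mu> \<nu>"
  then have \<pi>: "prob_space \<pi>" "sets \<pi> = sets (borel \<Otimes>\<^sub>M borel)" "distr \<pi> borel fst = \<mu>" "distr \<pi> borel snd = \<nu>"
    by (auto simp: couplings_def)
  interpret prob_space \<pi> by fact
  interpret psd_map_prob F L \<pi> ..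
  have m: "fst \<in> borel_measurable \<pi>" "snd \<in> borel_measurable \<pi>"
    using measurable_cong_sets[OF \<pi>(2) refl, of borel] by (auto simp: measurable_fst measurable_snd)
  have "integrable (distr \<pi> borel fst) (\<lambda>x. (norm x)\<^sup>2)" "integrable (distr \<pi> borel snd) (\<lambda>x. (norm x)\<^sup>2)"
    using \<mu> \<nu> \<pi> by (auto simp: P2_def)
  then have sq: "fst \<in> sq_integrable \<pi>" "snd \<in> sq_integrable \<pi>"
    using m by (auto simp: sq_integrable_def integrable_distr_eq)
  have "lambda_min (EF fst) powr (1 - q) \<le> (1 - q) * b * L2norm \<pi> (\<lambda>w. fst w - snd w)"
    by (rule distance_to_singular[OF b q sq _ slope])
      (use sing law_integral_F[OF sq(2)] \<pi> in auto)
  then have "lambda_min (\<integral>x. F x \<partial>\<mu>) powr (1 - q) \<le> (1 - q) * b * L2norm \<pi> (\<lambda>w. fst w - snd w)"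
    using law_integral_F[OF sq(1)] \<pi> by simp
  then show "1 / ((1 - q) * b) * lambda_min (\<integral>x. F x \<partial>\<mu>) powr (1 - q) \<le> sqrt (\<integral>z. (norm (fst z - snd z))\<^sup>2 \<partial>\<pi>)"
    using b q by (simp add: L2norm_def field_simps)
qed

end

theorem theorem2p2:
  fixes M :: "'e::euclidean_space set"
    and \<beta>s :: 'e
    and N :: "'y measure"
    and D :: "real^'d \<Rightarrow> 'y measure"
    and loss :: "'e \<Rightarrow> (real^'d) \<times> 'y \<Rightarrow> real"
    and f :: "(real^'d) measure \<Rightarrow> 'e \<Rightarrow> real"
    and e :: "'k::finite \<Rightarrow> 'e"
    and F :: "real^'d \<Rightarrow> real^'k^'k"
    and L q1 q2 a b :: real
  defines "f \<equiv> SP_objective N D loss"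
  assumes manifold: "C2_submanifold CARD('k) M"
    and label_law: "D \<in> borel \<rightarrow>\<^sub>M prob_algebra N"
    and loss_integrable: "\<And>\<mu> \<beta>. \<mu> \<in> P2 \<Longrightarrow> \<beta> \<in> M \<Longrightarrow> integrable (joint_law N D \<mu>) (loss \<beta>)"
    and objective_C2: "\<And>\<mu>. \<mu> \<in> P2 \<Longrightarrow> C2_smooth_on_manifold M (f \<mu>)"
    and in_M: "\<beta>s \<in> M"
    and minimizer: "\<And>\<mu> \<beta>. \<mu> \<in> P2 \<Longrightarrow> \<beta> \<in> M \<Longrightarrow> f \<mu> \<beta>s \<le> f \<mu> \<beta>"
    and basis: "orthonormal_basis_of e (tangent_space M \<beta>s)"
    and F_C1: "C1_on UNIV F"
    and F_psd: "\<And>x. F x \<in> psd_cone"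
    and hessian: "\<And>\<mu>. \<mu> \<in> P2 \<Longrightarrow> has_covariant_hessian M (f \<mu>) \<beta>s e (\<integral>x. F x \<partial>\<mu>)"
    and L_pos: "L > 0"
    and DF_growth: "\<And>x. onorm (frechet_derivative F (at x)) \<le> L * (1 + norm x)"
    and q1: "0 \<le> q1" "q1 < 1"
    and q2: "0 \<le> q2" "q2 < 1"
    and a_pos: "a > 0"
    and b_pos: "b > 0"
    and slope: "\<And>\<nu>. \<nu> \<in> P2 - ill_conditioned P2 M f \<beta>s \<Longrightarrow>
      \<exists>u. norm u = 1 \<and>
          (\<integral>x. F x \<partial>\<nu>) *v u = lambda_min (\<integral>x. F x \<partial>\<nu>) *\<^sub>R u \<and>
          a * lambda_min (\<integral>x. F x \<partial>\<nu>) powr q1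
            \<le> sqrt (\<integral>x. (norm (adjoint (frechet_derivative F (at x)) (outer_square u)))\<^sup>2 \<partial>\<nu>) \<and>
          sqrt (\<integral>x. (norm (adjoint (frechet_derivative F (at x)) (outer_square u)))\<^sup>2 \<partial>\<nu>)
            \<le> b * lambda_min (\<integral>x. F x \<partial>\<nu>) powr q2"
  shows "\<exists>C1>0. \<exists>C2>0. \<forall>\<mu>\<in>P2.
    ereal (C1 * ereal_npowr (REG M (f \<mu>) \<beta>s) (q2 - 1)) \<le> RSE P2 M f \<beta>s \<mu> \<and>
    RSE P2 M f \<beta>s \<mu> \<le> ereal (C2 * ereal_npowr (REG M (f \<mu>) \<beta>s) (q1 - 1))"
proof -
  interpret psd_map F L by unfold_locales (fact F_C1 F_psd L_pos DF_growth)+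
  let ?l = "\<lambda>\<mu>. lambda_min (\<integral>x. F x \<partial>\<mu>)"
  have nonneg: "0 \<le> ?l \<mu>" if "\<mu> \<in> P2" for \<mu>
    by (rule lambda_min_nonneg[OF integral_F_psd[OF that]])
  have stable: "tilt_stable M (f \<mu>) \<beta>s \<longleftrightarrow> 0 < ?l \<mu>"
    and REG_eq: "REG M (f \<mu>) \<beta>s = (if 0 < ?l \<mu> then ereal (1 / ?l \<mu>) else \<infinity>)"
    if "\<mu> \<in> P2" for \<mu>
    using tilt_stable_REG[OF manifold in_M basis objective_C2[OF that] minimizer[OF that]
        hessian[OF that] integral_F_psd[OF that]] by blast+
  have ill: "\<nu> \<in> ill_conditioned P2 M f \<beta>s \<longleftrightarrow> \<nu> \<in> P2 \<and> ?l \<nu> = 0" for \<nu>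
    using stable nonneg unfolding ill_conditioned_def by force
  \<comment> \<open>At l = 0 the convention for an infinite modulus agrees with
    \<open>0 powr s = 0\<close>, so one formula serves well-conditioned and ill-conditioned measures
    alike.\<close>
  have pow: "ereal_npowr (REG M (f \<mu>) \<beta>s) (q - 1) = ?l \<mu> powr (1 - q)" if "\<mu> \<in> P2" for \<mu> q
  proof (cases "0 < ?l \<mu>")
    case True
    then have "(1 / ?l \<mu>) powr (q - 1) = ?l \<mu> powr (1 - q)"
      by (simp add: powr_divide powr_minus_divide[symmetric])
    then show ?thesis using True by (simp add: REG_eq[OF that] ereal_npowr_def)
  next
    case False
    then have "?l \<mu> = 0" using nonneg[OF that] by simp
    then show ?thesis by (simp add: REG_eq[OF that] ereal_npowr_def)
  qed
  have slope': "\<exists>u. norm u = 1 \<and> (\<integral>x. F x \<partial>\<nu>) *v u = ?l \<nu> *\<^sub>R u \<and>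
      a * ?l \<nu> powr q1 \<le> sqrt (\<integral>x. (norm (V u x))\<^sup>2 \<partial>\<nu>) \<and>
      sqrt (\<integral>x. (norm (V u x))\<^sup>2 \<partial>\<nu>) \<le> b * ?l \<nu> powr q2"
    if "\<nu> \<in> P2" "0 < ?l \<nu>" for \<nu>
    unfolding V_def by (rule slope) (use that ill in auto)
  show ?thesis
  proof (intro exI conjI ballI)
    \<comment> \<open>These are the reciprocals of the growth rate (1 - q2) b and of the halved
      descent rate (1 - q1) a / 2.\<close>
    show "0 < 1 / ((1 - q2) * b)" "0 < 2 / ((1 - q1) * a)" using q1 q2 a_pos b_pos by auto
    fix \<mu> :: "(real^'d) measure" assume \<mu>: "\<mu> \<in> P2"
    show "ereal (1 / ((1 - q2) * b) * ereal_npowr (REG M (f \<mu>) \<beta>s) (q2 - 1)) \<le> RSE P2 M f \<beta>s \<mu>"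
      unfolding RSE_def W2_set_def pow[OF \<mu>]
    proof (rule INF_greatest)
      fix \<nu> assume "\<nu> \<in> ill_conditioned P2 M f \<beta>s"
      then have "\<nu> \<in> P2" "?l \<nu> = 0" using ill by auto
      then have "1 / ((1 - q2) * b) * ?l \<mu> powr (1 - q2) \<le> W2 \<mu> \<nu>"
        using W2_singular_lower[OF b_pos q2 \<mu>] slope' by blast
      then show "ereal (1 / ((1 - q2) * b) * ?l \<mu> powr (1 - q2)) \<le> ereal (W2 \<mu> \<nu>)" by simp
    qed
    \<comment> \<open>This measure also shows that the ill-conditioned set is nonempty, so that the
      infimum defining \<open>RSE\<close> is finite.\<close>
    obtain \<nu> where "\<nu> \<in> P2" "?l \<nu> = 0" "W2 \<mu> \<nu> \<le> 2 / ((1 - q1) * a) * ?l \<mu> powr (1 - q1)"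
      using W2_singular_upper[OF a_pos q1 \<mu>] slope' by blast
    then show "RSE P2 M f \<beta>s \<mu> \<le> ereal (2 / ((1 - q1) * a) * ereal_npowr (REG M (f \<mu>) \<beta>s) (q1 - 1))"
      unfolding RSE_def W2_set_def pow[OF \<mu>] using ill by (intro INF_lower2[of \<nu>]) auto
  qed
qed

end
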